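(* For every $f\in\mathbf{P}$, $$E\Big[\mathcal{E}\Big(\int\dot Z\,dW\Big)_1\,f\Big(W-\int_0^{\cdot}\dot Z(s)\,ds\Big)\Big]=E\big[f(W)\big].$$
   Context: $(\mathscr{W},\mathscr{B}(\mathscr{W}),\gamma)$ is the Wiener space: $\mathscr{W}$ is the set of continuous paths $w:[0,1]\to\mathbb{R}$ with $w(0)=0$, with the $\sigma$-field generated by the topology of uniform convergence, and $\gamma$ is Wiener measure; $W(t,w)=w(t)$ is the canonical Wiener process and $E$ is expectation under $\gamma$. $\mathscr{H}\subset\mathscr{W}$ is the Cameron-Martin space of absolutely continuous $h$ with square-integrable derivative $\dot h$, with inner product $\langle h_1,h_2\rangle=\int_0^1\dot h_1(t)\dot h_2(t)\,dt$. For $h\in\mathscr{H}$, $[h](w):=\int_0^1\dot h(t)\,dw(t)$ (Wiener integral); translations by $\mathscr{H}$-valued (possibly random) elements are understood via $[h](w-Z(w))=[h](w)-\langle h,Z(w)\rangle$. $\mathbf{P}$ is the algebra of polynomial functionals $F(w)=p([h_1](w),\dots,[h_n](w))$, with $n\in\mathbb{N}$, $h_i\in\mathscr{H}$, $p$ a real polynomial in $n$ variables. For a martingale $M$, $\mathcal{E}(M)_t=\exp\{M(t)-\frac12\langle M\rangle(t)\}$. Standing assumptions on $Z$: $Z:\mathscr{W}\to\mathscr{H}$ is a predictable map, i.e. $\dot Z(t)$, $0\le t\le1$, is a predictable process with $\|Z\|_{\mathscr{H}}^2=\int_0^1\dot Z(s)^2ds<\infty$ a.s., and $\mathcal{E}(\int\dot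 Z\,dW)$ is a true martingale. *)

theory Defs
  imports "HOL-Probability.Probability" "HOL-Library.Poly_Mapping"
begin

section \<open>Wiener space\<close>

text \<open>Paths on \<open>[0,1]\<close> are functions on \<^typ>\<open>real\<close> that are extensional on \<open>{0..1}\<close>;
  \<open>cfunspace\<close> carries the supremum metric.\<close>

type_synonym path = "real \<Rightarrow> real"

definition path_metric :: "path metric" where
  "path_metric = submetric (cfunspace (top_of_set {0..1}) euclidean_metric) {w. w 0 = 0}"

definition path_borel :: "path measure" where
  "path_borel = sigma (mspace path_metric) {U. openin (mtopology_of path_metric) U}"

definition wiener_measure :: "path measure \<Rightarrow> bool" where
  "wiener_measure \<gamma> \<longleftrightarrow>
     prob_space \<gamma> \<and> sets \<gamma> = sets path_borel \<and>
     (\<forall>s t. 0 \<le> s \<and> s < t \<and> t \<le> 1 \<longrightarrow>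
        distributed \<gamma> lborel (\<lambda>w. w t - w s)
          (\<lambda>x. ennreal (normal_density 0 (sqrt (t - s)) x))) \<and>
     (\<forall>(n::nat) t. 0 \<le> t 0 \<and> t n \<le> 1 \<and> (\<forall>i<n. t i < t (Suc i)) \<longrightarrow>
        prob_space.indep_vars \<gamma> (\<lambda>_. borel) (\<lambda>i w. w (t (Suc i)) - w (t i)) {..<n})"

text \<open>All random variables below are considered on the completion of \<open>\<gamma>\<close>, and the filtration
  is the canonical one augmented by the null sets.\<close>

definition wiener_filtration :: "path measure \<Rightarrow> real \<Rightarrow> path measure" where
  "wiener_filtration \<gamma> t = sigma (space \<gamma>)
     ({(\<lambda>w. w s) -` B \<inter> space \<gamma> | s B. s \<in> {0..t} \<and> B \<in> sets (borel :: real measure)}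
      \<union> null_sets (completion \<gamma>))"

definition adapted_process :: "path measure \<Rightarrow> (real \<Rightarrow> path \<Rightarrow> real) \<Rightarrow> bool" where
  "adapted_process \<gamma> X \<longleftrightarrow> (\<forall>t\<in>{0..1}. X t \<in> borel_measurable (wiener_filtration \<gamma> t))"

definition continuous_process :: "path measure \<Rightarrow> (real \<Rightarrow> path \<Rightarrow> real) \<Rightarrow> bool" where
  "continuous_process \<gamma> X \<longleftrightarrow> (AE w in \<gamma>. continuous_on {0..1} (\<lambda>t. X t w))"

definition predictable_sigma :: "path measure \<Rightarrow> (real \<times> path) measure" where
  "predictable_sigma \<gamma> = sigma ({0..1} \<times> space \<gamma>)
     ({{0} \<times> A | A. A \<in> sets (wiener_filtration \<gamma> 0)} \<union>
      {{s<..t} \<times> A | s t A. 0 \<le> s \<and> s < t \<and> t \<le> 1 \<and> A \<in> sets (wiener_filtration \<gamma> s)})"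

definition predictable_process :: "path measure \<Rightarrow> (real \<Rightarrow> path \<Rightarrow> real) \<Rightarrow> bool" where
  "predictable_process \<gamma> X \<longleftrightarrow> (\<lambda>(t, w). X t w) \<in> borel_measurable (predictable_sigma \<gamma>)"

definition martingale :: "path measure \<Rightarrow> (real \<Rightarrow> path \<Rightarrow> real) \<Rightarrow> bool" where
  "martingale \<gamma> X \<longleftrightarrow>
     adapted_process \<gamma> X \<and>
     (\<forall>t\<in>{0..1}. integrable (completion \<gamma>) (X t)) \<and>
     (\<forall>s t. 0 \<le> s \<and> s \<le> t \<and> t \<le> 1 \<longrightarrow>
        (AE w in completion \<gamma>.
           real_cond_exp (completion \<gamma>) (wiener_filtration \<gamma> s) (X t) w = X s w))"


section \<open>The Cameron-Martin space\<close>

definition absolutely_continuous_path :: "path \<Rightarrow> bool" where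
  "absolutely_continuous_path h \<longleftrightarrow>
     (\<forall>\<epsilon>>0. \<exists>\<delta>>0. \<forall>(n::nat) a b.
        (\<forall>i<n. 0 \<le> a i \<and> a i \<le> b i \<and> b i \<le> 1) \<and>
        (\<forall>i<n. \<forall>j<n. i \<noteq> j \<longrightarrow> {a i<..<b i} \<inter> {a j<..<b j} = {}) \<and>
        (\<Sum>i<n. b i - a i) < \<delta>
        \<longrightarrow> (\<Sum>i<n. \<bar>h (b i) - h (a i)\<bar>) < \<epsilon>)"

definition square_integrable :: "(real \<Rightarrow> real) \<Rightarrow> bool" where
  "square_integrable g \<longleftrightarrow>
     g \<in> borel_measurable (lebesgue_on {0..1}) \<and> integrable (lebesgue_on {0..1}) (\<lambda>t. (g t)\<^sup>2)"

text \<open>An absolutely continuous path is differentiable almost everywhere; on the remaining null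
  set the value of \<^const>\<open>deriv\<close> is irrelevant.\<close>

definition cameron_martin :: "path set" where
  "cameron_martin =
     {h \<in> mspace path_metric. absolutely_continuous_path h \<and> square_integrable (deriv h)}"

definition cm_inner :: "path \<Rightarrow> path \<Rightarrow> real" where
  "cm_inner h1 h2 = (\<integral>t. deriv h1 t * deriv h2 t \<partial>lebesgue_on {0..1})"

text \<open>A predictable map \<open>Z\<close> into the Cameron-Martin space, where \<open>Zdot\<close> is the predictable
  version of the (only almost everywhere defined) derivative. Membership in
  \<^const>\<open>cameron_martin\<close> contains the finiteness of \<open>\<integral>\<^sub>0\<^sup>1 Zdot(s)\<^sup>2 ds\<close>.\<close>

definition predictable_map ::
    "path measure \<Rightarrow> (path \<Rightarrow> path) \<Rightarrow> (real \<Rightarrow> path \<Rightarrow> real) \<Rightarrow> bool" where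
  "predictable_map \<gamma> Z Zdot \<longleftrightarrow>
     predictable_process \<gamma> Zdot \<and>
     (AE w in \<gamma>. Z w \<in> cameron_martin \<and>
        (AE t in lebesgue_on {0..1}. (Z w has_real_derivative Zdot t w) (at t)))"


section \<open>Stochastic integrals\<close>

definition time_grid :: "nat \<Rightarrow> (nat \<Rightarrow> real) \<Rightarrow> bool" where
  "time_grid n t \<longleftrightarrow> 0 \<le> t 0 \<and> t n \<le> 1 \<and> (\<forall>i<n. t i \<le> t (Suc i))"

definition step_process ::
    "nat \<Rightarrow> (nat \<Rightarrow> real) \<Rightarrow> (nat \<Rightarrow> path \<Rightarrow> real) \<Rightarrow> real \<Rightarrow> path \<Rightarrow> real" where
  "step_process n t \<xi> s w = (\<Sum>i<n. \<xi> i w * indicator {t i<..t (Suc i)} s)"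

definition step_integral ::
    "nat \<Rightarrow> (nat \<Rightarrow> real) \<Rightarrow> (nat \<Rightarrow> path \<Rightarrow> real) \<Rightarrow> real \<Rightarrow> path \<Rightarrow> real" where
  "step_integral n t \<xi> s w = (\<Sum>i<n. \<xi> i w * (w (min s (t (Suc i))) - w (min s (t i))))"

text \<open>\<open>J\<close> is a version of the Wiener integral \<open>[h] = \<integral>\<^sub>0\<^sup>1 h'(t) dw(t)\<close>, the limit in
  \<open>L\<^sup>2(\<gamma>)\<close> of the integrals of deterministic step functions tending to the derivative of \<open>h\<close>
  in \<open>L\<^sup>2[0,1]\<close>.\<close>

definition wiener_integral :: "path measure \<Rightarrow> path \<Rightarrow> (path \<Rightarrow> real) \<Rightarrow> bool" where
  "wiener_integral \<gamma> h J \<longleftrightarrow>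
     J \<in> borel_measurable (completion \<gamma>) \<and>
     (\<exists>n t c. (\<forall>k::nat. time_grid (n k) (t k)) \<and>
        (\<lambda>k. \<integral>\<^sup>+ s. ennreal (((\<Sum>i<n k. c k i * indicator {t k i<..t k (Suc i)} s) - deriv h s)\<^sup>2)
              \<partial>lebesgue_on {0..1}) \<longlonglongrightarrow> 0 \<and>
        (\<lambda>k. \<integral>\<^sup>+ w. ennreal (((\<Sum>i<n k. c k i * (w (t k (Suc i)) - w (t k i))) - J w)\<^sup>2)
              \<partial>completion \<gamma>) \<longlonglongrightarrow> 0)"

definition simple_integrand ::
    "path measure \<Rightarrow> nat \<Rightarrow> (nat \<Rightarrow> real) \<Rightarrow> (nat \<Rightarrow> path \<Rightarrow> real) \<Rightarrow> bool" where
  "simple_integrand \<gamma> n t \<xi> \<longleftrightarrow>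
     time_grid n t \<and>
     (\<forall>i<n. \<xi> i \<in> borel_measurable (wiener_filtration \<gamma> (t i)) \<and>
            (\<exists>C. \<forall>w\<in>space \<gamma>. \<bar>\<xi> i w\<bar> \<le> C))"

text \<open>\<open>M\<close> is a version of the Ito integral process \<open>\<integral> X dW\<close> of a predictable \<open>X\<close> with
  \<open>\<integral>\<^sub>0\<^sup>1 X(s)\<^sup>2 ds < \<infinity>\<close> almost surely: simple integrands approximate \<open>X\<close> in
  \<open>L\<^sup>2[0,1]\<close> in probability, and their integrals approximate \<open>M\<close> uniformly on \<open>[0,1]\<close> in
  probability. This determines \<open>M\<close> up to indistinguishability.\<close>

definition ito_integral ::
    "path measure \<Rightarrow> (real \<Rightarrow> path \<Rightarrow> real) \<Rightarrow> (real \<Rightarrow> path \<Rightarrow> real) \<Rightarrow> bool" where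
  "ito_integral \<gamma> X M \<longleftrightarrow>
     predictable_process \<gamma> X \<and>
     (AE w in \<gamma>. (\<integral>\<^sup>+ s. ennreal ((X s w)\<^sup>2) \<partial>lebesgue_on {0..1}) < \<infinity>) \<and>
     adapted_process \<gamma> M \<and> continuous_process \<gamma> M \<and>
     (\<exists>n t \<xi>. (\<forall>k::nat. simple_integrand \<gamma> (n k) (t k) (\<xi> k)) \<and>
        (\<forall>\<epsilon>>0::real.
          (\<lambda>k. measure (completion \<gamma>)
                {w \<in> space \<gamma>. (\<integral>\<^sup>+ s. ennreal ((step_process (n k) (t k) (\<xi> k) s w - X s w)\<^sup>2)
                                 \<partial>lebesgue_on {0..1}) > ennreal \<epsilon>}) \<longlonglongrightarrow> 0 \<and>
          (\<lambda>k. measure (completion \<gamma>)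
                {w \<in> space \<gamma>. \<exists>s\<in>{0..1}. \<bar>step_integral (n k) (t k) (\<xi> k) s w - M s w\<bar> > \<epsilon>})
             \<longlonglongrightarrow> 0))"

text \<open>\<open>A\<close> is a version of the bracket \<open>\<langle>M\<rangle>\<close> of the continuous process \<open>M\<close>: the limit in
  probability of the sums of squared increments as the mesh tends to zero.\<close>

definition quadratic_variation ::
    "path measure \<Rightarrow> (real \<Rightarrow> path \<Rightarrow> real) \<Rightarrow> (real \<Rightarrow> path \<Rightarrow> real) \<Rightarrow> bool" where
  "quadratic_variation \<gamma> M A \<longleftrightarrow>
     adapted_process \<gamma> M \<and> continuous_process \<gamma> M \<and>
     adapted_process \<gamma> A \<and> continuous_process \<gamma> A \<and>
     (\<forall>t\<in>{0..1}. \<forall>\<epsilon>>0. \<exists>\<delta>>0. \<forall>(n::nat) s.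
        s 0 = 0 \<and> s n = t \<and> (\<forall>i<n. s i \<le> s (Suc i) \<and> s (Suc i) - s i < \<delta>) \<longrightarrow>
        measure (completion \<gamma>)
          {w \<in> space \<gamma>. \<bar>(\<Sum>i<n. (M (s (Suc i)) w - M (s i) w)\<^sup>2) - A t w\<bar> > \<epsilon>} < \<epsilon>)"

definition stochastic_exponential ::
    "(real \<Rightarrow> path \<Rightarrow> real) \<Rightarrow> (real \<Rightarrow> path \<Rightarrow> real) \<Rightarrow> real \<Rightarrow> path \<Rightarrow> real" where
  "stochastic_exponential M A t w = exp (M t w - A t w / 2)"


section \<open>Polynomial functionals\<close>

text \<open>Polynomials in \<open>n\<close> real variables are finitely supported coefficient families indexed by
  monomials, i.e. by exponent vectors supported in \<open>{..<n}\<close>.\<close>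

definition poly_eval :: "((nat \<Rightarrow>\<^sub>0 nat) \<Rightarrow>\<^sub>0 real) \<Rightarrow> (nat \<Rightarrow> real) \<Rightarrow> real" where
  "poly_eval p x =
     (\<Sum>m\<in>Poly_Mapping.keys p. Poly_Mapping.lookup p m *
        (\<Prod>i\<in>Poly_Mapping.keys m. x i ^ Poly_Mapping.lookup m i))"

definition polynomial_in :: "nat \<Rightarrow> ((nat \<Rightarrow>\<^sub>0 nat) \<Rightarrow>\<^sub>0 real) \<Rightarrow> bool" where
  "polynomial_in n p \<longleftrightarrow> (\<forall>m\<in>Poly_Mapping.keys p. Poly_Mapping.keys m \<subseteq> {..<n})"

text \<open>A polynomial functional \<open>p([h\<^sub>1],\<dots>,[h\<^sub>n])\<close> sees a point of Wiener space only through the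
  map \<open>h \<mapsto> [h](w)\<close>, so it is represented as a function \<open>f\<close> of such a map. Thus \<open>f(W)\<close> is \<open>f\<close> at
  \<open>h \<mapsto> [h](w)\<close>, and the translate \<open>f(W - Z)\<close> is \<open>f\<close> at \<open>h \<mapsto> [h](w) - \<langle>h, Z(w)\<rangle>\<close>.\<close>

definition polynomial_functionals :: "((path \<Rightarrow> real) \<Rightarrow> real) set" where
  "polynomial_functionals =
     {\<lambda>\<omega>. poly_eval p (\<lambda>i. \<omega> (h i)) | n p h.
        polynomial_in n p \<and> (\<forall>i<n. h i \<in> cameron_martin)}"

end

theory Submission
  imports Defs
begin

text \<open>
  Let \<open>D = \<E>(\<integral> Zdot dW)\<^sub>1\<close>. Approximate \<open>Zdot\<close> by bounded simple integrands \<open>X\<^sub>k\<close> and a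
  deterministic \<open>g\<close> in \<open>L\<^sup>2[0,1]\<close> by step functions \<open>c\<^sub>k\<close>. On a grid, a Gaussian computation
  conditional on the past gives \<open>E[D\<^sub>k exp(i (\<integral> c\<^sub>k dW - \<integral> c\<^sub>k X\<^sub>k ds))] = exp(- \<parallel>c\<^sub>k\<parallel>\<^sup>2 / 2)\<close>, where
  \<open>D\<^sub>k\<close> is the stochastic exponential of \<open>X\<^sub>k\<close> and \<open>E[D\<^sub>k] = 1\<close>. The martingale hypothesis enters only
  through \<open>E[D] = 1\<close>: with it, Scheffe's lemma turns convergence of \<open>D\<^sub>k\<close> to \<open>D\<close> in probability into
  convergence in \<open>L\<^sup>1\<close>, so that no localisation by stopping times is needed. Hence, under \<open>D \<gamma>\<close>, the
  variable \<open>\<integral> g dW - \<integral> g Zdot ds\<close> has the Gaussian law of \<open>\<integral> g dW\<close> under \<open>\<gamma>\<close>. So all moments of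
  linear combinations of the \<open>[h\<^sub>i]\<close> agree, and by polarization all polynomial moments agree. That
  the bracket of the Ito integral is \<open>\<integral> Zdot\<^sup>2 ds\<close> is obtained from partitions refining the grid of
  \<open>X\<^sub>k\<close>.
\<close>

section \<open>Square-integrable functions\<close>

text \<open>Two obstacles shape the proof. First, \<open>D\<close> is known to be integrable and
  nothing more, so no Hoelder estimate can bound \<open>D\<close> times a polynomial. Laws are
  therefore compared before moments: once the characteristic functions agree, both the integrability
  and the values of the moments under the tilted measure are read off a Gaussian law. Second, the
  bracket is a limit along partitions, while the Ito integral is a uniform limit of simple
  integrals, and a small uniform error can still give a large sum of squared increments when the
  number of cells grows. So the partition is fixed first, and only then a later index
  \<open>m\<close> is chosen for which the increments of \<open>M\<close> and of the simple integral
  number \<open>m\<close> are close on it. The gap between the simple integrals number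
  \<open>m\<close> and \<open>k\<close> is controlled by an estimate that sees only the energy of
  the difference of the integrands, not the partition.\<close>

lemma abs_mult_le_sum_squares: "\<bar>a * b\<bar> \<le> a\<^sup>2 + (b :: real)\<^sup>2"
proof -
  have "0 \<le> \<bar>a\<bar> * \<bar>b\<bar>" "2 * \<bar>a\<bar> * \<bar>b\<bar> \<le> a\<^sup>2 + b\<^sup>2"
    using sum_squares_bound[of "\<bar>a\<bar>" "\<bar>b\<bar>"] by simp_all
  then show ?thesis unfolding abs_mult by linarith
qed

lemma integrable_mult_of_squares:
  fixes f g :: "'a \<Rightarrow> real"
  assumes "f \<in> borel_measurable M" "g \<in> borel_measurable M"
    and "integrable M (\<lambda>x. (f x)\<^sup>2)" "integrable M (\<lambda>x. (g x)\<^sup>2)"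
  shows "integrable M (\<lambda>x. f x * g x)"
proof (rule Bochner_Integration.integrable_bound)
  show "integrable M (\<lambda>x. (f x)\<^sup>2 + (g x)\<^sup>2)" using assms by simp
  have "\<bar>a * b\<bar> \<le> a\<^sup>2 + b\<^sup>2" for a b :: real
    by (rule abs_mult_le_sum_squares)
  then show "AE x in M. norm (f x * g x) \<le> norm ((f x)\<^sup>2 + (g x)\<^sup>2)" by simp
qed (use assms in simp)

lemma integrable_diff_square:
  fixes f g :: "'a \<Rightarrow> real"
  assumes "f \<in> borel_measurable M" "g \<in> borel_measurable M"
    and "integrable M (\<lambda>x. (f x)\<^sup>2)" "integrable M (\<lambda>x. (g x)\<^sup>2)"
  shows "integrable M (\<lambda>x. (f x - g x)\<^sup>2)"
proof -
  have "integrable M (\<lambda>x. (f x)\<^sup>2 + (g x)\<^sup>2 - 2 * (f x * g x))"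
    using integrable_mult_of_squares[OF assms] assms by simp
  then show ?thesis by (simp add: power2_diff mult.assoc)
qed

text \<open>Continuity of the L2 pairing. The difference of the products splits into three terms,
  each with at least one factor that tends to 0; a weighted version of
  \<open>abs_mult_le_sum_squares\<close> separates the factors.\<close>

lemma tendsto_integral_mult_L2:
  fixes f g :: "nat \<Rightarrow> 'a \<Rightarrow> real"
  assumes f: "\<And>k. f k \<in> borel_measurable M" "\<And>k. integrable M (\<lambda>x. (f k x)\<^sup>2)"
      and f': "f' \<in> borel_measurable M" "integrable M (\<lambda>x. (f' x)\<^sup>2)"
      and g: "\<And>k. g k \<in> borel_measurable M" "\<And>k. integrable M (\<lambda>x. (g k x)\<^sup>2)"
      and g': "g' \<in> borel_measurable M" "integrable M (\<lambda>x. (g' x)\<^sup>2)"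
      and lim: "(\<lambda>k. \<integral>x. (f k x - f' x)\<^sup>2 \<partial>M) \<longlonglongrightarrow> 0" "(\<lambda>k. \<integral>x. (g k x - g' x)\<^sup>2 \<partial>M) \<longlonglongrightarrow> 0"
  shows "(\<lambda>k. \<integral>x. f k x * g k x \<partial>M) \<longlonglongrightarrow> (\<integral>x. f' x * g' x \<partial>M)"
proof (rule LIMSEQ_I)
  fix e :: real assume e: "e > 0"
  define K where "K = (\<integral>x. (f' x)\<^sup>2 \<partial>M) + (\<integral>x. (g' x)\<^sup>2 \<partial>M) + 1"
  define V where "V k = (\<integral>x. (f k x - f' x)\<^sup>2 \<partial>M) + (\<integral>x. (g k x - g' x)\<^sup>2 \<partial>M)" for k
  \<comment> \<open>The weight in ab \<le> a^2/h + h b^2. It is so small that the part that does not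
    vanish, \<open>h * K\<close>, costs \<open>e / 2\<close>; the factor \<open>1 / h\<close> falls
    on \<open>V k\<close>, which tends to 0. The summand 1 in \<open>K\<close> keeps the quotient
    meaningful.\<close>
  define h where "h = e / (2 * K)"
  have K: "K \<ge> 1" unfolding K_def by simp
  then have h: "h > 0" "h * K = e / 2" using e by (simp_all add: h_def)
  have am: "\<bar>a * b\<bar> \<le> a\<^sup>2 / h + h * b\<^sup>2" for a b :: real
  proof -
    have "\<bar>a * b\<bar> = \<bar>a * (h * b)\<bar> / h" using h by (simp add: abs_mult)
    also have "\<dots> \<le> (a\<^sup>2 + (h * b)\<^sup>2) / h"
      using h by (intro divide_right_mono abs_mult_le_sum_squares) simp
    also have "\<dots> = a\<^sup>2 / h + h * b\<^sup>2" using h by (simp add: add_divide_distrib power2_eq_square)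
    finally show ?thesis .
  qed
  have bound: "\<bar>(\<integral>x. f k x * g k x \<partial>M) - (\<integral>x. f' x * g' x \<partial>M)\<bar> \<le> (1 + 1 / h) * V k + h * K" for k
  proof -
    have df: "integrable M (\<lambda>x. (f k x - f' x)\<^sup>2)" and dg: "integrable M (\<lambda>x. (g k x - g' x)\<^sup>2)"
      using f f' g g' by (intro integrable_diff_square; simp)+
    let ?R = "\<lambda>x. (1 + 1 / h) * ((f k x - f' x)\<^sup>2 + (g k x - g' x)\<^sup>2) + h * ((f' x)\<^sup>2 + (g' x)\<^sup>2)"
    have i1: "integrable M (\<lambda>x. f k x * g k x)" "integrable M (\<lambda>x. f' x * g' x)"
      using f f' g g' by (intro integrable_mult_of_squares; simp)+
    have iR: "integrable M ?R" using df dg f'(2) g'(2) by (intro Bochner_Integration.integrable_add integrable_mult_right)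
    have pt: "\<bar>f k x * g k x - f' x * g' x\<bar> \<le> ?R x" for x
    proof -
      have "f k x * g k x - f' x * g' x = (f k x - f' x) * (g k x - g' x) + (f k x - f' x) * g' x + (g k x - g' x) * f' x"
        by (simp add: algebra_simps)
      then have "\<bar>f k x * g k x - f' x * g' x\<bar> \<le> \<bar>(f k x - f' x) * (g k x - g' x)\<bar> + \<bar>(f k x - f' x) * g' x\<bar> + \<bar>(g k x - g' x) * f' x\<bar>"
        by linarith
      also have "\<dots> \<le> ((f k x - f' x)\<^sup>2 + (g k x - g' x)\<^sup>2) + ((f k x - f' x)\<^sup>2 / h + h * (g' x)\<^sup>2) + ((g k x - g' x)\<^sup>2 / h + h * (f' x)\<^sup>2)"
        by (intro add_mono am abs_mult_le_sum_squares)
      also have "\<dots> = ?R x" by (simp add: algebra_simps add_divide_distrib)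
      finally show ?thesis .
    qed
    have "\<bar>(\<integral>x. f k x * g k x \<partial>M) - (\<integral>x. f' x * g' x \<partial>M)\<bar> = \<bar>\<integral>x. f k x * g k x - f' x * g' x \<partial>M\<bar>"
      using i1 by simp
    also have "\<dots> \<le> (\<integral>x. \<bar>f k x * g k x - f' x * g' x\<bar> \<partial>M)"
      by (rule integral_abs_bound)
    also have "\<dots> \<le> (\<integral>x. ?R x \<partial>M)"
      using i1 iR pt by (intro integral_mono) auto
    also have "\<dots> = (1 + 1 / h) * V k + h * (K - 1)"
      using df dg f'(2) g'(2) by (simp add: V_def K_def)
    also have "\<dots> \<le> (1 + 1 / h) * V k + h * K" using h by simp
    finally show ?thesis .
  qed
  have "(\<lambda>k. (1 + 1 / h) * V k) \<longlonglongrightarrow> (1 + 1 / h) * (0 + 0)"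
    unfolding V_def by (intro tendsto_intros lim)
  then have "eventually (\<lambda>k. (1 + 1 / h) * V k < e / 2) sequentially"
    using e by (intro order_tendstoD) auto
  then have "eventually (\<lambda>k. \<bar>(\<integral>x. f k x * g k x \<partial>M) - (\<integral>x. f' x * g' x \<partial>M)\<bar> < e) sequentially"
  proof eventually_elim
    case (elim k)
    then show ?case using bound[of k] h by linarith
  qed
  then show "\<exists>no. \<forall>n\<ge>no. norm ((\<integral>x. f n x * g n x \<partial>M) - (\<integral>x. f' x * g' x \<partial>M)) < e"
    by (simp add: eventually_sequentially)
qed

text \<open>Reverse triangle inequality. It makes the root of a sum of squared increments Lipschitz
  in the process, which is how the sums for \<open>M\<close> are later compared with those for
  simple integrals.\<close>

lemma L2_set_diff_bound:
  "\<bar>L2_set f A - L2_set g A\<bar> \<le> L2_set (\<lambda>i. f i - g i) A"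
proof -
  have "L2_set f A \<le> L2_set (\<lambda>i. f i - g i) A + L2_set g A"
    using L2_set_triangle_ineq[of "\<lambda>i. f i - g i" g A] by simp
  moreover have "L2_set g A \<le> L2_set (\<lambda>i. f i - g i) A + L2_set f A"
    using L2_set_triangle_ineq[of "\<lambda>i. g i - f i" f A] by (simp add: L2_set_def power2_commute)
  ultimately show ?thesis by linarith
qed

lemma square_diff_le: "(a - c)\<^sup>2 \<le> 2 * (a - b)\<^sup>2 + 2 * (b - c :: real)\<^sup>2"
proof -
  have "2 * (a - b)\<^sup>2 + 2 * (b - c)\<^sup>2 - (a - c)\<^sup>2 = ((a - b) - (b - c))\<^sup>2"
    by (simp add: power2_eq_square algebra_simps)
  then show ?thesis using zero_le_power2[of "(a - b) - (b - c)"] by linarith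
qed

section \<open>Convergence in probability\<close>

lemma tendsto_zero_mono:
  fixes f g :: "nat \<Rightarrow> real"
  assumes "g \<longlonglongrightarrow> 0" "\<And>k. 0 \<le> f k" "\<And>k. f k \<le> g k"
  shows "f \<longlonglongrightarrow> 0"
  by (rule tendsto_sandwich[OF _ _ tendsto_const assms(1)]) (use assms in simp_all)

context prob_space
begin

abbreviation "tail_prob X e \<equiv> prob {w \<in> space M. \<bar>X w\<bar> > (e::real)}"

text \<open>Measurability belongs to the notion because \<open>measure\<close> carries no
  information on sets that are not measurable; the closure rules then propagate it along with the
  limit.\<close>

definition vanishes_in_prob :: "(nat \<Rightarrow> 'a \<Rightarrow> real) \<Rightarrow> bool" where
  "vanishes_in_prob X \<longleftrightarrow> (\<forall>k. X k \<in> borel_measurable M) \<and>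
     (\<forall>e>0. (\<lambda>k. tail_prob (X k) e) \<longlonglongrightarrow> 0)"

lemma vanishes_in_probD:
  assumes "vanishes_in_prob X"
  shows "X k \<in> borel_measurable M" and "e > 0 \<Longrightarrow> (\<lambda>k. tail_prob (X k) e) \<longlonglongrightarrow> 0"
  using assms by (auto simp: vanishes_in_prob_def)

lemma abs_gt_sets:
  "X \<in> borel_measurable M \<Longrightarrow> {w \<in> space M. \<bar>X w\<bar> > (e::real)} \<in> sets M"
  by measurable

lemma vanishes_in_prob_mono:
  assumes X: "vanishes_in_prob X" and Y: "\<And>k. Y k \<in> borel_measurable M"
    and le: "\<And>k. AE w in M. \<bar>Y k w\<bar> \<le> \<bar>X k w\<bar>"
  shows "vanishes_in_prob Y"
  unfolding vanishes_in_prob_def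
proof (intro conjI allI impI Y)
  fix e :: real assume e: "e > 0"
  show "(\<lambda>k. tail_prob (Y k) e) \<longlonglongrightarrow> 0"
  proof (rule tendsto_zero_mono[OF vanishes_in_probD(2)[OF X e]])
    show "tail_prob (Y k) e \<le> tail_prob (X k) e" for k
    proof (rule finite_measure_mono_AE)
      show "AE w in M. w \<in> {w \<in> space M. \<bar>Y k w\<bar> > e} \<longrightarrow> w \<in> {w \<in> space M. \<bar>X k w\<bar> > e}"
        using le[of k] by eventually_elim auto
    qed (rule abs_gt_sets[OF vanishes_in_probD(1)[OF X]])
  qed simp
qed

lemma vanishes_in_prob_subseq:
  "vanishes_in_prob X \<Longrightarrow> filterlim m at_top sequentially \<Longrightarrow> vanishes_in_prob (\<lambda>k. X (m k))"
  unfolding vanishes_in_prob_def using filterlim_compose by blast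

lemma vanishes_in_prob_cmult:
  assumes X: "vanishes_in_prob X"
  shows "vanishes_in_prob (\<lambda>k w. c * X k w)"
  unfolding vanishes_in_prob_def
proof (intro conjI allI impI)
  show "(\<lambda>w. c * X k w) \<in> borel_measurable M" for k using vanishes_in_probD(1)[OF X] by simp
  fix e :: real assume e: "e > 0"
  show "(\<lambda>k. tail_prob (\<lambda>w. c * X k w) e) \<longlonglongrightarrow> 0"
  proof (cases "c = 0")
    case False
    then have "\<bar>c * X k w\<bar> > e \<longleftrightarrow> \<bar>X k w\<bar> > e / \<bar>c\<bar>" for k w by (simp add: abs_mult field_simps)
    then show ?thesis using vanishes_in_probD(2)[OF X, of "e / \<bar>c\<bar>"] e False by simp
  qed (use e in simp)
qed

lemma vanishes_in_prob_square:
  assumes X: "vanishes_in_prob X"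
  shows "vanishes_in_prob (\<lambda>k w. (X k w)\<^sup>2)"
  unfolding vanishes_in_prob_def
proof (intro conjI allI impI)
  show "(\<lambda>w. (X k w)\<^sup>2) \<in> borel_measurable M" for k using vanishes_in_probD(1)[OF X] by simp
  fix e :: real assume e: "e > 0"
  have "\<bar>x\<^sup>2\<bar> > e \<longleftrightarrow> \<bar>x\<bar> > sqrt e" for x :: real
    using real_sqrt_less_iff[of e "x\<^sup>2"] by simp
  then show "(\<lambda>k. tail_prob (\<lambda>w. (X k w)\<^sup>2) e) \<longlonglongrightarrow> 0"
    using vanishes_in_probD(2)[OF X, of "sqrt e"] e by simp
qed

lemma vanishes_in_prob_add:
  assumes X: "vanishes_in_prob X" and Y: "vanishes_in_prob Y"
  shows "vanishes_in_prob (\<lambda>k w. X k w + Y k w)"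
  unfolding vanishes_in_prob_def
proof (intro conjI allI impI)
  note m[measurable] = vanishes_in_probD(1)[OF X] vanishes_in_probD(1)[OF Y]
  show "(\<lambda>w. X k w + Y k w) \<in> borel_measurable M" for k by simp
  fix e :: real assume e: "e > 0"
  then have e2: "e / 2 > 0" by simp
  have lim: "(\<lambda>k. tail_prob (X k) (e / 2) + tail_prob (Y k) (e / 2)) \<longlonglongrightarrow> 0"
    using tendsto_add[OF vanishes_in_probD(2)[OF X e2] vanishes_in_probD(2)[OF Y e2]] by simp
  show "(\<lambda>k. tail_prob (\<lambda>w. X k w + Y k w) e) \<longlonglongrightarrow> 0"
  proof (rule tendsto_zero_mono[OF lim])
    show "tail_prob (\<lambda>w. X k w + Y k w) e \<le> tail_prob (X k) (e / 2) + tail_prob (Y k) (e / 2)" for k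
    proof -
      have "tail_prob (\<lambda>w. X k w + Y k w) e \<le> prob ({w \<in> space M. \<bar>X k w\<bar> > e / 2} \<union> {w \<in> space M. \<bar>Y k w\<bar> > e / 2})"
        by (intro finite_measure_mono) (auto simp: abs_gt_sets m)
      also have "\<dots> \<le> tail_prob (X k) (e / 2) + tail_prob (Y k) (e / 2)"
        by (intro measure_Un_le abs_gt_sets m)
      finally show ?thesis .
    qed
  qed simp
qed

lemma vanishes_in_prob_zero: "vanishes_in_prob (\<lambda>_ _. 0)"
  by (simp add: vanishes_in_prob_def)

lemma vanishes_in_prob_sum:
  assumes "\<And>i. i \<in> I \<Longrightarrow> vanishes_in_prob (X i)"
  shows "vanishes_in_prob (\<lambda>k w. \<Sum>i\<in>I. X i k w)"
  using assms
proof (induction I rule: infinite_finite_induct)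
  case (insert i I)
  then have "vanishes_in_prob (\<lambda>k w. X i k w + (\<Sum>i\<in>I. X i k w))"
    by (intro vanishes_in_prob_add) auto
  then show ?case using insert by simp
qed (simp_all add: vanishes_in_prob_zero)

text \<open>The truncation \<open>min 1 \<bar>X\<bar>\<close> has integral at most \<open>e\<close>
  plus the tail probability at level \<open>e\<close>, so it tends to 0 in L1 and has an almost
  surely convergent subsequence. Once it is below 1 it equals \<open>\<bar>X\<bar>\<close>.\<close>

lemma vanishes_in_prob_AE_subseq:
  assumes X: "vanishes_in_prob X"
  shows "\<exists>r::nat\<Rightarrow>nat. strict_mono r \<and> (AE w in M. (\<lambda>k. X (r k) w) \<longlonglongrightarrow> 0)"
proof -
  note m[measurable] = vanishes_in_probD(1)[OF X]
  define u where "u k w = min 1 \<bar>X k w\<bar>" for k w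
  have um: "u k \<in> borel_measurable M" for k unfolding u_def by simp
  have ui: "integrable M (u k)" for k
    by (rule integrable_const_bound[of _ 1]) (auto simp: u_def um)
  have ub: "(\<integral>w. norm (u k w) \<partial>M) \<le> e + tail_prob (X k) e" if e: "e > 0" for k e
  proof -
    have S: "{w \<in> space M. \<bar>X k w\<bar> > e} \<in> sets M" by (rule abs_gt_sets[OF m])
    have ind: "integrable M (indicator {w \<in> space M. \<bar>X k w\<bar> > e} :: _ \<Rightarrow> real)"
      using S by (intro integrable_real_indicator) (auto simp: emeasure_eq_measure)
    have "(\<integral>w. norm (u k w) \<partial>M) \<le> (\<integral>w. e + indicator {w \<in> space M. \<bar>X k w\<bar> > e} w \<partial>M)"
    proof (rule integral_mono)
      show "integrable M (\<lambda>w. e + indicator {w \<in> space M. \<bar>X k w\<bar> > e} w)"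
        using ind by simp
      show "norm (u k w) \<le> e + indicator {w \<in> space M. \<bar>X k w\<bar> > e} w" if "w \<in> space M" for w
        using e that by (auto simp: u_def indicator_def)
    qed (use ui in simp)
    also have "\<dots> = e + tail_prob (X k) e"
      using ind S by (simp add: prob_space)
    finally show ?thesis .
  qed
  have "(\<lambda>k. \<integral>w. norm (u k w) \<partial>M) \<longlonglongrightarrow> 0"
  proof (rule LIMSEQ_I)
    fix e :: real assume "e > 0"
    then have e: "e / 2 > 0" by simp
    have "eventually (\<lambda>k. tail_prob (X k) (e / 2) < e / 2) sequentially"
      using order_tendstoD(2)[OF vanishes_in_probD(2)[OF X e] e] .
    then have "eventually (\<lambda>k. norm ((\<integral>w. norm (u k w) \<partial>M) - 0) < e) sequentially"
    proof eventually_elim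
      case (elim k)
      have "(\<integral>w. norm (u k w) \<partial>M) \<ge> 0" by simp
      then show ?case using ub[OF e, of k] elim by simp
    qed
    then show "\<exists>no. \<forall>k\<ge>no. norm ((\<integral>w. norm (u k w) \<partial>M) - 0) < e"
      by (simp add: eventually_sequentially)
  qed
  from tendsto_L1_AE_subseq[OF ui this] obtain r where r: "strict_mono r" "AE w in M. (\<lambda>n. u (r n) w) \<longlonglongrightarrow> 0"
    by blast
  have "(\<lambda>k. X (r k) w) \<longlonglongrightarrow> 0" if "(\<lambda>n. u (r n) w) \<longlonglongrightarrow> 0" for w
  proof (rule tendsto_rabs_zero_cancel, rule Lim_transform_eventually[OF that])
    have "eventually (\<lambda>n. u (r n) w < 1) sequentially" using order_tendstoD(2)[OF that] by simp
    then show "\<forall>\<^sub>F n in sequentially. u (r n) w = \<bar>X (r n) w\<bar>"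
      by eventually_elim (simp add: u_def min_def split: if_splits)
  qed
  then show ?thesis using r by (intro exI[of _ r] conjI) (auto elim: eventually_mono)
qed

text \<open>The sum of the squares dominates each of the sequences, so one subsequence serves all of
  them at once.\<close>

lemma vanishes_in_prob_AE_subseq_finite:
  assumes A: "finite A" "\<And>X. X \<in> A \<Longrightarrow> vanishes_in_prob X"
  shows "\<exists>r::nat\<Rightarrow>nat. strict_mono r \<and> (AE w in M. \<forall>X\<in>A. (\<lambda>k. X (r k) w) \<longlonglongrightarrow> 0)"
proof -
  have "vanishes_in_prob (\<lambda>k w. \<Sum>X\<in>A. (X k w)\<^sup>2)"
    by (intro vanishes_in_prob_sum vanishes_in_prob_square A)
  from vanishes_in_prob_AE_subseq[OF this] obtain r where r: "strict_mono r"
    "AE w in M. (\<lambda>k. \<Sum>X\<in>A. (X (r k) w)\<^sup>2) \<longlonglongrightarrow> 0" by blast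
  have "(\<lambda>k. X (r k) w) \<longlonglongrightarrow> 0" if lim: "(\<lambda>k. \<Sum>X\<in>A. (X (r k) w)\<^sup>2) \<longlonglongrightarrow> 0" and X: "X \<in> A" for X w
  proof -
    have "(X (r k) w)\<^sup>2 \<le> (\<Sum>X\<in>A. (X (r k) w)\<^sup>2)" for k
      using A(1) X by (intro member_le_sum) auto
    then have "(\<lambda>k. (X (r k) w)\<^sup>2) \<longlonglongrightarrow> 0"
      by (intro tendsto_sandwich[OF _ _ tendsto_const lim]) auto
    then show ?thesis by simp
  qed
  then show ?thesis using r by (intro exI[of _ r] conjI) (auto elim: eventually_mono)
qed

lemma vanishes_in_prob_AE_subseq4:
  assumes "vanishes_in_prob X" "vanishes_in_prob Y" "vanishes_in_prob Z" "vanishes_in_prob V"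
  obtains r :: "nat \<Rightarrow> nat" where "strict_mono r"
    "AE w in M. (\<lambda>k. X (r k) w) \<longlonglongrightarrow> 0 \<and> (\<lambda>k. Y (r k) w) \<longlonglongrightarrow> 0 \<and> (\<lambda>k. Z (r k) w) \<longlonglongrightarrow> 0 \<and> (\<lambda>k. V (r k) w) \<longlonglongrightarrow> 0"
proof -
  have "\<exists>r::nat\<Rightarrow>nat. strict_mono r \<and> (AE w in M. \<forall>U\<in>{X, Y, Z, V}. (\<lambda>k. U (r k) w) \<longlonglongrightarrow> 0)"
    using assms by (intro vanishes_in_prob_AE_subseq_finite) auto
  then show thesis using that by auto
qed

text \<open>The form in which diagonal choices are used: for a fixed level \<open>e\<close>, the
  level attached to \<open>k\<close> is eventually smaller than \<open>e\<close>.\<close>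

lemma vanishes_in_prob_rate:
  assumes Y: "\<And>k. Y k \<in> borel_measurable M"
    and rate: "\<And>k. tail_prob (Y k) (inverse (real (Suc k))) < inverse (real (Suc k))"
  shows "vanishes_in_prob Y"
  unfolding vanishes_in_prob_def
proof (intro conjI allI impI Y)
  fix e :: real assume e: "e > 0"
  have ev: "eventually (\<lambda>k. inverse (real (Suc k)) < e) sequentially"
    using order_tendstoD(2)[OF LIMSEQ_inverse_real_of_nat e] .
  show "(\<lambda>k. tail_prob (Y k) e) \<longlonglongrightarrow> 0"
  proof (rule tendsto_sandwich[OF _ _ tendsto_const LIMSEQ_inverse_real_of_nat])
    show "\<forall>\<^sub>F k in sequentially. tail_prob (Y k) e \<le> inverse (real (Suc k))"
      using ev
    proof eventually_elim
      case (elim k)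
      have "tail_prob (Y k) e \<le> tail_prob (Y k) (inverse (real (Suc k)))"
        using elim by (intro finite_measure_mono abs_gt_sets Y) auto
      then show ?case using rate[of k] by simp
    qed
  qed simp
qed

lemma vanishes_in_prob_const:
  assumes "vanishes_in_prob (\<lambda>_. X)"
  shows "AE w in M. X w = 0"
  using vanishes_in_prob_AE_subseq[OF assms] by (auto simp: LIMSEQ_const_iff)

end

section \<open>Gaussian integrals\<close>

abbreviation "gauss v \<equiv> density lborel (\<lambda>x. ennreal (normal_density 0 (sqrt v) x))"

lemma gauss_moments:
  assumes v: "v > 0"
  shows "integrable (gauss v) (\<lambda>x. x)" "(\<integral>x. x \<partial>gauss v) = 0"
    and "integrable (gauss v) (\<lambda>x. x\<^sup>2)" "(\<integral>x. x\<^sup>2 \<partial>gauss v) = v"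
    and "integrable (gauss v) (\<lambda>x. x ^ 4)" "(\<integral>x. x ^ 4 \<partial>gauss v) = 3 * v\<^sup>2"
proof -
  have s: "sqrt v > 0" using v by simp
  note m = integrable_normal_moment[OF s, of 0]
  show "integrable (gauss v) (\<lambda>x. x)" "integrable (gauss v) (\<lambda>x. x\<^sup>2)" "integrable (gauss v) (\<lambda>x. x ^ 4)"
    using m[of 1] m[of 2] m[of 4] by (simp_all add: integrable_density)
  show "(\<integral>x. x \<partial>gauss v) = 0"
    using integral_normal_moment_odd[OF s, of 0 0] by (simp add: integral_density)
  show "(\<integral>x. x\<^sup>2 \<partial>gauss v) = v"
    using integral_normal_moment_even[OF s, of 0 1] v by (simp add: integral_density fact_numeral)
  show "(\<integral>x. x ^ 4 \<partial>gauss v) = 3 * v\<^sup>2"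
    using integral_normal_moment_even[OF s, of 0 2] v
    by (simp add: integral_density fact_numeral power2_eq_square)
qed

text \<open>The variance \<open>2 * v\<^sup>2\<close> is of second order in the length
  \<open>v\<close> of a cell, while the number of cells grows only like the inverse of that length;
  this makes sums of squared increments concentrate.\<close>

lemma gauss_centred_square:
  assumes v: "v > 0"
  shows "integrable (gauss v) (\<lambda>x. x\<^sup>2 - v)" "(\<integral>x. x\<^sup>2 - v \<partial>gauss v) = 0"
    and "integrable (gauss v) (\<lambda>x. (x\<^sup>2 - v)\<^sup>2)" "(\<integral>x. (x\<^sup>2 - v)\<^sup>2 \<partial>gauss v) = 2 * v\<^sup>2"
proof -
  interpret g: prob_space "gauss v" using v by (intro prob_space_normal_density) simp
  have p: "g.prob UNIV = 1" using g.prob_space by simp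
  note m = gauss_moments[OF v]
  show "integrable (gauss v) (\<lambda>x. x\<^sup>2 - v)" "(\<integral>x. x\<^sup>2 - v \<partial>gauss v) = 0"
    using m by (simp_all add: p)
  have e: "(x\<^sup>2 - v)\<^sup>2 = x ^ 4 - (2 * v) * x\<^sup>2 + v\<^sup>2" for x :: real
    by (simp add: power2_eq_square algebra_simps power4_eq_xxxx)
  show "integrable (gauss v) (\<lambda>x. (x\<^sup>2 - v)\<^sup>2)" "(\<integral>x. (x\<^sup>2 - v)\<^sup>2 \<partial>gauss v) = 2 * v\<^sup>2"
    unfolding e using m by (simp_all add: p power2_eq_square)
qed

text \<open>Completing the square: the exponential factor moves the mean of the centred Gaussian
  density to \<open>y * v\<close>, and a shifted density still has mass 1.\<close>

lemma gauss_nn_integral_exp: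
  assumes v: "v > 0"
  shows "(\<integral>\<^sup>+ x. ennreal (exp (y * x - y\<^sup>2 * v / 2)) \<partial>gauss v) = 1"
proof -
  have s: "sqrt v > 0" using v by simp
  interpret g: prob_space "density lborel (normal_density (y * v) (sqrt v))" using s by (rule prob_space_normal_density)
  have e: "normal_density 0 (sqrt v) x * exp (y * x - y\<^sup>2 * v / 2) = normal_density (y * v) (sqrt v) x" for x
  proof -
    have "- x\<^sup>2 / (2 * v) + (y * x - y\<^sup>2 * v / 2) = - (x - y * v)\<^sup>2 / (2 * v)"
      using v by (simp add: field_simps power2_eq_square)
    then show ?thesis using v by (simp add: normal_density_def exp_add[symmetric])
  qed
  have "(\<integral>\<^sup>+ x. ennreal (exp (y * x - y\<^sup>2 * v / 2)) \<partial>gauss v) =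
      (\<integral>\<^sup>+ x. ennreal (normal_density (y * v) (sqrt v) x) \<partial>lborel)"
    by (subst nn_integral_density) (auto simp: ennreal_mult[symmetric] e)
  also have "\<dots> = 1"
    using g.emeasure_space_1 by (simp add: emeasure_density)
  finally show ?thesis .
qed

text \<open>Girsanov for one Gaussian variable. Under the tilted density, \<open>x - y * v\<close>
  is again centred with variance \<open>v\<close>, so \<open>y\<close> drops out of the result. The
  proof substitutes \<open>y * v + sqrt v * x\<close> to reach the standard normal law.\<close>

lemma gauss_integral_tilted_iexp:
  assumes v: "v > 0"
  shows "(\<integral>x. of_real (exp (y * x - y\<^sup>2 * v / 2)) * iexp (c * (x - y * v)) \<partial>gauss v) = 
    complex_of_real (exp (- (c\<^sup>2 * v / 2)))"
proof -
  have s: "sqrt v > 0" using v by simp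
  have e: "normal_density 0 (sqrt v) (y * v + sqrt v * x) * exp (y * (y * v + sqrt v * x) - y\<^sup>2 * v / 2) 
      = std_normal_density x / sqrt v" for x
  proof -
    have "- (y * v + sqrt v * x)\<^sup>2 / (2 * v) + (y * (y * v + sqrt v * x) - y\<^sup>2 * v / 2) = - x\<^sup>2 / 2"
      using v by (simp add: field_simps power2_eq_square)
    then show ?thesis using v 
      by (simp add: normal_density_def exp_add[symmetric] real_sqrt_mult)
  qed
  let ?f = "\<lambda>x. normal_density 0 (sqrt v) x *\<^sub>R (of_real (exp (y * x - y\<^sup>2 * v / 2)) * iexp (c * (x - y * v)))"
  have "(\<integral>x. of_real (exp (y * x - y\<^sup>2 * v / 2)) * iexp (c * (x - y * v)) \<partial>gauss v) = (\<integral>x. ?f x \<partial>lborel)"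
    by (subst integral_density) auto
  also have "\<dots> = \<bar>sqrt v\<bar> *\<^sub>R (\<integral>x. ?f (y * v + sqrt v * x) \<partial>lborel)"
    using s by (intro lborel_integral_real_affine) auto
  also have "\<dots> = (\<integral>x. sqrt v *\<^sub>R ?f (y * v + sqrt v * x) \<partial>lborel)"
    using s by (simp del: scaleR_scaleR)
  also have "\<dots> = (\<integral>x. std_normal_density x *\<^sub>R iexp (c * sqrt v * x) \<partial>lborel)"
  proof (intro Bochner_Integration.integral_cong refl)
    fix x
    have "sqrt v *\<^sub>R ?f (y * v + sqrt v * x) = 
      (sqrt v * (normal_density 0 (sqrt v) (y * v + sqrt v * x) * exp (y * (y * v + sqrt v * x) - y\<^sup>2 * v / 2))) *\<^sub>R iexp (c * sqrt v * x)"
      by (simp add: scaleR_conv_of_real mult_ac)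
    then show "sqrt v *\<^sub>R ?f (y * v + sqrt v * x) = std_normal_density x *\<^sub>R iexp (c * sqrt v * x)"
      unfolding e using s by simp
  qed
  also have "\<dots> = char std_normal_distribution (c * sqrt v)"
    unfolding char_def by (subst integral_density) auto
  also have "\<dots> = complex_of_real (exp (- (c\<^sup>2 * v / 2)))"
    using v by (simp add: char_std_normal_distribution power_mult_distrib)
  finally show ?thesis .
qed

section \<open>Grids on the unit interval\<close>

lemma finite_set_grid:
  fixes S :: "real set"
  assumes "finite S" "S \<noteq> {}"
  obtains N s where "\<And>i. i < N \<Longrightarrow> s i < s (Suc i)" "s ` {..N} = S" "s 0 = Min S" "s N = Max S"
proof -
  define xs where "xs = sorted_list_of_set S"
  have xs: "sorted_wrt (<) xs" "set xs = S" "length xs = card S"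
    using assms by (auto simp: xs_def)
  define N where "N = card S - 1"
  have N: "Suc N = length xs" using assms xs by (simp add: N_def card_gt_0_iff)
  have 1: "xs ! i < xs ! Suc i" if "i < N" for i
    using that xs(1) N by (auto simp: sorted_wrt_iff_nth_less)
  have 2: "(!) xs ` {..N} = S"
    using N xs(2) by (auto simp: set_conv_nth image_def less_Suc_eq_le[symmetric])
  have le: "xs ! i \<le> xs ! j" if "i \<le> j" "j \<le> N" for i j
    using that xs(1) N sorted_wrt_nth_less[of "(<)" xs i j] by (cases "i = j") auto
  have 3: "xs ! 0 = Min S" "xs ! N = Max S"
    unfolding 2[symmetric] by (auto intro!: Min_eqI[symmetric] Max_eqI[symmetric] le)
  show thesis by (rule that[of N "(!) xs", OF 1 2 3])
qed

text \<open>Strictly increasing, unlike \<open>time_grid\<close>: every cell has positive length, so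
  its increment has a Gaussian density.\<close>

definition grid :: "nat \<Rightarrow> (nat \<Rightarrow> real) \<Rightarrow> bool" where
  "grid N s \<longleftrightarrow> s 0 = 0 \<and> s N = 1 \<and> (\<forall>i<N. s i < s (Suc i))"

abbreviation incr :: "(real \<Rightarrow> real) \<Rightarrow> (nat \<Rightarrow> real) \<Rightarrow> nat \<Rightarrow> real" where
  "incr w s j \<equiv> w (s (Suc j)) - w (s j)"

lemma grid_less: "grid N s \<Longrightarrow> i < j \<Longrightarrow> j \<le> N \<Longrightarrow> s i < s j"
proof (induction j)
  case (Suc j)
  then show ?case by (cases "i = j") (auto simp: grid_def intro: less_trans)
qed simp

lemma grid_le: "grid N s \<Longrightarrow> i \<le> j \<Longrightarrow> j \<le> N \<Longrightarrow> s i \<le> s j"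
  using grid_less[of N s i j] by (cases "i = j") auto

lemma grid_le_iff: "grid N s \<Longrightarrow> i \<le> N \<Longrightarrow> j \<le> N \<Longrightarrow> s i \<le> s j \<longleftrightarrow> i \<le> j"
  using grid_less[of N s j i] grid_le[of N s i j] by fastforce

lemma grid_less_iff: "grid N s \<Longrightarrow> i \<le> N \<Longrightarrow> j \<le> N \<Longrightarrow> s i < s j \<longleftrightarrow> i < j"
  using grid_le_iff[of N s j i] by fastforce

lemma grid_range: "grid N s \<Longrightarrow> i \<le> N \<Longrightarrow> 0 \<le> s i \<and> s i \<le> 1"
  using grid_le[of N s 0 i] grid_le[of N s i N] by (auto simp: grid_def)

lemma grid_cell: 
  assumes "grid N s" "j < N"
  shows "0 \<le> s j" "s j < s (Suc j)" "s (Suc j) \<le> 1"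
  using grid_range[of N s j] grid_range[of N s "Suc j"] assms by (auto simp: grid_def)

lemma grid_cover:
  assumes g: "grid N s" and x: "0 < x" "x \<le> 1"
  obtains j where "j < N" "s j < x" "x \<le> s (Suc j)"
proof -
  define j where "j = (LEAST i. x \<le> s i)"
  have ex: "x \<le> s N" using g x by (simp add: grid_def)
  have j: "x \<le> s j" "j \<le> N" unfolding j_def using ex by (auto intro: LeastI Least_le)
  have "j \<noteq> 0"
  proof
    assume "j = 0"
    then show False using j(1) g x by (simp add: grid_def)
  qed
  then obtain i where i: "j = Suc i" using not0_implies_Suc by blast
  have "\<not> x \<le> s i" using not_less_Least[of i "\<lambda>i. x \<le> s i"] i unfolding j_def by simp
  then show thesis using that[of i] i j by simp
qed

lemma grid_cell_unique:
  assumes g: "grid N s" "i < N" "j < N" and x: "s i < x" "x \<le> s (Suc i)" "s j < x" "x \<le> s (Suc j)"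
  shows "i = j"
proof -
  have "s i < s (Suc j)" "s j < s (Suc i)" using x by simp_all
  then show ?thesis using grid_less_iff[OF g(1)] g by simp
qed

lemma finite_set_unit_grid:
  fixes S :: "real set"
  assumes "finite S" "S \<subseteq> {0..1}"
  obtains N s where "grid N s" "s ` {..N} = insert 0 (insert 1 S)"
proof -
  let ?S = "insert 0 (insert 1 S)"
  obtain N s where g: "\<And>i. i < N \<Longrightarrow> s i < s (Suc i)" "s ` {..N} = ?S" "s 0 = Min ?S" "s N = Max ?S"
    using finite_set_grid[of ?S] assms by auto
  have "Min ?S = 0" "Max ?S = 1" using assms by (intro Min_eqI Max_eqI; auto)+
  then show thesis using that[of N s] g unfolding grid_def by auto
qed

text \<open>Adjoining the multiples of \<open>1 / K\<close> to \<open>S\<close> suffices: a cell of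
  length at least \<open>\<delta>\<close> would contain one of them in its interior.\<close>

lemma fine_unit_grid:
  fixes S :: "real set"
  assumes "finite S" "S \<subseteq> {0..1}" "\<delta> > 0"
  obtains N s where "grid N s" "S \<subseteq> s ` {..N}" "\<And>i. i < N \<Longrightarrow> s (Suc i) - s i < \<delta>"
proof -
  obtain K :: nat where K: "K > 0" "1 / real K < \<delta>"
  proof -
    obtain n where "inverse (real (Suc n)) < \<delta>" using reals_Archimedean[OF assms(3)] by blast
    then show thesis using that[of "Suc n"] by (simp add: inverse_eq_divide)
  qed
  define T where "T = S \<union> (\<lambda>m. real m / real K) ` {..K}"
  have T: "finite T" "T \<subseteq> {0..1}" using assms K by (auto simp: T_def)
  obtain N s where s: "grid N s" "s ` {..N} = insert 0 (insert 1 T)"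
    using finite_set_unit_grid[OF T] .
  have "s (Suc i) - s i < \<delta>" if i: "i < N" for i
  proof (rule ccontr)
    assume "\<not> s (Suc i) - s i < \<delta>"
    then have big: "s i + 1 / real K < s (Suc i)" using K by simp
    note c = grid_cell[OF s(1) i]
    \<comment> \<open>\<open>m / K\<close> is the first multiple strictly beyond \<open>s i\<close>,
      hence at most \<open>s i + 1 / K\<close>.\<close>
    define m where "m = nat (floor (real K * s i)) + 1"
    have m: "real m \<le> real K * s i + 1" "real K * s i < real m"
      using c real_of_int_floor_add_one_gt[of "real K * s i"] of_int_floor_le[of "real K * s i"] unfolding m_def
      by (simp_all add: of_nat_nat add.commute)
    have lo: "s i < real m / real K" using m(2) K by (simp add: field_simps)
    have hi: "real m / real K < s (Suc i)"
    proof -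
      have "real m / real K \<le> (real K * s i + 1) / real K" using m(1) K by (intro divide_right_mono) auto
      also have "\<dots> = s i + 1 / real K" using K by (simp add: field_simps)
      finally show ?thesis using big by simp
    qed
    have "real m / real K < 1" using hi c by simp
    then have "m \<le> K" using K by simp
    then have "real m / real K \<in> s ` {..N}" unfolding s(2) T_def by auto
    then obtain l where "l \<le> N" "s l = real m / real K" by auto
    then show False using lo hi grid_less_iff[OF s(1), of i l] grid_less_iff[OF s(1), of l "Suc i"] i by simp
  qed
  then show thesis using that[of N s] s unfolding T_def by auto
qed

section \<open>Integrals over [0,1] of functions constant on grid cells\<close>

abbreviation "unit_leb \<equiv> lebesgue_on {0..1::real}"
abbreviation "sq_norm g \<equiv> \<integral>x. (g x :: real)\<^sup>2 \<partial>unit_leb"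
abbreviation "sq_dist f g \<equiv> \<integral>x. (f x - g x :: real)\<^sup>2 \<partial>unit_leb"
abbreviation "energy X w \<equiv> \<integral>x. (X x w :: real)\<^sup>2 \<partial>unit_leb"

lemma cell_constant_integral:
  fixes f :: "real \<Rightarrow> real"
  assumes g: "grid N s" and f: "\<And>j x. j < N \<Longrightarrow> s j < x \<Longrightarrow> x \<le> s (Suc j) \<Longrightarrow> f x = f (s (Suc j))"
  shows "integrable unit_leb f" 
    and "(\<integral>x. f x \<partial>unit_leb) = (\<Sum>j<N. f (s (Suc j)) * (s (Suc j) - s j))"
proof -
  \<comment> \<open>The left-open cells miss the point 0. The extra term, supported on a null set,
    makes the identity hold at every point of [0,1].\<close>
  let ?h = "\<lambda>x. (\<Sum>j<N. f (s (Suc j)) * indicator {s j<..s (Suc j)} x) + f 0 * indicator {0} x :: real"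
  have eq: "f x = ?h x" if x: "x \<in> {0..1}" for x
  proof (cases "x = 0")
    case True
    have "(\<Sum>j<N. f (s (Suc j)) * indicator {s j<..s (Suc j)} x) = (0 :: real)"
      using grid_cell(1)[OF g] True by (intro sum.neutral) (auto simp: indicator_def dest: leD)
    then show ?thesis using True by simp
  next
    case False
    then obtain j where j: "j < N" "s j < x" "x \<le> s (Suc j)"
      using grid_cover[OF g, of x] x by auto
    have "(\<Sum>i<N. f (s (Suc i)) * indicator {s i<..s (Suc i)} x) = (\<Sum>i<N. if i = j then f (s (Suc i)) else 0)"
    proof (intro sum.cong refl)
      fix i assume "i \<in> {..<N}"
      then have "x \<in> {s i<..s (Suc i)} \<longleftrightarrow> i = j"
        using grid_cell_unique[OF g, of i j x] j by auto
      then show "f (s (Suc i)) * indicator {s i<..s (Suc i)} x = (if i = j then f (s (Suc i)) else 0)"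
        by (simp add: indicator_def)
    qed
    then show ?thesis using False j f[OF j] by simp
  qed
  have mb: "has_bochner_integral unit_leb (indicator {a<..b} :: real \<Rightarrow> real) (b - a)" if "0 \<le> a" "a \<le> b" "b \<le> 1" for a b
  proof -
    have A: "{a<..b} \<in> sets unit_leb" using that by (intro sets_restrict_space_iff[THEN iffD2]) auto
    have E: "emeasure unit_leb {a<..b} = ennreal (b - a)"
      using that by (subst emeasure_restrict_space) auto
    have "measure unit_leb {a<..b} = b - a"
      using E that by (intro measure_eq_emeasure_eq_ennreal) auto
    then show ?thesis
      using has_bochner_integral_real_indicator[OF A] E by simp
  qed
  have z: "has_bochner_integral unit_leb (indicator {0} :: real \<Rightarrow> real) 0"
  proof -
    have A: "{0} \<in> sets unit_leb" by (intro sets_restrict_space_iff[THEN iffD2]) auto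
    have E: "emeasure unit_leb {0} = ennreal 0"
      by (subst emeasure_restrict_space) auto
    have "measure unit_leb {0} = 0"
      using E by (intro measure_eq_emeasure_eq_ennreal) auto
    then show ?thesis
      using has_bochner_integral_real_indicator[OF A] E by simp
  qed
  have H: "has_bochner_integral unit_leb ?h ((\<Sum>j<N. f (s (Suc j)) * (s (Suc j) - s j)) + f 0 * 0)"
  proof (intro has_bochner_integral_add has_bochner_integral_sum has_bochner_integral_mult_right)
    fix j assume "j \<in> {..<N}"
    then show "has_bochner_integral unit_leb (indicator {s j<..s (Suc j)} :: real \<Rightarrow> real) (s (Suc j) - s j)"
      using grid_cell[OF g, of j] by (intro mb) auto
  qed (rule z)
  have cong: "has_bochner_integral unit_leb f A \<longleftrightarrow> has_bochner_integral unit_leb ?h A" for A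
    by (intro has_bochner_integral_cong refl eq) simp
  show "integrable unit_leb f" "(\<integral>x. f x \<partial>unit_leb) = (\<Sum>j<N. f (s (Suc j)) * (s (Suc j) - s j))"
    using H unfolding cong[symmetric] by (simp_all add: has_bochner_integral_iff)
qed

text \<open>Reduces an exceedance at some time in [0,1] to one at a rational time, hence an
  uncountable union of events to a countable one.\<close>

lemma continuous_rational_witness:
  fixes f :: "real \<Rightarrow> real"
  assumes f: "continuous_on {0..1} f" and s: "s \<in> {0..1}" "\<bar>f s\<bar> > e"
  shows "\<exists>q\<in>\<rat> \<inter> {0..1}. \<bar>f q\<bar> > e"
proof -
  have "\<exists>d>0. \<forall>y\<in>{0..1}. dist y s < d \<longrightarrow> dist (f y) (f s) < \<bar>f s\<bar> - e"
    using f s unfolding continuous_on_iff by auto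
  then obtain d where d: "d > 0" "\<And>y. y \<in> {0..1} \<Longrightarrow> dist y s < d \<Longrightarrow> dist (f y) (f s) < \<bar>f s\<bar> - e"
    by blast
  have "max 0 (s - d) < min 1 (s + d)" using s d by auto
  from Rats_dense_in_real[OF this] obtain q where q: "q \<in> \<rat>" "max 0 (s - d) < q" "q < min 1 (s + d)" by blast
  have "dist q s < d" using q by (auto simp: dist_real_def)
  then have "dist (f q) (f s) < \<bar>f s\<bar> - e" using d(2)[of q] q by auto
  then have "\<bar>f q\<bar> > e" by (auto simp: dist_real_def)
  then show ?thesis using q by auto
qed

section \<open>Brownian increments\<close>

locale wiener_space =
  fixes \<gamma> :: "path measure"
  assumes wiener: "wiener_measure \<gamma>"
begin

section \<open>The completed space and the augmented filtration\<close>

abbreviation "C \<equiv> completion \<gamma>"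
abbreviation "F \<equiv> wiener_filtration \<gamma>"

lemma prob_space_base: "prob_space \<gamma>"
  using wiener by (simp add: wiener_measure_def)

sublocale base: prob_space \<gamma>
  by (rule prob_space_base)

sublocale prob_space C
  by (rule base.prob_space_completion)

lemma space_wiener: "space \<gamma> = mspace path_metric"
proof -
  have "sets \<gamma> = sets path_borel" using wiener by (simp add: wiener_measure_def)
  then have "space \<gamma> = space path_borel" by (rule sets_eq_imp_space_eq)
  then show ?thesis by (simp add: path_borel_def space_measure_of_conv)
qed

lemma path_zero: "w \<in> space \<gamma> \<Longrightarrow> w 0 = 0"
  by (simp add: space_wiener path_metric_def)

lemma path_continuous: "w \<in> space \<gamma> \<Longrightarrow> continuous_on {0..1} w"
  by (simp add: space_wiener path_metric_def)

lemma increment_distributed: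
  assumes "0 \<le> s" "s < t" "t \<le> 1"
  shows "distributed \<gamma> lborel (\<lambda>w. w t - w s) (\<lambda>x. ennreal (normal_density 0 (sqrt (t - s)) x))"
  using wiener assms by (simp add: wiener_measure_def)

lemma path_measurable_base:
  assumes "t \<in> {0..1}"
  shows "(\<lambda>w. w t) \<in> borel_measurable \<gamma>"
proof (cases "t = 0")
  case True
  then show ?thesis
    using path_zero by (subst measurable_cong[where g="\<lambda>_. 0"]) auto
next
  case False
  then have "(\<lambda>w. w t - w 0) \<in> borel_measurable \<gamma>"
    using increment_distributed[of 0 t] assms by (auto simp: distributed_def)
  then show ?thesis
    by (subst measurable_cong[where g="\<lambda>w. w t - w 0"]) (auto simp: path_zero)
qed

lemma path_measurable: "t \<in> {0..1} \<Longrightarrow> (\<lambda>w. w t) \<in> borel_measurable C"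
  by (intro measurable_completion path_measurable_base)

lemma space_F[simp]: "space (F t) = space \<gamma>"
  by (simp add: wiener_filtration_def space_measure_of_conv)

lemma F_generators:
  "{(\<lambda>w. w s) -` B \<inter> space \<gamma> | s B. s \<in> {0..t} \<and> B \<in> sets (borel :: real measure)}
      \<union> null_sets C \<subseteq> Pow (space \<gamma>)"
  by (auto dest!: null_setsD2 dest: sets.sets_into_space[THEN subsetD])

lemma sets_F:
  "sets (F t) = sigma_sets (space \<gamma>)
     ({(\<lambda>w. w s) -` B \<inter> space \<gamma> | s B. s \<in> {0..t} \<and> B \<in> sets (borel :: real measure)}
      \<union> null_sets C)"
  unfolding wiener_filtration_def by (rule sets_measure_of[OF F_generators])

lemma F_mono:
  assumes "s \<le> t"
  shows "sets (F s) \<subseteq> sets (F t)"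
proof -
  have "r \<in> {0..t}" if "r \<in> {0..s}" for r
    using assms that by simp
  then show ?thesis
    unfolding sets_F by (intro sigma_sets_mono' Un_mono order_refl) blast
qed

lemma F_mono_measurable: "s \<le> t \<Longrightarrow> f \<in> F s \<rightarrow>\<^sub>M N \<Longrightarrow> f \<in> F t \<rightarrow>\<^sub>M N"
  using F_mono[of s t] by (auto simp: measurable_def)

lemma sets_F_C: 
  assumes "t \<le> 1"
  shows "sets (F t) \<subseteq> sets C"
proof -
  have "(\<lambda>w. w s) -` B \<inter> space \<gamma> \<in> sets C" if "s \<in> {0..t}" "B \<in> sets borel" for s and B :: "real set"
    using measurable_sets[OF path_measurable[of s], of B] that assms by auto
  then have "{(\<lambda>w. w s) -` B \<inter> space \<gamma> | s B. s \<in> {0..t} \<and> B \<in> sets (borel :: real measure)} \<union> null_sets C \<subseteq> sets C"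
    by blast
  from sets.sigma_sets_subset[OF this] show ?thesis
    unfolding sets_F by simp
qed

lemma F_measurable_C: "t \<le> 1 \<Longrightarrow> f \<in> F t \<rightarrow>\<^sub>M N \<Longrightarrow> f \<in> C \<rightarrow>\<^sub>M N"
  using sets_F_C[of t] by (auto simp: measurable_def)

lemma subalgebra_F: "t \<le> 1 \<Longrightarrow> subalgebra C (F t)"
  using sets_F_C by (simp add: subalgebra_def)

lemma path_F: "0 \<le> s \<Longrightarrow> s \<le> t \<Longrightarrow> (\<lambda>w. w s) \<in> borel_measurable (F t)"
proof (rule measurableI)
  fix B :: "real set" assume "0 \<le> s" "s \<le> t" "B \<in> sets borel"
  then have "(\<lambda>w. w s) -` B \<inter> space \<gamma> \<in> {(\<lambda>w. w s) -` B \<inter> space \<gamma> | s B. s \<in> {0..t} \<and> B \<in> sets borel} \<union> null_sets C"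
    using atLeastAtMost_iff by blast
  then show "(\<lambda>w. w s) -` B \<inter> space (F t) \<in> sets (F t)"
    unfolding sets_F space_F by (rule sigma_sets.Basic)
qed simp

text \<open>Rests on the completeness of \<open>C\<close>. It supplies measurability for functions
  known only as almost sure limits.\<close>

lemma borel_measurable_AE_cong:
  fixes f g :: "path \<Rightarrow> 'a :: topological_space"
  assumes f: "f \<in> borel_measurable C" and eq: "AE w in C. f w = g w"
  shows "g \<in> borel_measurable C"
proof (rule borel_measurableI)
  fix S :: "'a set" assume "open S"
  then have 1: "f -` S \<inter> space C \<in> sets C" using measurable_sets[OF f, of S] by simp
  have 2: "AE w in C. w \<in> f -` S \<inter> space C \<longleftrightarrow> w \<in> g -` S \<inter> space C"
    using eq by eventually_elim auto
  show "g -` S \<inter> space C \<in> sets C"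
    by (rule completion.in_sets_AE[OF 2 1]) simp
qed

section \<open>Independence of the past and a later increment\<close>

lemma path_eq_sum_increments:
  assumes w: "w \<in> space \<gamma>" and "s 0 = (0::real)"
  shows "w (s i) = (\<Sum>j<i. incr w s j)"
  using sum_lessThan_telescope[of "\<lambda>j. w (s j)" i] assms path_zero[OF w] by simp

text \<open>Independence is given for increments along one increasing sequence of times. Values of
  the path at times up to \<open>s\<close> are partial sums of such increments, so a cylinder event
  depends on all increments but the last.\<close>

lemma indep_cylinder_increment:
  assumes st: "0 \<le> s" "s < t" "t \<le> 1"
    and R: "finite R" "R \<subseteq> {0..s}" and B: "\<And>r. r \<in> R \<Longrightarrow> B r \<in> sets borel"
    and D: "D \<in> sets (borel :: real measure)"
  shows "base.prob ({w \<in> space \<gamma>. \<forall>r\<in>R. w r \<in> B r} \<inter> {w \<in> space \<gamma>. w t - w s \<in> D}) =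
    base.prob {w \<in> space \<gamma>. \<forall>r\<in>R. w r \<in> B r} * base.prob {w \<in> space \<gamma>. w t - w s \<in> D}"
proof -
  \<comment> \<open>The time 0 is adjoined so that path values are sums of increments, and
    \<open>s\<close> so that the last increment starts there.\<close>
  let ?S = "insert 0 (insert s R)"
  obtain n \<tau>' where g: "\<And>i. i < n \<Longrightarrow> \<tau>' i < \<tau>' (Suc i)" "\<tau>' ` {..n} = ?S" "\<tau>' 0 = Min ?S" "\<tau>' n = Max ?S"
    using finite_set_grid[of ?S] R(1) by blast
  have "Min ?S = 0" "Max ?S = s" using R st by (intro Min_eqI Max_eqI; auto)+
  note g = g(1,2) g(3,4)[unfolded this]
  \<comment> \<open>Appending \<open>t\<close> makes the increment with index \<open>n\<close> equal
    to \<open>w t - w s\<close>.\<close>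
  define \<tau> where "\<tau> = \<tau>'(Suc n := t)"
  have \<tau>: "\<tau> 0 = 0" "\<tau> n = s" "\<tau> (Suc n) = t" "\<And>i. i < Suc n \<Longrightarrow> \<tau> i < \<tau> (Suc i)" "\<tau> ` {..n} = ?S"
    using g st by (auto simp: \<tau>_def less_Suc_eq)
  have ind: "base.indep_vars (\<lambda>_. borel) (\<lambda>i w. w (\<tau> (Suc i)) - w (\<tau> i)) {..<Suc n}"
    using wiener \<tau> st unfolding wiener_measure_def by auto
  define U where "U = (\<lambda>w::path. restrict (\<lambda>i. w (\<tau> (Suc i)) - w (\<tau> i)) {..<n})"
  define V where "V = (\<lambda>w::path. restrict (\<lambda>i. w (\<tau> (Suc i)) - w (\<tau> i)) {n})"
  have iv: "base.indep_var (PiM {..<n} (\<lambda>_. borel)) U (PiM {n} (\<lambda>_. borel)) V"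
    unfolding U_def V_def by (rule base.indep_var_restrict[OF ind]) auto
  obtain idx where idx: "\<And>r. r \<in> R \<Longrightarrow> idx r \<le> n \<and> \<tau> (idx r) = r"
  proof -
    have "\<exists>i. i \<le> n \<and> \<tau> i = r" if "r \<in> R" for r
    proof -
      have "r \<in> \<tau> ` {..n}" using \<tau>(5) that by simp
      then show ?thesis by auto
    qed
    then show thesis using that by metis
  qed
  define A where "A = {x \<in> space (PiM {..<n} (\<lambda>_. borel :: real measure)). \<forall>r\<in>R. (\<Sum>j<idx r. x j) \<in> B r}"
  have A: "A \<in> sets (PiM {..<n} (\<lambda>_. borel))"
  proof -
    have "(\<lambda>x. \<Sum>j<idx r. x j) \<in> borel_measurable (PiM {..<n} (\<lambda>_. borel :: real measure))" if "r \<in> R" for r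
      using idx[OF that] by (intro borel_measurable_sum measurable_component_singleton) auto
    from measurable_sets[OF this B]
    have "{x \<in> space (PiM {..<n} (\<lambda>_. borel :: real measure)). (\<Sum>j<idx r. x j) \<in> B r}
        \<in> sets (PiM {..<n} (\<lambda>_. borel))" if "r \<in> R" for r
      using that by (simp add: vimage_def Int_def conj_commute)
    then show ?thesis
      unfolding A_def by (intro sets.sets_Collect_finite_All R(1))
  qed
  have [measurable]: "D \<in> sets borel" by fact
  have A2: "{x \<in> space (PiM {n} (\<lambda>_. borel)). x n \<in> D} \<in> sets (PiM {n} (\<lambda>_. borel :: real measure))"
    by measurable
  have e1: "{w \<in> space \<gamma>. \<forall>r\<in>R. w r \<in> B r} = U -` A \<inter> space \<gamma>"
  proof -
    have "(\<Sum>j<idx r. U w j) = w r" if "w \<in> space \<gamma>" "r \<in> R" for w r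
    proof -
      have "w r = (\<Sum>j<idx r. w (\<tau> (Suc j)) - w (\<tau> j))"
        using path_eq_sum_increments[OF that(1), of \<tau> "idx r"] \<tau>(1) idx[OF that(2)] by simp
      also have "\<dots> = (\<Sum>j<idx r. U w j)"
        using idx[OF that(2)] by (intro sum.cong) (auto simp: U_def)
      finally show ?thesis ..
    qed
    then show ?thesis by (auto simp: A_def U_def space_PiM)
  qed
  have e2: "{w \<in> space \<gamma>. w t - w s \<in> D} = V -` {x \<in> space (PiM {n} (\<lambda>_. borel)). x n \<in> D} \<inter> space \<gamma>"
    using \<tau> by (auto simp: V_def space_PiM)
  have e3: "(U -` A \<inter> space \<gamma>) \<inter> (V -` {x \<in> space (PiM {n} (\<lambda>_. borel)). x n \<in> D} \<inter> space \<gamma>)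
      = (\<lambda>w. (U w, V w)) -` (A \<times> {x \<in> space (PiM {n} (\<lambda>_. borel)). x n \<in> D}) \<inter> space \<gamma>"
    by auto
  show ?thesis
    unfolding e1 e2 e3 by (rule base.indep_varD[OF iv A A2])
qed

lemma prob_cong_AE:
  assumes "A \<in> sets C" "B \<in> sets C" "AE w in C. w \<in> A \<longleftrightarrow> w \<in> B"
  shows "prob A = prob B"
  using assms by (intro finite_measure_eq_AE)

text \<open>The augmenting null sets are absorbed by passing to the pi-system of all events almost surely
  equal to a cylinder.\<close>

lemma indep_event_increment:
  assumes st: "0 \<le> s" "s < t" "t \<le> 1"
  shows "indep_set (sets (F s)) {{w \<in> space \<gamma>. w t - w s \<in> D} | D. D \<in> sets (borel :: real measure)}"
proof -
  define cyl where "cyl = {{w \<in> space \<gamma>. \<forall>r\<in>R. w r \<in> B r} | R B.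
      finite R \<and> R \<subseteq> {0..s} \<and> (\<forall>r. B r \<in> sets (borel :: real measure))}"
  define G where "G = {E \<in> sets C. \<exists>E'\<in>cyl. AE w in C. w \<in> E \<longleftrightarrow> w \<in> E'}"
  define V where "V = {{w \<in> space \<gamma>. w t - w s \<in> D} | D. D \<in> sets (borel :: real measure)}"
  have path_vimage: "{w \<in> space \<gamma>. w r \<in> B} \<in> sets \<gamma>" if "r \<in> {0..1}" "B \<in> sets borel" for r B
    using measurable_sets[OF path_measurable_base[OF that(1)] that(2)]
    by (simp add: vimage_def Int_def conj_commute)
  have cyl_sets: "cyl \<subseteq> sets \<gamma>"
    unfolding cyl_def using st by (auto intro!: sets.sets_Collect_finite_All path_vimage)
  have cyl_Int: "a \<inter> b \<in> cyl" if ab: "a \<in> cyl" "b \<in> cyl" for a b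
  proof -
    obtain R B where a: "a = {w \<in> space \<gamma>. \<forall>r\<in>R. w r \<in> B r}" "finite R" "R \<subseteq> {0..s}" "\<And>r. B r \<in> sets borel"
      using ab(1) unfolding cyl_def by blast
    obtain R' B' where b: "b = {w \<in> space \<gamma>. \<forall>r\<in>R'. w r \<in> B' r}" "finite R'" "R' \<subseteq> {0..s}" "\<And>r. B' r \<in> sets borel"
      using ab(2) unfolding cyl_def by blast
    let ?B = "\<lambda>r. (if r \<in> R then B r else UNIV) \<inter> (if r \<in> R' then B' r else UNIV)"
    have "a \<inter> b = {w \<in> space \<gamma>. \<forall>r\<in>R \<union> R'. w r \<in> ?B r}"
      unfolding a b by auto
    then show ?thesis
      unfolding cyl_def using a b by (intro CollectI exI[of _ "R \<union> R'"] exI[of _ ?B]) auto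
  qed
  have G_Int: "Int_stable G"
  proof (rule Int_stableI)
    fix a b assume "a \<in> G" "b \<in> G"
    then obtain a' b' where *: "a \<in> sets C" "b \<in> sets C" "a' \<in> cyl" "b' \<in> cyl"
      "AE w in C. w \<in> a \<longleftrightarrow> w \<in> a'" "AE w in C. w \<in> b \<longleftrightarrow> w \<in> b'" unfolding G_def by blast
    have "AE w in C. w \<in> a \<inter> b \<longleftrightarrow> w \<in> a' \<inter> b'" using *(5,6) by eventually_elim auto
    then show "a \<inter> b \<in> G" using * cyl_Int unfolding G_def by blast
  qed
  have V_sets: "V \<subseteq> sets \<gamma>"
  proof -
    have "(\<lambda>w. w t - w s) \<in> borel_measurable \<gamma>"
      using st by (intro borel_measurable_diff path_measurable_base) auto
    from measurable_sets[OF this] show ?thesis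
      by (auto simp: V_def vimage_def Int_def conj_commute)
  qed
  have V_Int: "Int_stable V"
    unfolding V_def
  proof (rule Int_stableI, safe)
    fix D D' :: "real set" assume "D \<in> sets borel" "D' \<in> sets borel"
    then show "\<exists>D''. {w \<in> space \<gamma>. w t - w s \<in> D} \<inter> {w \<in> space \<gamma>. w t - w s \<in> D'} =
        {w \<in> space \<gamma>. w t - w s \<in> D''} \<and> D'' \<in> sets borel"
      by (intro exI[of _ "D \<inter> D'"]) auto
  qed
  have "indep_set G V"
  proof (rule indep_setI)
    show "G \<subseteq> events" by (auto simp: G_def)
    show "V \<subseteq> events" using V_sets by auto
    fix a b assume "a \<in> G" "b \<in> V"
    then obtain a' where a': "a \<in> sets C" "a' \<in> cyl" "AE w in C. w \<in> a \<longleftrightarrow> w \<in> a'" unfolding G_def by blast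
    have S: "a' \<in> sets \<gamma>" "b \<in> sets \<gamma>" using a' cyl_sets V_sets \<open>b \<in> V\<close> by auto
    have "prob (a \<inter> b) = prob (a' \<inter> b)"
      using a' S by (intro prob_cong_AE) auto
    also have "\<dots> = base.prob (a' \<inter> b)" using S by simp
    also have "\<dots> = base.prob a' * base.prob b"
      using a'(2) \<open>b \<in> V\<close> unfolding cyl_def V_def by (auto intro!: indep_cylinder_increment[OF st])
    also have "\<dots> = prob a' * prob b" using S by simp
    also have "prob a' = prob a"
      using a' S by (intro prob_cong_AE) auto
    finally show "prob (a \<inter> b) = prob a * prob b" .
  qed
  from indep_set_sigma_sets[OF this G_Int V_Int]
  have ind: "indep_set (sigma_sets (space C) G) (sigma_sets (space C) V)" .
  have "{(\<lambda>w. w s') -` B \<inter> space \<gamma> | s' B. s' \<in> {0..s} \<and> B \<in> sets (borel :: real measure)} \<union> null_sets C \<subseteq> G"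
  proof (intro Un_least subsetI)
    fix x assume "x \<in> null_sets C"
    \<comment> \<open>A null event is almost surely equal to the empty event, which is itself a
      cylinder; so the augmentation stays inside \<open>G\<close>.\<close>
    moreover have "{} \<in> cyl"
      unfolding cyl_def using st by (intro CollectI exI[of _ "{0}"] exI[of _ "\<lambda>_. {}"]) auto
    ultimately show "x \<in> G" using AE_not_in[of x C] unfolding G_def by (auto intro!: bexI[of _ "{}"])
  next
    fix x assume "x \<in> {(\<lambda>w. w s') -` B \<inter> space \<gamma> | s' B. s' \<in> {0..s} \<and> B \<in> sets (borel :: real measure)}"
    then obtain s' B where x: "x = (\<lambda>w. w s') -` B \<inter> space \<gamma>" "s' \<in> {0..s}" "B \<in> sets (borel :: real measure)"
      by blast
    have "x \<in> cyl"
      unfolding cyl_def using x by (intro CollectI exI[of _ "{s'}"] exI[of _ "\<lambda>_. B"]) auto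
    then show "x \<in> G" using cyl_sets unfolding G_def by auto
  qed
  then have "sets (F s) \<subseteq> sigma_sets (space C) G"
    unfolding sets_F by (simp add: sigma_sets_mono')
  moreover have "V \<subseteq> sigma_sets (space C) V" by auto
  ultimately have "indep_set (sets (F s)) V"
    using ind unfolding indep_sets2_eq by blast
  then show ?thesis unfolding V_def .
qed

section \<open>Integrating out one increment while the past is held fixed\<close>

lemma distr_increment:
  assumes st: "0 \<le> s" "s < t" "t \<le> 1"
  shows "distr C borel (\<lambda>w. w t - w s) = gauss (t - s)"
proof -
  have "distr C borel (\<lambda>w. w t - w s) = distr \<gamma> borel (\<lambda>w. w t - w s)"
    using st by (intro distr_completion borel_measurable_diff path_measurable_base) auto
  also have "\<dots> = distr \<gamma> lborel (\<lambda>w. w t - w s)"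
    by (intro distr_cong) auto
  also have "\<dots> = gauss (t - s)"
    using increment_distributed[OF st] by (simp add: distributed_def)
  finally show ?thesis .
qed

text \<open>Independence in the form that Fubini accepts. The target \<open>N\<close> is arbitrary
  so that several past variables can be frozen together as a tuple.\<close>

lemma joint_distr_increment:
  assumes st: "0 \<le> s" "s < t" "t \<le> 1" and U: "U \<in> F s \<rightarrow>\<^sub>M N"
  shows "distr C N U \<Otimes>\<^sub>M gauss (t - s) = distr C (N \<Otimes>\<^sub>M borel) (\<lambda>w. (U w, w t - w s))"
proof (rule pair_measure_eqI)
  have UC[measurable]: "U \<in> C \<rightarrow>\<^sub>M N" using U st by (intro F_measurable_C) auto
  have [measurable]: "(\<lambda>w. w t - w s) \<in> borel_measurable C"
    using st by (intro borel_measurable_diff path_measurable) auto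
  interpret U: prob_space "distr C N U" by (rule prob_space_distr) fact
  interpret g: prob_space "gauss (t - s)" using st by (intro prob_space_normal_density) simp
  show "sigma_finite_measure (distr C N U)" "sigma_finite_measure (gauss (t - s))" ..
  show "sets (distr C N U \<Otimes>\<^sub>M gauss (t - s)) = sets (distr C (N \<Otimes>\<^sub>M borel) (\<lambda>w. (U w, w t - w s)))"
    by (simp cong: sets_pair_measure_cong)
  fix A D assume "A \<in> sets (distr C N U)" "D \<in> sets (gauss (t - s))"
  then have A[measurable]: "A \<in> sets N" and D[measurable]: "D \<in> sets borel" by auto
  let ?A = "U -` A \<inter> space \<gamma>" and ?D = "{w \<in> space \<gamma>. w t - w s \<in> D}"
  have D': "?D = (\<lambda>w. w t - w s) -` D \<inter> space C" by auto
  have "?A \<in> sets (F s)" using measurable_sets[OF U A] by simp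
  then have "prob (?A \<inter> ?D) = prob ?A * prob ?D"
    using D by (intro indep_setD[OF indep_event_increment[OF st]]) blast+
  then have "emeasure C (?A \<inter> ?D) = emeasure C ?A * emeasure C ?D"
    by (simp add: emeasure_eq_measure ennreal_mult del: emeasure_completion measure_completion)
  moreover have "(\<lambda>w. (U w, w t - w s)) -` (A \<times> D) \<inter> space C = ?A \<inter> ?D" by auto
  moreover have "emeasure (gauss (t - s)) D = emeasure C ?D"
    unfolding distr_increment[OF st, symmetric] D' by (subst emeasure_distr) auto
  moreover have "emeasure (distr C N U) A = emeasure C ?A"
    by (subst emeasure_distr) auto
  moreover have "emeasure (distr C (N \<Otimes>\<^sub>M borel) (\<lambda>w. (U w, w t - w s))) (A \<times> D) =
      emeasure C ((\<lambda>w. (U w, w t - w s)) -` (A \<times> D) \<inter> space C)"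
    by (rule emeasure_distr) auto
  ultimately show "emeasure (distr C N U) A * emeasure (gauss (t - s)) D =
      emeasure (distr C (N \<Otimes>\<^sub>M borel) (\<lambda>w. (U w, w t - w s))) (A \<times> D)"
    by (simp only:)
qed

text \<open>Takes the place of conditioning on the past: by Tonelli the past variable is a parameter
  while the increment is integrated against its Gaussian law. In \<open>tilted_char_step\<close> it
  provides the integrability that the signed version \<open>integral_freeze\<close> assumes.\<close>

lemma nn_integral_freeze:
  assumes st: "0 \<le> s" "s < t" "t \<le> 1" and U: "U \<in> F s \<rightarrow>\<^sub>M N"
    and f[measurable]: "f \<in> borel_measurable (N \<Otimes>\<^sub>M borel)"
  shows "(\<integral>\<^sup>+ w. f (U w, w t - w s) \<partial>C) = (\<integral>\<^sup>+ w. (\<integral>\<^sup>+ x. f (U w, x) \<partial>gauss (t - s)) \<partial>C)"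
proof -
  let ?g = "gauss (t - s)"
  interpret g: prob_space ?g using st by (intro prob_space_normal_density) simp
  have UC[measurable]: "U \<in> C \<rightarrow>\<^sub>M N" using U st by (intro F_measurable_C) auto
  have [measurable]: "(\<lambda>w. w t - w s) \<in> borel_measurable C"
    using st by (intro borel_measurable_diff path_measurable) auto
  have "(\<integral>\<^sup>+ w. f (U w, w t - w s) \<partial>C) = (\<integral>\<^sup>+ z. f z \<partial>distr C (N \<Otimes>\<^sub>M borel) (\<lambda>w. (U w, w t - w s)))"
    by (subst nn_integral_distr) auto
  also have "\<dots> = (\<integral>\<^sup>+ z. f z \<partial>(distr C N U \<Otimes>\<^sub>M ?g))"
    by (simp only: joint_distr_increment[OF st U])
  also have "\<dots> = (\<integral>\<^sup>+ u. (\<integral>\<^sup>+ x. f (u, x) \<partial>?g) \<partial>distr C N U)"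
  proof -
    have "sets (distr C N U \<Otimes>\<^sub>M ?g) = sets (N \<Otimes>\<^sub>M borel)" by (intro sets_pair_measure_cong) auto
    then have "f \<in> borel_measurable (distr C N U \<Otimes>\<^sub>M ?g)" using f measurable_cong_sets by blast
    then show ?thesis by (subst g.nn_integral_fst) auto
  qed
  also have "\<dots> = (\<integral>\<^sup>+ w. (\<integral>\<^sup>+ x. f (U w, x) \<partial>?g) \<partial>C)"
  proof (rule nn_integral_distr)
    have "sets (N \<Otimes>\<^sub>M ?g) = sets (N \<Otimes>\<^sub>M borel)" by (intro sets_pair_measure_cong) auto
    then have "f \<in> borel_measurable (N \<Otimes>\<^sub>M ?g)" using f measurable_cong_sets by blast
    from g.borel_measurable_nn_integral_fst[OF this]
    show "(\<lambda>u. \<integral>\<^sup>+ x. f (u, x) \<partial>?g) \<in> borel_measurable (distr C N U)" by simp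
  qed auto
  finally show ?thesis .
qed

lemma integral_freeze:
  fixes f :: "'b \<times> real \<Rightarrow> 'c::{banach, second_countable_topology}"
  assumes st: "0 \<le> s" "s < t" "t \<le> 1" and U: "U \<in> F s \<rightarrow>\<^sub>M N"
    and f[measurable]: "f \<in> borel_measurable (N \<Otimes>\<^sub>M borel)"
    and int: "integrable C (\<lambda>w. f (U w, w t - w s))"
  shows "(\<integral> w. f (U w, w t - w s) \<partial>C) = (\<integral> w. (\<integral> x. f (U w, x) \<partial>gauss (t - s)) \<partial>C)"
proof -
  let ?g = "gauss (t - s)"
  interpret g: prob_space ?g using st by (intro prob_space_normal_density) simp
  have UC[measurable]: "U \<in> C \<rightarrow>\<^sub>M N" using U st by (intro F_measurable_C) auto
  have [measurable]: "(\<lambda>w. w t - w s) \<in> borel_measurable C"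
    using st by (intro borel_measurable_diff path_measurable) auto
  interpret U: prob_space "distr C N U" by (rule prob_space_distr) fact
  interpret pair_sigma_finite "distr C N U" ?g ..
  have eq: "distr C (N \<Otimes>\<^sub>M borel) (\<lambda>w. (U w, w t - w s)) = distr C N U \<Otimes>\<^sub>M ?g"
    by (simp only: joint_distr_increment[OF st U])
  have "integrable (distr C (N \<Otimes>\<^sub>M borel) (\<lambda>w. (U w, w t - w s))) f"
    using int by (subst integrable_distr_eq) auto
  then have i: "integrable (distr C N U \<Otimes>\<^sub>M ?g) f" unfolding eq .
  have "(\<integral> w. f (U w, w t - w s) \<partial>C) = (\<integral> z. f z \<partial>distr C (N \<Otimes>\<^sub>M borel) (\<lambda>w. (U w, w t - w s)))"
    by (subst integral_distr) auto
  also have "\<dots> = (\<integral> z. f z \<partial>(distr C N U \<Otimes>\<^sub>M ?g))" unfolding eq ..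
  also have "\<dots> = (\<integral> u. (\<integral> x. f (u, x) \<partial>?g) \<partial>distr C N U)"
    using integral_fst'[OF i] by simp
  also have "\<dots> = (\<integral> w. (\<integral> x. f (U w, x) \<partial>?g) \<partial>C)"
  proof (rule integral_distr)
    have "sets (N \<Otimes>\<^sub>M ?g) = sets (N \<Otimes>\<^sub>M borel)" by (intro sets_pair_measure_cong) auto
    then have "f \<in> borel_measurable (N \<Otimes>\<^sub>M ?g)" using f measurable_cong_sets by blast
    then have "(\<lambda>(u, x). f (u, x)) \<in> borel_measurable (N \<Otimes>\<^sub>M ?g)" by simp
    from g.borel_measurable_lebesgue_integral[OF this]
    show "(\<lambda>u. \<integral> x. f (u, x) \<partial>?g) \<in> borel_measurable N" by simp
  qed fact
  finally show ?thesis .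
qed

section \<open>Orthogonality and exponential tilting along a grid\<close>

lemma increment_measurable:
  assumes "0 \<le> s" "s < t" "t \<le> 1"
  shows "(\<lambda>w. w t - w s) \<in> borel_measurable C"
  using assms by (intro borel_measurable_diff path_measurable) auto

lemma indep_mult_increment:
  fixes v :: "real \<Rightarrow> real"
  assumes st: "0 \<le> s" "s < t" "t \<le> 1" and U: "U \<in> borel_measurable (F s)" "integrable C U"
    and v: "integrable (gauss (t - s)) v"
  shows "integrable C (\<lambda>w. U w * v (w t - w s))"
    and "(\<integral>w. U w * v (w t - w s) \<partial>C) = (\<integral>w. U w \<partial>C) * (\<integral>x. v x \<partial>gauss (t - s))"
proof -
  have vm[measurable]: "v \<in> borel_measurable borel" using borel_measurable_integrable[OF v] by simp
  note X[measurable] = increment_measurable[OF st]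
  have "indep_var borel U borel (\<lambda>w. w t - w s)"
    unfolding indep_var_distribution_eq
    using joint_distr_increment[OF st U(1)] distr_increment[OF st] borel_measurable_integrable[OF U(2)] X by simp
  then have "indep_var borel (id \<circ> U) borel (v \<circ> (\<lambda>w. w t - w s))"
    by (rule indep_var_compose) auto
  then have i: "indep_var borel U borel (\<lambda>w. v (w t - w s))" by (simp add: comp_def)
  have vi: "integrable C (\<lambda>w. v (w t - w s))"
    using v unfolding distr_increment[OF st, symmetric] by (subst (asm) integrable_distr_eq) auto
  show "integrable C (\<lambda>w. U w * v (w t - w s))" by (rule indep_var_integrable[OF i U(2) vi])
  have "(\<integral>w. v (w t - w s) \<partial>C) = (\<integral>x. v x \<partial>gauss (t - s))"
    unfolding distr_increment[OF st, symmetric] by (subst integral_distr) auto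
  then show "(\<integral>w. U w * v (w t - w s) \<partial>C) = (\<integral>w. U w \<partial>C) * (\<integral>x. v x \<partial>gauss (t - s))"
    using indep_var_lebesgue_integral[OF i U(2) vi] by simp
qed

text \<open>Mixed terms vanish because the newest factor \<open>v j\<close> has mean 0 and is
  independent of everything before it. With \<open>v\<close> the identity this is the Ito isometry;
  with the centred square it controls the quadratic variation. Measurability of the partial sum is
  carried through the induction since the next step treats that sum as a past variable.\<close>

lemma orthogonal_increments:
  fixes \<zeta> :: "nat \<Rightarrow> path \<Rightarrow> real" and v :: "nat \<Rightarrow> real \<Rightarrow> real"
  assumes g: "grid N s"
    and \<zeta>: "\<And>j. j < N \<Longrightarrow> \<zeta> j \<in> borel_measurable (F (s j))"
      "\<And>j w. j < N \<Longrightarrow> w \<in> space \<gamma> \<Longrightarrow> \<bar>\<zeta> j w\<bar> \<le> B j"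
    and v: "\<And>j. j < N \<Longrightarrow> integrable (gauss (s (Suc j) - s j)) (v j)"
      "\<And>j. j < N \<Longrightarrow> (\<integral>x. v j x \<partial>gauss (s (Suc j) - s j)) = 0"
      "\<And>j. j < N \<Longrightarrow> integrable (gauss (s (Suc j) - s j)) (\<lambda>x. (v j x)\<^sup>2)"
      "\<And>j. j < N \<Longrightarrow> (\<integral>x. (v j x)\<^sup>2 \<partial>gauss (s (Suc j) - s j)) = m j"
  shows "n \<le> N \<Longrightarrow>
    (\<lambda>w. \<Sum>j<n. \<zeta> j w * v j (incr w s j)) \<in> borel_measurable (F (s n)) \<and>
    integrable C (\<lambda>w. (\<Sum>j<n. \<zeta> j w * v j (incr w s j))\<^sup>2) \<and>
    (\<integral>w. (\<Sum>j<n. \<zeta> j w * v j (incr w s j))\<^sup>2 \<partial>C) = (\<Sum>j<n. m j * (\<integral>w. (\<zeta> j w)\<^sup>2 \<partial>C))"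
proof (induction n)
  case 0
  show ?case by simp
next
  case (Suc n)
  then have n: "n < N" by simp
  let ?S = "\<lambda>w. \<Sum>j<n. \<zeta> j w * v j (incr w s j)"
  let ?X = "\<lambda>w. incr w s n" and ?g = "gauss (s (Suc n) - s n)"
  note st = grid_cell[OF g n]
  have IH: "?S \<in> borel_measurable (F (s n))" "integrable C (\<lambda>w. (?S w)\<^sup>2)"
    "(\<integral>w. (?S w)\<^sup>2 \<partial>C) = (\<Sum>j<n. m j * (\<integral>w. (\<zeta> j w)\<^sup>2 \<partial>C))"
    using Suc by auto
  have sn1: "s n \<le> 1" using st by simp
  note ts = \<zeta>(1)[OF n] 
  have \<zeta>C: "\<zeta> n \<in> borel_measurable C" using F_measurable_C[OF sn1 ts] .
  have SC: "?S \<in> borel_measurable C" using F_measurable_C[OF sn1 IH(1)] .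
  have Sint: "integrable C ?S" using square_integrable_imp_integrable[OF SC] IH(2) by simp
  have bnd: "AE w in C. \<bar>\<zeta> n w\<bar> \<le> B n" by (rule AE_I2) (use \<zeta>(2)[OF n] in simp)
  have \<zeta>2: "integrable C (\<lambda>w. (\<zeta> n w)\<^sup>2)"
  proof (rule integrable_const_bound)
    show "AE w in C. norm ((\<zeta> n w)\<^sup>2) \<le> (B n)\<^sup>2"
      using bnd by eventually_elim (simp add: abs_le_square_iff[symmetric])
  qed (use \<zeta>C in simp)
  have S\<zeta>: "integrable C (\<lambda>w. ?S w * \<zeta> n w)"
  proof (rule Bochner_Integration.integrable_bound)
    show "integrable C (\<lambda>w. B n * ?S w)" using Sint by simp
    show "AE w in C. norm (?S w * \<zeta> n w) \<le> norm (B n * ?S w)"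
      using bnd by eventually_elim (auto simp: abs_mult mult.commute intro!: mult_mono)
  qed (use SC \<zeta>C in simp)
  note 1 = indep_mult_increment[OF st _ S\<zeta> v(1)[OF n]]
  note 2 = indep_mult_increment[OF st _ \<zeta>2 v(3)[OF n]]
  have m1: "(\<lambda>w. ?S w * \<zeta> n w) \<in> borel_measurable (F (s n))" using IH(1) ts by (rule borel_measurable_times)
  have m2: "(\<lambda>w. (\<zeta> n w)\<^sup>2) \<in> borel_measurable (F (s n))" using ts by simp
  have vm: "v n \<in> borel_measurable borel" using borel_measurable_integrable[OF v(1)[OF n]] by simp
  have e: "(\<Sum>j<Suc n. \<zeta> j w * v j (incr w s j))\<^sup>2 =
     (?S w)\<^sup>2 + (2 * ((?S w * \<zeta> n w) * v n (?X w)) + (\<zeta> n w)\<^sup>2 * (v n (?X w))\<^sup>2)" for w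
    by (simp add: power2_eq_square algebra_simps)
  note i1 = 1(1)[OF m1] and i2 = 2(1)[OF m2]
  show ?case
  proof (intro conjI)
    have "(\<lambda>w. \<zeta> n w * v n (?X w)) \<in> borel_measurable (F (s (Suc n)))"
    proof (rule borel_measurable_times)
      show "\<zeta> n \<in> borel_measurable (F (s (Suc n)))" using F_mono_measurable[OF _ ts] st by simp
      have "?X \<in> borel_measurable (F (s (Suc n)))"
        using st by (intro borel_measurable_diff path_F) auto
      then show "(\<lambda>w. v n (?X w)) \<in> borel_measurable (F (s (Suc n)))"
        using measurable_compose[OF _ vm] by blast
    qed
    moreover have "?S \<in> borel_measurable (F (s (Suc n)))" using F_mono_measurable[OF _ IH(1)] st by simp
    ultimately show "(\<lambda>w. \<Sum>j<Suc n. \<zeta> j w * v j (incr w s j)) \<in> borel_measurable (F (s (Suc n)))"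
      by simp
    show "integrable C (\<lambda>w. (\<Sum>j<Suc n. \<zeta> j w * v j (incr w s j))\<^sup>2)"
      unfolding e using IH(2) i1 i2 
      by (intro Bochner_Integration.integrable_add integrable_mult_right)
    have "(\<integral>w. (\<Sum>j<Suc n. \<zeta> j w * v j (incr w s j))\<^sup>2 \<partial>C) =
      (\<integral>w. (?S w)\<^sup>2 \<partial>C) + (2 * (\<integral>w. (?S w * \<zeta> n w) * v n (?X w) \<partial>C) + (\<integral>w. (\<zeta> n w)\<^sup>2 * (v n (?X w))\<^sup>2 \<partial>C))"
      unfolding e using IH(2) i1 i2 by (simp del: power_mult_distrib)
    then show "(\<integral>w. (\<Sum>j<Suc n. \<zeta> j w * v j (incr w s j))\<^sup>2 \<partial>C) = (\<Sum>j<Suc n. m j * (\<integral>w. (\<zeta> j w)\<^sup>2 \<partial>C))"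
      using 1(2)[OF m1] 2(2)[OF m2] IH(3) v(2,4)[OF n] by simp
  qed
qed

text \<open>Given the past, the new factor integrates to the Gaussian characteristic function,
  whatever \<open>\<eta>\<close> is. Its imaginary exponential has modulus 1 and its real one has
  mass 1, so the norms of \<open>H\<close> and \<open>G\<close> have the same integral.\<close>

lemma tilted_char_step:
  fixes G :: "path \<Rightarrow> complex" and c :: real
  assumes st: "0 \<le> s" "s < t" "t \<le> 1" and G: "G \<in> borel_measurable (F s)" "integrable C G"
    and \<eta>: "\<eta> \<in> borel_measurable (F s)"
  defines "H \<equiv> \<lambda>w. G w * (of_real (exp (\<eta> w * (w t - w s) - (\<eta> w)\<^sup>2 * (t - s) / 2)) *
      iexp (c * ((w t - w s) - \<eta> w * (t - s))))"
  shows "H \<in> borel_measurable (F t)" "integrable C H"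
    "(\<integral>w. H w \<partial>C) = (\<integral>w. G w \<partial>C) * of_real (exp (- (c\<^sup>2 * (t - s) / 2)))"
proof -
  let ?U = "\<lambda>w. (G w, \<eta> w)"
  define f :: "(complex \<times> real) \<times> real \<Rightarrow> complex" where "f = (\<lambda>z. fst (fst z) *
    (of_real (exp (snd (fst z) * snd z - (snd (fst z))\<^sup>2 * (t - s) / 2)) * iexp (c * (snd z - snd (fst z) * (t - s)))))"
  have U: "?U \<in> F s \<rightarrow>\<^sub>M borel \<Otimes>\<^sub>M borel" using G(1) \<eta> by (rule measurable_Pair)
  have f[measurable]: "f \<in> borel_measurable ((borel \<Otimes>\<^sub>M borel) \<Otimes>\<^sub>M borel)"
    unfolding f_def by measurable
  have H: "H = (\<lambda>w. f (?U w, w t - w s))" by (simp add: H_def f_def)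
  show HF: "H \<in> borel_measurable (F t)"
    unfolding H
  proof (rule measurable_compose[OF _ f], rule measurable_Pair)
    show "?U \<in> F t \<rightarrow>\<^sub>M borel \<Otimes>\<^sub>M borel" using F_mono_measurable[OF _ U] st by simp
    show "(\<lambda>w. w t - w s) \<in> borel_measurable (F t)"
      using st by (intro borel_measurable_diff path_F) auto
  qed
  have HC: "H \<in> borel_measurable C" using F_measurable_C[OF st(3) HF] .
  have GC: "G \<in> borel_measurable C" using F_measurable_C[OF _ G(1)] st by simp
  have "(\<integral>\<^sup>+ w. norm (H w) \<partial>C) = (\<integral>\<^sup>+ w. (\<lambda>z. ennreal (norm (f z))) (?U w, w t - w s) \<partial>C)"
    unfolding H by simp
  also have "\<dots> = (\<integral>\<^sup>+ w. (\<integral>\<^sup>+ x. norm (f (?U w, x)) \<partial>gauss (t - s)) \<partial>C)"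
    by (rule nn_integral_freeze[OF st U]) measurable
  also have "\<dots> = (\<integral>\<^sup>+ w. norm (G w) \<partial>C)"
  proof (rule nn_integral_cong)
    fix w
    have "(\<integral>\<^sup>+ x. norm (f (?U w, x)) \<partial>gauss (t - s)) = 
      (\<integral>\<^sup>+ x. ennreal (norm (G w)) * ennreal (exp (\<eta> w * x - (\<eta> w)\<^sup>2 * (t - s) / 2)) \<partial>gauss (t - s))"
      by (intro nn_integral_cong) (simp add: f_def norm_mult ennreal_mult[symmetric] norm_exp_i_times)
    also have "\<dots> = norm (G w)"
      using gauss_nn_integral_exp[of "t - s" "\<eta> w"] st by (subst nn_integral_cmult) auto
    finally show "(\<integral>\<^sup>+ x. norm (f (?U w, x)) \<partial>gauss (t - s)) = norm (G w)" .
  qed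
  also have "\<dots> < \<infinity>" using G(2) by (simp add: integrable_iff_bounded)
  finally show Hi: "integrable C H" using HC by (simp add: integrable_iff_bounded)
  have "(\<integral>w. H w \<partial>C) = (\<integral>w. (\<integral>x. f (?U w, x) \<partial>gauss (t - s)) \<partial>C)"
    unfolding H by (rule integral_freeze[OF st U f]) (use Hi in \<open>simp add: H\<close>)
  also have "\<dots> = (\<integral>w. G w * of_real (exp (- (c\<^sup>2 * (t - s) / 2))) \<partial>C)"
    using gauss_integral_tilted_iexp[of "t - s"] st by (simp add: f_def)
  finally show "(\<integral>w. H w \<partial>C) = (\<integral>w. G w \<partial>C) * of_real (exp (- (c\<^sup>2 * (t - s) / 2)))"
    by simp
qed

text \<open>Discrete Girsanov: the right-hand side is free of \<open>\<eta>\<close>, so under the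
  tilt the compensated sum keeps the Gaussian law that the sum has without it.\<close>

lemma tilted_char_grid:
  fixes c :: "nat \<Rightarrow> real"
  assumes g: "grid N s" and \<eta>: "\<And>j. j < N \<Longrightarrow> \<eta> j \<in> borel_measurable (F (s j))"
  defines "D \<equiv> \<lambda>n w. exp ((\<Sum>j<n. \<eta> j w * incr w s j) - (\<Sum>j<n. (\<eta> j w)\<^sup>2 * (s (Suc j) - s j)) / 2)"
  defines "X \<equiv> \<lambda>n w. (\<Sum>j<n. c j * incr w s j) - (\<Sum>j<n. c j * \<eta> j w * (s (Suc j) - s j))"
  shows "n \<le> N \<Longrightarrow> (\<lambda>w. of_real (D n w) * iexp (X n w)) \<in> borel_measurable (F (s n)) \<and>
    integrable C (\<lambda>w. of_real (D n w) * iexp (X n w)) \<and>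
    (\<integral>w. of_real (D n w) * iexp (X n w) \<partial>C) = of_real (exp (- ((\<Sum>j<n. (c j)\<^sup>2 * (s (Suc j) - s j)) / 2)))"
proof (induction n)
  case 0
  show ?case using prob_space by (simp add: D_def X_def)
next
  case (Suc n)
  then have n: "n < N" by simp
  let ?G = "\<lambda>w. complex_of_real (D n w) * iexp (X n w)"
  have IH: "?G \<in> borel_measurable (F (s n))" "integrable C ?G"
    "(\<integral>w. ?G w \<partial>C) = of_real (exp (- ((\<Sum>j<n. (c j)\<^sup>2 * (s (Suc j) - s j)) / 2)))"
    using Suc by auto
  have e: "of_real (D (Suc n) w) * iexp (X (Suc n) w) =
    ?G w * (of_real (exp (\<eta> n w * incr w s n - (\<eta> n w)\<^sup>2 * (s (Suc n) - s n) / 2)) *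
      iexp (c n * ((incr w s n) - \<eta> n w * (s (Suc n) - s n))))" for w
  proof -
    have "D (Suc n) w = D n w * exp (\<eta> n w * incr w s n - (\<eta> n w)\<^sup>2 * (s (Suc n) - s n) / 2)"
      by (simp add: D_def exp_add[symmetric]) (simp add: field_simps)
    moreover have "iexp (X (Suc n) w) = iexp (X n w) * iexp (c n * ((incr w s n) - \<eta> n w * (s (Suc n) - s n)))"
      by (simp add: X_def exp_add[symmetric] algebra_simps)
    ultimately show ?thesis by (simp add: mult_ac)
  qed
  have "exp (- ((\<Sum>j<n. (c j)\<^sup>2 * (s (Suc j) - s j)) / 2)) * exp (- ((c n)\<^sup>2 * (s (Suc n) - s n) / 2))
      = exp (- ((\<Sum>j<Suc n. (c j)\<^sup>2 * (s (Suc j) - s j)) / 2))"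
    by (simp add: exp_add[symmetric] add_divide_distrib)
  then show ?case
    unfolding e using tilted_char_step[OF grid_cell[OF g n] IH(1,2) \<eta>[OF n], of "c n"] IH(3)
    by (simp del: sum.lessThan_Suc flip: of_real_mult)
qed

end

section \<open>Simple integrands\<close>

context wiener_space
begin

text \<open>Quantifying over all grids containing \<open>S\<close> makes pairs of simple processes and their integrals
  closed under linear combinations without an explicit common refinement.\<close>

definition simple_on :: "real set \<Rightarrow> (real \<Rightarrow> path \<Rightarrow> real) \<Rightarrow> (real \<Rightarrow> path \<Rightarrow> real) \<Rightarrow> bool" where
  "simple_on S X I \<longleftrightarrow> (\<forall>N s. grid N s \<and> S \<subseteq> s ` {..N} \<longrightarrow>
     (\<forall>j<N. X (s (Suc j)) \<in> borel_measurable (F (s j))) \<and>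
     (\<forall>j<N. \<exists>B. \<forall>w\<in>space \<gamma>. \<bar>X (s (Suc j)) w\<bar> \<le> B) \<and>
     (\<forall>j<N. \<forall>x w. s j < x \<and> x \<le> s (Suc j) \<longrightarrow> X x w = X (s (Suc j)) w) \<and>
     (\<forall>i\<le>N. \<forall>w. I (s i) w = (\<Sum>j<i. X (s (Suc j)) w * incr w s j)))"

text \<open>Any time of [0,1] can be adjoined to the grid in \<open>simple_on\<close>, so
  \<open>X\<close> determines \<open>I\<close> on the whole interval.\<close>

definition simple_pair :: "(real \<Rightarrow> path \<Rightarrow> real) \<Rightarrow> (real \<Rightarrow> path \<Rightarrow> real) \<Rightarrow> bool" where
  "simple_pair X I \<longleftrightarrow> (\<exists>S. finite S \<and> S \<subseteq> {0..1} \<and> simple_on S X I)"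

lemma simple_onD:
  assumes "simple_on S X I" "grid N s" "S \<subseteq> s ` {..N}"
  shows "j < N \<Longrightarrow> X (s (Suc j)) \<in> borel_measurable (F (s j))"
    and "j < N \<Longrightarrow> \<exists>B. \<forall>w\<in>space \<gamma>. \<bar>X (s (Suc j)) w\<bar> \<le> B"
    and "j < N \<Longrightarrow> s j < x \<Longrightarrow> x \<le> s (Suc j) \<Longrightarrow> X x w = X (s (Suc j)) w"
    and "i \<le> N \<Longrightarrow> I (s i) w = (\<Sum>j<i. X (s (Suc j)) w * incr w s j)"
  using assms unfolding simple_on_def by blast+

lemma simple_on_mono: "simple_on S X I \<Longrightarrow> S \<subseteq> T \<Longrightarrow> simple_on T X I"
  unfolding simple_on_def by (meson order_trans)

lemma simple_on_lincomb:
  assumes 1: "simple_on S X I" and 2: "simple_on S Y J"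
  shows "simple_on S (\<lambda>x w. a * X x w + b * Y x w) (\<lambda>x w. a * I x w + b * J x w)"
  unfolding simple_on_def
proof (intro allI impI, elim conjE)
  fix N s assume g: "grid N s" "S \<subseteq> s ` {..N}"
  note 1 = simple_onD[OF 1 g] and 2 = simple_onD[OF 2 g]
  show "(\<forall>j<N. (\<lambda>w. a * X (s (Suc j)) w + b * Y (s (Suc j)) w) \<in> borel_measurable (F (s j))) \<and>
    (\<forall>j<N. \<exists>B. \<forall>w\<in>space \<gamma>. \<bar>a * X (s (Suc j)) w + b * Y (s (Suc j)) w\<bar> \<le> B) \<and>
    (\<forall>j<N. \<forall>x w. s j < x \<and> x \<le> s (Suc j) \<longrightarrow> a * X x w + b * Y x w = a * X (s (Suc j)) w + b * Y (s (Suc j)) w) \<and>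
    (\<forall>i\<le>N. \<forall>w. a * I (s i) w + b * J (s i) w = (\<Sum>j<i. (a * X (s (Suc j)) w + b * Y (s (Suc j)) w) * incr w s j))"
  proof (intro conjI allI impI)
    fix j assume j: "j < N"
    show "(\<lambda>w. a * X (s (Suc j)) w + b * Y (s (Suc j)) w) \<in> borel_measurable (F (s j))"
      using 1(1)[OF j] 2(1)[OF j] by simp
    obtain A B where AB: "\<forall>w\<in>space \<gamma>. \<bar>X (s (Suc j)) w\<bar> \<le> A" "\<forall>w\<in>space \<gamma>. \<bar>Y (s (Suc j)) w\<bar> \<le> B"
      using 1(2)[OF j] 2(2)[OF j] by blast
    have "\<bar>a * X (s (Suc j)) w + b * Y (s (Suc j)) w\<bar> \<le> \<bar>a\<bar> * A + \<bar>b\<bar> * B" if "w \<in> space \<gamma>" for w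
    proof -
      have "\<bar>a * X (s (Suc j)) w + b * Y (s (Suc j)) w\<bar> \<le> \<bar>a\<bar> * \<bar>X (s (Suc j)) w\<bar> + \<bar>b\<bar> * \<bar>Y (s (Suc j)) w\<bar>"
        using abs_triangle_ineq[of "a * X (s (Suc j)) w" "b * Y (s (Suc j)) w"] by (simp add: abs_mult)
      also have "\<dots> \<le> \<bar>a\<bar> * A + \<bar>b\<bar> * B" using AB that by (intro add_mono mult_left_mono) auto
      finally show ?thesis .
    qed
    then show "\<exists>B. \<forall>w\<in>space \<gamma>. \<bar>a * X (s (Suc j)) w + b * Y (s (Suc j)) w\<bar> \<le> B" by blast
  next
    fix j x w assume j: "j < N" and x: "s j < x \<and> x \<le> s (Suc j)"
    then show "a * X x w + b * Y x w = a * X (s (Suc j)) w + b * Y (s (Suc j)) w"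
      using 1(3)[OF j, of x w] 2(3)[OF j, of x w] by simp
  next
    fix i w assume i: "i \<le> N"
    show "a * I (s i) w + b * J (s i) w = (\<Sum>j<i. (a * X (s (Suc j)) w + b * Y (s (Suc j)) w) * incr w s j)"
      unfolding 1(4)[OF i, of w] 2(4)[OF i, of w] by (simp add: sum_distrib_left sum.distrib[symmetric] algebra_simps)
  qed
qed

lemma simple_pair_lincomb:
  assumes "simple_pair X I" "simple_pair Y J"
  shows "simple_pair (\<lambda>x w. a * X x w + b * Y x w) (\<lambda>x w. a * I x w + b * J x w)"
proof -
  obtain S T where "finite S" "S \<subseteq> {0..1}" "simple_on S X I" "finite T" "T \<subseteq> {0..1}" "simple_on T Y J"
    using assms unfolding simple_pair_def by blast
  then show ?thesis
    unfolding simple_pair_def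
    by (intro exI[of _ "S \<union> T"] conjI simple_on_lincomb) (auto intro: simple_on_mono)
qed

lemma simple_pair_zero: "simple_pair (\<lambda>_ _. 0) (\<lambda>_ _. 0)"
  unfolding simple_pair_def simple_on_def by (intro exI[of _ "{}"]) auto

section \<open>Step processes as simple pairs\<close>

lemma time_grid_mono: 
  assumes t: "time_grid n t" and ij: "i \<le> j" "j \<le> n"
  shows "t i \<le> t j"
  using ij
proof (induction j)
  case (Suc j)
  have "t j \<le> t (Suc j)" using t Suc.prems by (simp add: time_grid_def)
  then show ?case using Suc by (cases "i = Suc j") auto
qed simp

lemma time_grid_range: "time_grid n t \<Longrightarrow> i \<le> n \<Longrightarrow> 0 \<le> t i \<and> t i \<le> 1"
  using time_grid_mono[of n t 0 i] time_grid_mono[of n t i n] by (auto simp: time_grid_def)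

text \<open>The increment over (a, b], stopped at \<open>s i\<close>, telescopes over the cells
  inside (a, b]. A cell is recognised by its right end because cells are left-open.\<close>

lemma grid_increment_sum:
  assumes g: "grid N s" and ab: "a \<in> s ` {..N}" "b \<in> s ` {..N}" "a \<le> b" and i: "i \<le> N"
  shows "w (min (s i) b) - w (min (s i) a) = (\<Sum>j<i. indicator {a<..b} (s (Suc j)) * incr w s j :: real)"
proof -
  obtain p q where pq: "p \<le> N" "q \<le> N" "a = s p" "b = s q" using ab by auto
  have le: "p \<le> q" using ab(3) grid_le_iff[OF g pq(1,2)] pq by simp
  have mn: "min (s i) (s m) = s (min i m)" if "m \<le> N" for m
    using grid_le_iff[OF g i that] by (auto simp: min_def)
  have "(\<Sum>j<i. indicator {a<..b} (s (Suc j)) * incr w s j) = 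
      (\<Sum>j<i. if j \<in> {min i p..<min i q} then incr w s j else 0)"
  proof (intro sum.cong refl)
    fix j assume "j \<in> {..<i}"
    then have j: "j < i" "Suc j \<le> N" using i by auto
    have "s (Suc j) \<in> {a<..b} \<longleftrightarrow> j \<in> {min i p..<min i q}"
      using grid_less_iff[OF g pq(1) j(2)] grid_le_iff[OF g j(2) pq(2)] j pq by auto
    then show "indicator {a<..b} (s (Suc j)) * incr w s j = 
       (if j \<in> {min i p..<min i q} then incr w s j else 0)"
      by (auto simp: indicator_def)
  qed
  also have "\<dots> = (\<Sum>j\<in>{min i p..<min i q}. incr w s j)"
    by (subst sum.inter_restrict[symmetric]) (auto intro!: sum.cong)
  also have "\<dots> = w (s (min i q)) - w (s (min i p))"
    using le by (subst sum_Suc_diff') auto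
  finally show ?thesis using mn[OF pq(1)] mn[OF pq(2)] pq by simp
qed

text \<open>On a grid containing all \<open>t i\<close>, the condition \<open>t i < x\<close> for
  \<open>x\<close> in cell \<open>j\<close> amounts to \<open>t i \<le> s j\<close>. So the step
  process is constant on the cell, and every coefficient active there is known at the left end,
  although its value is read at the right end.\<close>

lemma simple_integrand_simple_on:
  assumes "simple_integrand \<gamma> n t \<xi>"
  shows "simple_on (t ` {..n}) (step_process n t \<xi>) (step_integral n t \<xi>)"
  unfolding simple_on_def
proof (intro allI impI, elim conjE)
  fix N s assume g: "grid N s" and sub: "t ` {..n} \<subseteq> s ` {..N}"
  have t: "time_grid n t" and \<xi>: "\<And>i. i < n \<Longrightarrow> \<xi> i \<in> borel_measurable (F (t i))"
      "\<And>i. i < n \<Longrightarrow> \<exists>C. \<forall>w\<in>space \<gamma>. \<bar>\<xi> i w\<bar> \<le> C"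
    using assms by (auto simp: simple_integrand_def)
  have ts: "t i \<in> s ` {..N}" if "i \<le> n" for i using sub that by auto
  have cell: "t i < x \<longleftrightarrow> t i \<le> s j" if "i \<le> n" "j < N" "s j < x" "x \<le> s (Suc j)" for i j x
  proof -
    have "t i \<in> s ` {..N}" using ts that(1) by blast
    then obtain p where p: "p \<le> N" "t i = s p" by auto
    have "t i < x \<Longrightarrow> p < Suc j" using p that grid_less_iff[OF g p(1), of "Suc j"] by auto
    then show ?thesis using p that grid_le_iff[OF g p(1), of j] by auto
  qed
  show "(\<forall>j<N. step_process n t \<xi> (s (Suc j)) \<in> borel_measurable (F (s j))) \<and>
     (\<forall>j<N. \<exists>B. \<forall>w\<in>space \<gamma>. \<bar>step_process n t \<xi> (s (Suc j)) w\<bar> \<le> B) \<and>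
     (\<forall>j<N. \<forall>x w. s j < x \<and> x \<le> s (Suc j) \<longrightarrow> step_process n t \<xi> x w = step_process n t \<xi> (s (Suc j)) w) \<and>
     (\<forall>i\<le>N. \<forall>w. step_integral n t \<xi> (s i) w = (\<Sum>j<i. step_process n t \<xi> (s (Suc j)) w * incr w s j))"
  proof (intro conjI allI impI)
    fix j assume j: "j < N"
    show "step_process n t \<xi> (s (Suc j)) \<in> borel_measurable (F (s j))"
      unfolding step_process_def[abs_def]
    proof (rule borel_measurable_sum)
      fix i assume i: "i \<in> {..<n}"
      show "(\<lambda>w. \<xi> i w * indicator {t i<..t (Suc i)} (s (Suc j))) \<in> borel_measurable (F (s j))"
      proof (cases "t i \<le> s j")
        case True
        then have "\<xi> i \<in> borel_measurable (F (s j))" using \<xi>(1)[of i] i F_mono_measurable[of "t i" "s j"] by simp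
        then show ?thesis by simp
      next
        case False
        then have "\<not> t i < s (Suc j)" using cell[of i j "s (Suc j)"] i j grid_cell[OF g j] by simp
        then show ?thesis by simp
      qed
    qed
    have "\<forall>i. \<exists>C. i < n \<longrightarrow> (\<forall>w\<in>space \<gamma>. \<bar>\<xi> i w\<bar> \<le> C)" using \<xi>(2) by blast
    then obtain B where B: "\<And>i w. i < n \<Longrightarrow> w \<in> space \<gamma> \<Longrightarrow> \<bar>\<xi> i w\<bar> \<le> B i" by metis
    have "\<bar>step_process n t \<xi> (s (Suc j)) w\<bar> \<le> (\<Sum>i<n. B i)" if w: "w \<in> space \<gamma>" for w
      unfolding step_process_def
    proof (rule order_trans[OF sum_abs sum_mono])
      fix i assume "i \<in> {..<n}"
      then show "\<bar>\<xi> i w * indicator {t i<..t (Suc i)} (s (Suc j))\<bar> \<le> B i"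
        using B[of i w] w by (auto simp: indicator_def intro: order_trans[OF abs_ge_zero])
    qed
    then show "\<exists>B. \<forall>w\<in>space \<gamma>. \<bar>step_process n t \<xi> (s (Suc j)) w\<bar> \<le> B" by blast
  next
    fix j x w assume j: "j < N" and x: "s j < x \<and> x \<le> s (Suc j)"
    show "step_process n t \<xi> x w = step_process n t \<xi> (s (Suc j)) w"
      unfolding step_process_def
    proof (intro sum.cong refl)
      fix i assume i: "i \<in> {..<n}"
      then have "x \<in> {t i<..t (Suc i)} \<longleftrightarrow> s (Suc j) \<in> {t i<..t (Suc i)}"
        using cell[of i j x] cell[of i j "s (Suc j)"] cell[of "Suc i" j x] cell[of "Suc i" j "s (Suc j)"] x j 
          grid_cell[OF g j] by (auto simp: not_less[symmetric])
      then show "\<xi> i w * indicator {t i<..t (Suc i)} x = \<xi> i w * indicator {t i<..t (Suc i)} (s (Suc j))"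
        by (simp add: indicator_def)
    qed
  next
    fix i w assume i: "i \<le> N"
    have "step_integral n t \<xi> (s i) w = (\<Sum>k<n. \<xi> k w * (\<Sum>j<i. indicator {t k<..t (Suc k)} (s (Suc j)) * incr w s j))"
      unfolding step_integral_def
      using t i by (intro sum.cong refl arg_cong2[where f="(*)"] grid_increment_sum[OF g] ts) (auto simp: time_grid_def)
    also have "\<dots> = (\<Sum>k<n. \<Sum>j<i. \<xi> k w * indicator {t k<..t (Suc k)} (s (Suc j)) * incr w s j)"
      by (simp only: sum_distrib_left mult.assoc)
    also have "\<dots> = (\<Sum>j<i. \<Sum>k<n. \<xi> k w * indicator {t k<..t (Suc k)} (s (Suc j)) * incr w s j)"
      by (rule sum.swap)
    finally show "step_integral n t \<xi> (s i) w = (\<Sum>j<i. step_process n t \<xi> (s (Suc j)) w * incr w s j)"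
      by (simp only: step_process_def sum_distrib_right)
  qed
qed

lemma simple_integrand_simple_pair:
  assumes "simple_integrand \<gamma> n t \<xi>"
  shows "simple_pair (step_process n t \<xi>) (step_integral n t \<xi>)"
  unfolding simple_pair_def
proof (intro exI conjI)
  show "t ` {..n} \<subseteq> {0..1}" using assms time_grid_range[of n t] by (auto simp: simple_integrand_def)
qed (auto intro: simple_integrand_simple_on[OF assms])

section \<open>Simple pairs evaluated on a grid\<close>

lemma simple_pair_grid:
  assumes "simple_pair X I"
  obtains N s where "grid N s" "simple_on (s ` {..N}) X I"
proof -
  obtain S where S: "finite S" "S \<subseteq> {0..1}" "simple_on S X I" using assms unfolding simple_pair_def by blast
  obtain N s where "grid N s" "s ` {..N} = insert 0 (insert 1 S)" using finite_set_unit_grid[OF S(1,2)] .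
  then show thesis using that[of N s] simple_on_mono[OF S(3), of "s ` {..N}"] by auto
qed

lemma simple_pair_grid2:
  assumes "simple_pair X I" "simple_pair Y J"
  obtains N s where "grid N s" "simple_on (s ` {..N}) X I" "simple_on (s ` {..N}) Y J"
proof -
  obtain S where S: "finite S" "S \<subseteq> {0..1}" "simple_on S X I" using assms unfolding simple_pair_def by blast
  obtain T where T: "finite T" "T \<subseteq> {0..1}" "simple_on T Y J" using assms unfolding simple_pair_def by blast
  have ST: "finite (S \<union> T)" "S \<union> T \<subseteq> {0..1}" using S T by auto
  obtain N s where "grid N s" "s ` {..N} = insert 0 (insert 1 (S \<union> T))" using finite_set_unit_grid[OF ST] .
  then show thesis using that[of N s] simple_on_mono[OF S(3), of "s ` {..N}"] simple_on_mono[OF T(3), of "s ` {..N}"] by auto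
qed

lemma simple_on_measurable_I:
  assumes "simple_on S X I" "grid N s" "S \<subseteq> s ` {..N}" "i \<le> N"
  shows "I (s i) \<in> borel_measurable C"
proof -
  note d = simple_onD[OF assms(1-3)]
  have "X (s (Suc j)) \<in> borel_measurable C" if "j < N" for j
    using F_measurable_C[OF _ d(1)[OF that]] grid_cell[OF assms(2) that] by simp
  then have "(\<lambda>w. \<Sum>j<i. X (s (Suc j)) w * incr w s j) \<in> borel_measurable C"
    using assms(4) grid_cell[OF assms(2)]
    by (intro borel_measurable_sum borel_measurable_times increment_measurable) auto
  then show ?thesis using d(4)[OF assms(4)] by (simp cong: measurable_cong)
qed

lemma simple_on_square_integral:
  assumes X: "simple_on S X I" "grid N s" "S \<subseteq> s ` {..N}"
  shows "energy X w = (\<Sum>j<N. (X (s (Suc j)) w)\<^sup>2 * (s (Suc j) - s j))"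
proof (rule cell_constant_integral(2)[OF X(2)])
  fix j y assume "j < N" "s j < y" "y \<le> s (Suc j)"
  then show "(X y w)\<^sup>2 = (X (s (Suc j)) w)\<^sup>2" using simple_onD(3)[OF X, of j y w] by simp
qed

lemma simple_on_cross_integral:
  assumes X: "simple_on S X I" and c: "simple_on S (\<lambda>x _. c x) K" and g: "grid N s" "S \<subseteq> s ` {..N}"
  shows "(\<integral>x. c x * X x w \<partial>unit_leb) = (\<Sum>j<N. c (s (Suc j)) * X (s (Suc j)) w * (s (Suc j) - s j))"
proof (rule cell_constant_integral(2)[OF g(1)])
  fix j y assume "j < N" "s j < y" "y \<le> s (Suc j)"
  then show "c y * X y w = c (s (Suc j)) * X (s (Suc j)) w"
    using simple_onD(3)[OF X g, of j y w] simple_onD(3)[OF c g, of j y] by simp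
qed

lemma simple_pair_section:
  assumes "simple_pair X I"
  shows "(\<lambda>x. X x w) \<in> borel_measurable unit_leb" "integrable unit_leb (\<lambda>x. (X x w)\<^sup>2)"
proof -
  obtain N s where g: "grid N s" and s: "simple_on (s ` {..N}) X I"
    using simple_pair_grid[OF assms] .
  have c: "X y w = X (s (Suc j)) w" if "j < N" "s j < y" "y \<le> s (Suc j)" for j y
    using simple_onD(3)[OF s g order_refl that] .
  have "integrable unit_leb (\<lambda>x. X x w)"
    by (rule cell_constant_integral(1)[OF g]) (rule c)
  then show "(\<lambda>x. X x w) \<in> borel_measurable unit_leb" by (rule borel_measurable_integrable)
  show "integrable unit_leb (\<lambda>x. (X x w)\<^sup>2)"
    by (rule cell_constant_integral(1)[OF g]) (rule arg_cong[where f="\<lambda>x. x\<^sup>2"], rule c)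
qed

lemma simple_on_measurable_X:
  assumes "simple_on S X I" "grid N s" "S \<subseteq> s ` {..N}" "j < N"
  shows "X (s (Suc j)) \<in> borel_measurable C"
  using F_measurable_C[OF _ simple_onD(1)[OF assms]] grid_cell[OF assms(2,4)] by simp

lemma simple_pair_tilted_char:
  assumes X: "simple_pair X I" and c: "simple_pair (\<lambda>x _. c x) K"
  defines "D \<equiv> \<lambda>w. exp (I 1 w - energy X w / 2)"
  shows "integrable C D" "(\<integral>w. D w \<partial>C) = 1"
    "(\<integral>w. of_real (D w) * iexp (K 1 w - (\<integral>x. c x * X x w \<partial>unit_leb)) \<partial>C) = of_real (exp (- (sq_norm c / 2)))"
    "(\<lambda>w. of_real (D w) * iexp (K 1 w - (\<integral>x. c x * X x w \<partial>unit_leb))) \<in> borel_measurable C"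
proof -
  obtain N s where g: "grid N s" and s: "simple_on (s ` {..N}) X I" "simple_on (s ` {..N}) (\<lambda>x _. c x) K"
    using simple_pair_grid2[OF X c] .
  note x = simple_onD[OF s(1) g order_refl] and k = simple_onD[OF s(2) g order_refl]
  have sN: "s N = 1" using g by (simp add: grid_def)
  have I1: "I 1 w = (\<Sum>j<N. X (s (Suc j)) w * incr w s j)" for w using x(4)[of N w] sN by simp
  have K1: "K 1 w = (\<Sum>j<N. c (s (Suc j)) * incr w s j)" for w using k(4)[of N w] sN by simp
  note X2 = simple_on_square_integral[OF s(1) g order_refl] and c2 = simple_on_square_integral[OF s(2) g order_refl]
    and cX = simple_on_cross_integral[OF s g order_refl]
  note t = tilted_char_grid[OF g x(1), where n=N]
  \<comment> \<open>With \<open>c = 0\<close> the imaginary exponential is 1, and the same formula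
    says that \<open>D\<close> has expectation 1.\<close>
  note t1 = t[where c="\<lambda>j. c (s (Suc j))", OF _ order_refl] and t0 = t[where c="\<lambda>_. 0", OF _ order_refl]
  show "(\<integral>w. of_real (D w) * iexp (K 1 w - (\<integral>x. c x * X x w \<partial>unit_leb)) \<partial>C) = of_real (exp (- (sq_norm c / 2)))"
    unfolding D_def I1 K1 X2 c2 cX by (rule t1[THEN conjunct2, THEN conjunct2])
  show "(\<lambda>w. of_real (D w) * iexp (K 1 w - (\<integral>x. c x * X x w \<partial>unit_leb))) \<in> borel_measurable C"
    unfolding D_def I1 K1 X2 c2 cX by (rule borel_measurable_integrable[OF t1[THEN conjunct2, THEN conjunct1]])
  have D0: "integrable C (\<lambda>w. complex_of_real (D w))" "(\<integral>w. complex_of_real (D w) \<partial>C) = 1"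
    using t0 unfolding D_def I1 X2 by simp_all
  then show "integrable C D" "(\<integral>w. D w \<partial>C) = 1"
    by (simp_all add: complex_of_real_integrable_eq)
qed

text \<open>The bound comes from the grid generated by \<open>S\<close> and is valid on all finer
  grids, so a mesh can be chosen after it. Time 0 lies in no cell and is excluded.\<close>

lemma simple_on_bounded:
  assumes "simple_on S X I" "finite S" "S \<subseteq> {0..1}"
  obtains B where "B \<ge> 0" "\<And>w x. w \<in> space \<gamma> \<Longrightarrow> 0 < x \<Longrightarrow> x \<le> 1 \<Longrightarrow> \<bar>X x w\<bar> \<le> B"
proof -
  obtain N s where g: "grid N s" "s ` {..N} = insert 0 (insert 1 S)" using finite_set_unit_grid[OF assms(2,3)] .
  have S: "S \<subseteq> s ` {..N}" using g by auto
  note d = simple_onD[OF assms(1) g(1) S]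
  have "\<forall>j. \<exists>B. j < N \<longrightarrow> (\<forall>w\<in>space \<gamma>. \<bar>X (s (Suc j)) w\<bar> \<le> B)" using d(2) by blast
  then obtain B where B: "\<And>j w. j < N \<Longrightarrow> w \<in> space \<gamma> \<Longrightarrow> \<bar>X (s (Suc j)) w\<bar> \<le> B j" by metis
  show thesis
  proof (rule that)
    show "0 \<le> (\<Sum>j<N. \<bar>B j\<bar>)" by (simp add: sum_nonneg)
    fix w x assume w: "w \<in> space \<gamma>" and x: "0 < x" "x \<le> (1::real)"
    obtain j where j: "j < N" "s j < x" "x \<le> s (Suc j)" using grid_cover[OF g(1) x] .
    have "\<bar>X x w\<bar> \<le> \<bar>B j\<bar>" using d(3)[OF j, of w] B[OF j(1) w] by simp
    also have "\<dots> \<le> (\<Sum>j<N. \<bar>B j\<bar>)" using j by (intro member_le_sum) auto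
    finally show "\<bar>X x w\<bar> \<le> (\<Sum>j<N. \<bar>B j\<bar>)" .
  qed
qed

lemma simple_on_increment:
  assumes "simple_on S X I" "grid N s" "S \<subseteq> s ` {..N}" "l < N"
  shows "I (s (Suc l)) w - I (s l) w = X (s (Suc l)) w * incr w s l"
  using simple_onD(4)[OF assms(1-3), of "Suc l" w] simple_onD(4)[OF assms(1-3), of l w] assms(4) by simp

text \<open>The error is a sum of orthogonal terms, the squared value on a cell times the squared
  Brownian increment minus its mean. Its second moment is at most \<open>2 * B ^ 4\<close> times the
  mesh, and Chebyshev finishes.\<close>

lemma simple_quadratic_variation:
  assumes X: "simple_on S X I" "finite S" "S \<subseteq> {0..1}" and pos: "\<delta> > 0" "e > 0"
  obtains n p where "grid n p" "S \<subseteq> p ` {..n}" "\<And>i. i < n \<Longrightarrow> p (Suc i) - p i < \<delta>"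
    "(\<lambda>w. (\<Sum>l<n. (I (p (Suc l)) w - I (p l) w)\<^sup>2) - energy X w) \<in> borel_measurable C"
    "tail_prob (\<lambda>w. (\<Sum>l<n. (I (p (Suc l)) w - I (p l) w)\<^sup>2) - energy X w) e < e"
proof -
  obtain B where B: "B \<ge> 0" "\<And>w x. w \<in> space \<gamma> \<Longrightarrow> 0 < x \<Longrightarrow> x \<le> 1 \<Longrightarrow> \<bar>X x w\<bar> \<le> B"
    using simple_on_bounded[OF X] by blast
  \<comment> \<open>Chebyshev at level \<open>e\<close> asks for a second moment below
    \<open>e ^ 3\<close>, while the bound will be \<open>2 * B ^ 4 * d\<close>. The summand 4 keeps
    the denominator positive when \<open>B = 0\<close> and the inequality strict.\<close>
  define d where "d = min \<delta> (e ^ 3 / (4 * B ^ 4 + 4))"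
  have B4: "4 * B ^ 4 + 4 > 0" using B(1) by (simp add: add_nonneg_pos)
  have d: "d > 0" "d \<le> \<delta>" "2 * B ^ 4 * d < e ^ 3"
  proof -
    show "d > 0" "d \<le> \<delta>" using pos B4 by (simp_all add: d_def)
    have "d * (4 * B ^ 4 + 4) \<le> e ^ 3" using B4 by (simp add: pos_le_divide_eq[symmetric] d_def)
    moreover have "2 * B ^ 4 * d < d * (4 * B ^ 4 + 4)"
    proof -
      have "0 < d * (2 * B ^ 4 + 4)" using \<open>d > 0\<close> B(1) by (intro mult_pos_pos add_nonneg_pos) auto
      then show ?thesis by (simp add: algebra_simps)
    qed
    ultimately show "2 * B ^ 4 * d < e ^ 3" by simp
  qed
  obtain n p where g: "grid n p" "S \<subseteq> p ` {..n}" "\<And>i. i < n \<Longrightarrow> p (Suc i) - p i < d"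
    using fine_unit_grid[OF X(2,3) d(1)] by blast
  define \<zeta> where "\<zeta> j w = (X (p (Suc j)) w)\<^sup>2" for j w
  define v where "v j = (\<lambda>x::real. x\<^sup>2 - (p (Suc j) - p j))" for j
  define R where "R = (\<lambda>w. (\<Sum>l<n. (I (p (Suc l)) w - I (p l) w)\<^sup>2) - energy X w)"
  have R: "R w = (\<Sum>j<n. \<zeta> j w * v j (incr w p j))" for w
    unfolding R_def simple_on_square_integral[OF X(1) g(1,2)] sum_subtractf[symmetric]
  proof (intro sum.cong refl)
    fix l assume "l \<in> {..<n}"
    then have "I (p (Suc l)) w - I (p l) w = X (p (Suc l)) w * incr w p l"
      by (intro simple_on_increment[OF X(1) g(1,2)]) simp
    then have "(I (p (Suc l)) w - I (p l) w)\<^sup>2 = (X (p (Suc l)) w)\<^sup>2 * (incr w p l)\<^sup>2"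
      by (simp only: power_mult_distrib)
    then show "(I (p (Suc l)) w - I (p l) w)\<^sup>2 - (X (p (Suc l)) w)\<^sup>2 * (p (Suc l) - p l) = \<zeta> l w * v l (incr w p l)"
      by (simp only: \<zeta>_def v_def) (simp add: algebra_simps)
  qed
  have bX: "\<bar>\<zeta> j w\<bar> \<le> B\<^sup>2" if "j < n" "w \<in> space \<gamma>" for j w
    using B(2)[OF that(2), of "p (Suc j)"] grid_cell[OF g(1) that(1)] abs_le_square_iff[of "X (p (Suc j)) w" B] B(1)
    by (simp add: \<zeta>_def)
  have \<zeta>F: "\<zeta> j \<in> borel_measurable (F (p j))" if "j < n" for j
    unfolding \<zeta>_def using simple_onD(1)[OF X(1) g(1,2) that] by simp
  have O: "(\<lambda>w. \<Sum>j<n. \<zeta> j w * v j (incr w p j)) \<in> borel_measurable (F (p n)) \<and>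
    integrable C (\<lambda>w. (\<Sum>j<n. \<zeta> j w * v j (incr w p j))\<^sup>2) \<and>
    (\<integral>w. (\<Sum>j<n. \<zeta> j w * v j (incr w p j))\<^sup>2 \<partial>C) = (\<Sum>j<n. (2 * (p (Suc j) - p j)\<^sup>2) * (\<integral>w. (\<zeta> j w)\<^sup>2 \<partial>C))"
  proof (rule orthogonal_increments[where B="\<lambda>_. B\<^sup>2", OF g(1)])
    fix j assume "j < n"
    then have "p (Suc j) - p j > 0" using grid_cell[OF g(1)] by simp
    from gauss_centred_square[OF this]
    show "integrable (gauss (p (Suc j) - p j)) (v j)" "(\<integral>x. v j x \<partial>gauss (p (Suc j) - p j)) = 0"
      "integrable (gauss (p (Suc j) - p j)) (\<lambda>x. (v j x)\<^sup>2)" 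
      "(\<integral>x. (v j x)\<^sup>2 \<partial>gauss (p (Suc j) - p j)) = 2 * (p (Suc j) - p j)\<^sup>2"
      by (simp_all add: v_def)
  qed (use bX \<zeta>F in auto)
  have p1: "p n = 1" "p 0 = 0" using g(1) by (simp_all add: grid_def)
  have RC: "R \<in> borel_measurable C" "integrable C (\<lambda>w. (R w)\<^sup>2)"
    using O F_measurable_C[of "p n" R borel] p1 by (simp_all add: R[abs_def])
  have "(\<integral>w. (R w)\<^sup>2 \<partial>C) = (\<Sum>j<n. (2 * (p (Suc j) - p j)\<^sup>2) * (\<integral>w. (\<zeta> j w)\<^sup>2 \<partial>C))"
    using O by (simp add: R)
  also have "\<dots> \<le> (\<Sum>j<n. 2 * B ^ 4 * d * (p (Suc j) - p j))"
  proof (intro sum_mono)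
    fix j assume "j \<in> {..<n}"
    then have j: "j < n" by simp
    have \<zeta>2: "(\<zeta> j w)\<^sup>2 \<le> B ^ 4" if "w \<in> space C" for w
      using power_mono[OF bX[OF j, of w], of 2] that by simp
    have m: "\<zeta> j \<in> borel_measurable C" unfolding \<zeta>_def using simple_on_measurable_X[OF X(1) g(1,2) j] by simp
    have "integrable C (\<lambda>w. (\<zeta> j w)\<^sup>2)"
      using \<zeta>2 m by (intro integrable_const_bound[of _ "B ^ 4"] AE_I2) auto
    then have "(\<integral>w. (\<zeta> j w)\<^sup>2 \<partial>C) \<le> (\<integral>w. B ^ 4 \<partial>C)" using \<zeta>2 by (intro integral_mono) auto
    then have E: "(\<integral>w. (\<zeta> j w)\<^sup>2 \<partial>C) \<le> B ^ 4" by (simp add: base.prob_space)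
    have "(p (Suc j) - p j)\<^sup>2 \<le> d * (p (Suc j) - p j)"
      using g(3)[OF j] grid_cell[OF g(1) j] unfolding power2_eq_square by (intro mult_right_mono) auto
    then have "2 * (p (Suc j) - p j)\<^sup>2 * (\<integral>w. (\<zeta> j w)\<^sup>2 \<partial>C) \<le> 2 * (d * (p (Suc j) - p j)) * B ^ 4"
      (is "_ \<le> ?b") using E d(1) grid_cell[OF g(1) j] by (intro mult_mono) auto
    also have "?b = 2 * B ^ 4 * d * (p (Suc j) - p j)" by (simp only: mult_ac)
    finally show "2 * (p (Suc j) - p j)\<^sup>2 * (\<integral>w. (\<zeta> j w)\<^sup>2 \<partial>C) \<le> 2 * B ^ 4 * d * (p (Suc j) - p j)" .
  qed
  also have "\<dots> = 2 * B ^ 4 * d"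
    using sum_lessThan_telescope[of p n] p1 by (simp add: sum_distrib_left[symmetric])
  also have "\<dots> < e ^ 3" by (rule d(3))
  finally have E: "(\<integral>w. (R w)\<^sup>2 \<partial>C) < e ^ 3" .
  have S': "{w \<in> space C. \<bar>R w\<bar> \<ge> e} \<in> sets C" using RC(1) by measurable
  have "tail_prob R e \<le> prob {w \<in> space C. \<bar>R w\<bar> \<ge> e}"
    by (rule finite_measure_mono[OF _ S']) auto
  also have "\<dots> \<le> (\<integral>w. (R w)\<^sup>2 \<partial>C) / e\<^sup>2"
    by (rule second_moment_method[OF RC pos(2)])
  also have "\<dots> < e ^ 3 / e\<^sup>2" using E pos by (intro divide_strict_right_mono) auto
  also have "\<dots> = e" using pos by (simp add: power3_eq_cube power2_eq_square)
  finally have P: "tail_prob R e < e" .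
  have mesh: "p (Suc i) - p i < \<delta>" if "i < n" for i using g(3)[OF that] d(2) by simp
  show thesis using that[OF g(1,2) mesh] RC(1) P unfolding R_def by blast
qed

text \<open>The process is truncated when its accumulated energy exceeds \<open>\<delta>\<close>; on a grid this truncation
  is still adapted, so no stopping times are needed.\<close>

lemma simple_square_sum_bound:
  assumes Y: "simple_pair Y J" and p: "grid n p" and pos: "\<epsilon> > 0" "\<delta> > 0"
  shows "prob {w \<in> space C. (\<Sum>l<n. (J (p (Suc l)) w - J (p l) w)\<^sup>2) > \<epsilon>} \<le>
    prob {w \<in> space C. energy Y w > \<delta>} + \<delta> / \<epsilon>"
proof -
  obtain S where S: "finite S" "S \<subseteq> {0..1}" "simple_on S Y J" using Y unfolding simple_pair_def by blast
  have pr: "p ` {..n} \<subseteq> {0..1}" using grid_range[OF p] by auto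
  have "finite (S \<union> p ` {..n})" "S \<union> p ` {..n} \<subseteq> {0..1}" using S pr by auto
  from finite_set_unit_grid[OF this]
  obtain N s where g: "grid N s" and sS: "s ` {..N} = insert 0 (insert 1 (S \<union> p ` {..n}))" .
  have SN: "S \<subseteq> s ` {..N}" using sS by auto
  have "\<exists>i\<le>N. s i = p l" if "l \<le> n" for l
  proof -
    have "p l \<in> s ` {..N}" unfolding sS using that by auto
    then show ?thesis by auto
  qed
  then obtain idx where idx: "\<And>l. l \<le> n \<Longrightarrow> idx l \<le> N" "\<And>l. l \<le> n \<Longrightarrow> s (idx l) = p l"
    by metis
  have idx0: "idx 0 = 0" using grid_le_iff[OF g, of "idx 0" 0] idx[of 0] p g by (simp add: grid_def)
  have idxn: "idx n = N" using grid_le_iff[OF g, of N "idx n"] idx[of n] p g by (simp add: grid_def)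
  have idx_mono: "idx l \<le> idx (Suc l)" if "l < n" for l
    using grid_le_iff[OF g, of "idx l" "idx (Suc l)"] idx[of l] idx[of "Suc l"] grid_cell[OF p that] that by simp
  define y where "y j = Y (s (Suc j))" for j
  define \<Delta> where "\<Delta> j = s (Suc j) - s j" for j
  have \<Delta>: "\<Delta> j > 0" if "j < N" for j using grid_cell[OF g that] by (simp add: \<Delta>_def)
  \<comment> \<open>The sum includes cell \<open>j\<close> itself: the value on that cell is already
    known at \<open>s j\<close>. Hence the truncated process stops before its energy passes
    \<open>\<delta>\<close>, with no overshoot by a last cell.\<close>
  define T where "T j w = (\<Sum>i<Suc j. (y i w)\<^sup>2 * \<Delta> i)" for j w
  define \<eta> where "\<eta> j w = y j w * indicator {..\<delta>} (T j w)" for j w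
  \<comment> \<open>Selects the fine cells that lie in the coarse cell \<open>l\<close> of the
    partition \<open>p\<close>.\<close>
  define b where "b l j = (if idx l \<le> j \<and> j < idx (Suc l) then 1 else 0 :: real)" for l j
  define Q where "Q w = (\<Sum>l<n. (\<Sum>j<N. b l j * \<eta> j w * incr w s j)\<^sup>2)" for w
  note d = simple_onD[OF S(3) g SN]
  have yF: "y i \<in> borel_measurable (F (s j))" if "i \<le> j" "j < N" for i j
    using d(1)[of i] F_mono_measurable[of "s i" "s j"] grid_le[OF g, of i j] that unfolding y_def by simp
  have TF: "T j \<in> borel_measurable (F (s j))" if "j < N" for j
    unfolding T_def[abs_def] using that
    by (intro borel_measurable_sum borel_measurable_times borel_measurable_power yF borel_measurable_const) auto
  have \<eta>F: "\<eta> j \<in> borel_measurable (F (s j))" if "j < N" for j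
    unfolding \<eta>_def using yF[OF order_refl that] TF[OF that] by measurable
  have "\<forall>j. \<exists>B. j < N \<longrightarrow> (\<forall>w\<in>space \<gamma>. \<bar>y j w\<bar> \<le> B)" using d(2) unfolding y_def by blast
  then obtain B where B: "\<And>j w. j < N \<Longrightarrow> w \<in> space \<gamma> \<Longrightarrow> \<bar>y j w\<bar> \<le> B j" by metis
  have \<eta>y: "\<bar>\<eta> j w\<bar> \<le> \<bar>y j w\<bar>" for j w by (simp add: \<eta>_def indicator_def)
  have \<eta>B: "\<bar>\<eta> j w\<bar> \<le> B j" if "j < N" "w \<in> space \<gamma>" for j w
    using B[OF that] \<eta>y[of j w] by linarith
  have b\<eta>B: "\<bar>b l j * \<eta> j w\<bar> \<le> B j" if "j < N" "w \<in> space \<gamma>" for l j w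
    using \<eta>B[OF that] by (auto simp: b_def)
  \<comment> \<open>If cell \<open>m\<close> is kept, then \<open>T m w \<le> \<delta>\<close>
    bounds the whole sum; otherwise its term is 0 and the induction hypothesis is enough.\<close>
  have \<eta>_sum: "m \<le> N \<Longrightarrow> (\<Sum>j<m. (\<eta> j w)\<^sup>2 * \<Delta> j) \<le> \<delta>" for m w
  proof (induction m)
    case (Suc m)
    show ?case
    proof (cases "T m w \<le> \<delta>")
      case True
      have "(\<Sum>j<Suc m. (\<eta> j w)\<^sup>2 * \<Delta> j) \<le> T m w"
        unfolding T_def using Suc.prems \<eta>y \<Delta>
        by (intro sum_mono mult_right_mono) (auto simp: abs_le_square_iff[symmetric] intro: less_imp_le)
      then show ?thesis using True by simp
    next
      case False
      then show ?thesis using Suc by (simp add: \<eta>_def)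
    qed
  qed (use pos in simp)
  \<comment> \<open>Each fine cell lies in exactly one coarse cell. Summing the isometry over the
    coarse cells therefore returns the total energy, and the bound does not depend on
    \<open>p\<close>.\<close>
  have b_sum: "(\<Sum>l<n. b l j) = 1" if "j < N" for j
  proof -
    have "b l j = of_bool (j < idx (Suc l)) - of_bool (j < idx l)" if "l < n" for l
      using idx_mono[OF that] by (auto simp: b_def)
    then have "(\<Sum>l<n. b l j) = (\<Sum>l<n. of_bool (j < idx (Suc l)) - of_bool (j < idx l))"
      by (intro sum.cong) auto
    also have "\<dots> = of_bool (j < idx n) - of_bool (j < idx 0)"
      by (rule sum_lessThan_telescope)
    finally show ?thesis using that idx0 idxn by simp
  qed
  have O: "integrable C (\<lambda>w. (\<Sum>j<N. b l j * \<eta> j w * incr w s j)\<^sup>2) \<and>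
    (\<integral>w. (\<Sum>j<N. b l j * \<eta> j w * incr w s j)\<^sup>2 \<partial>C) = (\<Sum>j<N. \<Delta> j * (\<integral>w. (b l j * \<eta> j w)\<^sup>2 \<partial>C))" for l
  proof (rule conjunct2[OF orthogonal_increments[where \<zeta>="\<lambda>j w. b l j * \<eta> j w" and B=B and v="\<lambda>_ x. x" and n=N, OF g]])
    fix j assume j: "j < N"
    then show "(\<lambda>w. b l j * \<eta> j w) \<in> borel_measurable (F (s j))" using \<eta>F[OF j] by simp
    show "\<bar>b l j * \<eta> j w\<bar> \<le> B j" if "w \<in> space \<gamma>" for w using b\<eta>B[OF j that] .
    show "integrable (gauss (s (Suc j) - s j)) (\<lambda>x. x)" "(\<integral>x. x \<partial>gauss (s (Suc j) - s j)) = 0"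
      "integrable (gauss (s (Suc j) - s j)) (\<lambda>x. x\<^sup>2)" "(\<integral>x. x\<^sup>2 \<partial>gauss (s (Suc j) - s j)) = \<Delta> j"
      using gauss_moments[OF \<Delta>[OF j, unfolded \<Delta>_def]] by (simp_all add: \<Delta>_def)
  qed simp
  have \<eta>i: "integrable C (\<lambda>w. (\<eta> j w)\<^sup>2)" if "j < N" for j
  proof (rule integrable_const_bound)
    show "AE w in C. norm ((\<eta> j w)\<^sup>2) \<le> (B j)\<^sup>2"
    proof (rule AE_I2)
      fix w assume "w \<in> space C"
      then have "\<bar>\<eta> j w\<bar> \<le> \<bar>B j\<bar>" using \<eta>B[OF that, of w] by simp
      then show "norm ((\<eta> j w)\<^sup>2) \<le> (B j)\<^sup>2" by (simp add: abs_le_square_iff)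
    qed
    show "(\<lambda>w. (\<eta> j w)\<^sup>2) \<in> borel_measurable C"
      using F_measurable_C[OF _ \<eta>F[OF that]] grid_cell[OF g that] by simp
  qed
  have Qi: "integrable C Q" unfolding Q_def using O by simp
  have "(\<integral>w. Q w \<partial>C) = (\<Sum>l<n. \<Sum>j<N. \<Delta> j * (\<integral>w. (b l j * \<eta> j w)\<^sup>2 \<partial>C))"
    unfolding Q_def using O by simp
  also have "\<dots> = (\<Sum>l<n. \<Sum>j<N. b l j * (\<Delta> j * (\<integral>w. (\<eta> j w)\<^sup>2 \<partial>C)))"
    by (intro sum.cong refl) (simp add: b_def)
  also have "\<dots> = (\<Sum>j<N. \<Sum>l<n. b l j * (\<Delta> j * (\<integral>w. (\<eta> j w)\<^sup>2 \<partial>C)))"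
    by (rule sum.swap)
  also have "\<dots> = (\<Sum>j<N. (\<integral>w. (\<eta> j w)\<^sup>2 * \<Delta> j \<partial>C))"
    by (intro sum.cong refl) (simp add: sum_distrib_right[symmetric] b_sum mult.commute)
  also have "\<dots> = (\<integral>w. (\<Sum>j<N. (\<eta> j w)\<^sup>2 * \<Delta> j) \<partial>C)"
    using \<eta>i by (subst Bochner_Integration.integral_sum) auto
  also have "\<dots> \<le> (\<integral>w. \<delta> \<partial>C)"
    using \<eta>i \<eta>_sum[of N] by (intro integral_mono) auto
  also have "\<dots> = \<delta>" by (simp add: base.prob_space)
  finally have EQ: "(\<integral>w. Q w \<partial>C) \<le> \<delta>" .
  have Q0: "Q w \<ge> 0" for w unfolding Q_def by (simp add: sum_nonneg)
  have V: "energy Y w = (\<Sum>j<N. (y j w)\<^sup>2 * \<Delta> j)" for w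
    unfolding simple_on_square_integral[OF S(3) g SN] y_def \<Delta>_def ..
  have yC: "y j \<in> borel_measurable C" if "j < N" for j
    unfolding y_def using simple_on_measurable_X[OF S(3) g SN that] .
  have Vm: "(\<lambda>w. energy Y w) \<in> borel_measurable C"
    unfolding V using yC by (intro borel_measurable_sum borel_measurable_times borel_measurable_power) auto
  have incr: "J (p (Suc l)) w - J (p l) w = (\<Sum>j<N. b l j * y j w * incr w s j)" if l: "l < n" for l w
  proof -
    have "J (p (Suc l)) w - J (p l) w = J (s (idx (Suc l))) w - J (s (idx l)) w" using idx l by simp
    also have "\<dots> = (\<Sum>j\<in>{0..<idx (Suc l)}. y j w * incr w s j) - (\<Sum>j\<in>{0..<idx l}. y j w * incr w s j)"
      using d(4)[OF idx(1)[of "Suc l"], of w] d(4)[OF idx(1)[of l], of w] l by (simp add: y_def lessThan_atLeast0)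
    also have "\<dots> = (\<Sum>j\<in>{idx l..<idx (Suc l)}. y j w * incr w s j)"
      using idx_mono[OF l] by (intro sum_diff_nat_ivl) auto
    also have "\<dots> = (\<Sum>j\<in>{..<N} \<inter> {idx l..<idx (Suc l)}. y j w * incr w s j)"
      using idx(1)[of "Suc l"] l by (intro sum.cong) auto
    also have "\<dots> = (\<Sum>j<N. if j \<in> {idx l..<idx (Suc l)} then y j w * incr w s j else 0)"
      by (rule sum.inter_restrict) simp
    also have "\<dots> = (\<Sum>j<N. b l j * y j w * incr w s j)"
      by (intro sum.cong refl) (auto simp: b_def)
    finally show ?thesis .
  qed
  \<comment> \<open>Where the total energy is at most \<open>\<delta>\<close> nothing is truncated,
    so \<open>Q\<close> is the sum of squared increments itself.\<close>
  have sub: "{w \<in> space C. (\<Sum>l<n. (J (p (Suc l)) w - J (p l) w)\<^sup>2) > \<epsilon>} \<subseteq>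
      {w \<in> space C. energy Y w > \<delta>} \<union> {w \<in> space C. Q w \<ge> \<epsilon>}"
  proof
    fix w assume w: "w \<in> {w \<in> space C. (\<Sum>l<n. (J (p (Suc l)) w - J (p l) w)\<^sup>2) > \<epsilon>}"
    show "w \<in> {w \<in> space C. energy Y w > \<delta>} \<union> {w \<in> space C. Q w \<ge> \<epsilon>}"
    proof (cases "energy Y w > \<delta>")
      case False
      have "T j w \<le> \<delta>" if "j < N" for j
      proof -
        have nn: "0 \<le> (y i w)\<^sup>2 * \<Delta> i" if "i < N" for i using \<Delta>[OF that] by simp
        have "T j w \<le> (\<Sum>j<N. (y j w)\<^sup>2 * \<Delta> j)"
          unfolding T_def using that by (intro sum_mono2 nn) auto
        then show ?thesis using False V[of w] by simp
      qed
      then have "\<eta> j w = y j w" if "j < N" for j using that by (simp add: \<eta>_def)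
      then have "Q w = (\<Sum>l<n. (J (p (Suc l)) w - J (p l) w)\<^sup>2)"
        unfolding Q_def using incr by (intro sum.cong refl arg_cong[where f="\<lambda>x. x\<^sup>2"]) auto
      then show ?thesis using w by auto
    qed (use w in auto)
  qed
  have A: "{w \<in> space C. energy Y w > \<delta>} \<in> sets C" using Vm by measurable
  have Qm: "Q \<in> borel_measurable C" using Qi by (rule borel_measurable_integrable)
  have A': "{w \<in> space C. Q w \<ge> \<epsilon>} \<in> sets C" using Qm by measurable
  have "prob {w \<in> space C. (\<Sum>l<n. (J (p (Suc l)) w - J (p l) w)\<^sup>2) > \<epsilon>} \<le> 
    prob ({w \<in> space C. energy Y w > \<delta>} \<union> {w \<in> space C. Q w \<ge> \<epsilon>})"
    using A A' by (intro finite_measure_mono[OF sub] sets.Un)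
  also have "\<dots> \<le> prob {w \<in> space C. energy Y w > \<delta>} + prob {w \<in> space C. Q w \<ge> \<epsilon>}"
    using A A' by (rule measure_Un_le)
  also have "prob {w \<in> space C. Q w \<ge> \<epsilon>} \<le> (\<integral>w. Q w \<partial>C) / \<epsilon>"
    using Qi Q0 pos by (intro integral_Markov_inequality_measure[where A="{}"]) auto
  also have "\<dots> \<le> \<delta> / \<epsilon>" using EQ pos by (intro divide_right_mono) auto
  finally show ?thesis by simp
qed

end

section \<open>The Ito integral and its bracket\<close>

context wiener_space
begin

text \<open>This is how predictability is used: joint measurability makes time sections measurable,
  and time integrals measurable functions of the path.\<close>

lemma predictable_joint_measurable:
  assumes X: "predictable_process \<gamma> X"
  shows "(\<lambda>(t, w). X t w) \<in> borel_measurable (restrict_space borel {0..1} \<Otimes>\<^sub>M C)"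
proof -
  let ?Q = "restrict_space borel {0..1::real} \<Otimes>\<^sub>M C"
  let ?G = "{{0} \<times> A | A. A \<in> sets (F 0)} \<union> {{s<..t} \<times> A | s t A. 0 \<le> s \<and> s < t \<and> t \<le> 1 \<and> A \<in> sets (F s)}"
  have sp: "space ?Q = {0..1} \<times> space \<gamma>"
    by (simp add: space_pair_measure space_restrict_space)
  have GQ: "?G \<subseteq> sets ?Q"
  proof (intro Un_least subsetI)
    fix x assume "x \<in> {{0::real} \<times> A | A. A \<in> sets (F 0)}"
    then obtain A where A: "x = {0::real} \<times> A" "A \<in> sets (F 0)" by blast
    have "A \<in> sets C" using sets_F_C[of 0] A by auto
    moreover have "{0::real} \<in> sets (restrict_space borel {0..1::real})" by (intro sets_restrict_space_iff[THEN iffD2]) auto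
    ultimately show "x \<in> sets ?Q" unfolding A by (intro pair_measureI)
  next
    fix x assume "x \<in> {{s<..t} \<times> A | s t A. 0 \<le> s \<and> s < t \<and> t \<le> 1 \<and> A \<in> sets (F s)}"
    then obtain s t A where A: "x = {s<..t} \<times> A" "0 \<le> s" "s < t" "t \<le> 1" "A \<in> sets (F s)" by blast
    have "A \<in> sets C" using sets_F_C[of s] A by auto
    moreover have "{s<..t} \<in> sets (restrict_space borel {0..1::real})" 
      using A by (intro sets_restrict_space_iff[THEN iffD2]) auto
    ultimately show "x \<in> sets ?Q" unfolding A by (intro pair_measureI)
  qed
  have "?G \<subseteq> Pow ({0..1} \<times> space \<gamma>)" using GQ sets.sets_into_space unfolding sp[symmetric] by blast
  then have "sets (predictable_sigma \<gamma>) = sigma_sets ({0..1} \<times> space \<gamma>) ?G"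
    unfolding predictable_sigma_def by (rule sets_measure_of)
  then have 1: "sets (predictable_sigma \<gamma>) \<subseteq> sets ?Q"
    using sets.sigma_sets_subset[OF GQ] unfolding sp by simp
  have 2: "space (predictable_sigma \<gamma>) = space ?Q"
    unfolding sp predictable_sigma_def by (simp add: space_measure_of_conv)
  have "(\<lambda>(t, w). X t w) \<in> borel_measurable (predictable_sigma \<gamma>)"
    using X by (simp add: predictable_process_def)
  then show ?thesis using 1 2 unfolding measurable_def by auto
qed

lemma unit_leb_measurable_restrict:
  assumes "f \<in> restrict_space borel {0..1::real} \<rightarrow>\<^sub>M N"
  shows "f \<in> unit_leb \<rightarrow>\<^sub>M N"
proof -
  have "sets (restrict_space borel {0..1::real}) \<subseteq> sets unit_leb"
    unfolding sets_restrict_space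
  proof (rule image_mono, rule subsetI)
    fix A :: "real set" assume "A \<in> sets borel"
    then show "A \<in> sets lebesgue" by (intro sets_completionI_sets) simp
  qed
  then show ?thesis using assms unfolding measurable_def by (auto simp: space_restrict_space)
qed

lemma joint_section_measurable:
  assumes f: "(\<lambda>(t, w). f t w) \<in> restrict_space borel {0..1::real} \<Otimes>\<^sub>M C \<rightarrow>\<^sub>M N" and w: "w \<in> space \<gamma>"
  shows "(\<lambda>t. f t w) \<in> unit_leb \<rightarrow>\<^sub>M N"
proof (rule unit_leb_measurable_restrict)
  have "w \<in> space C" using w by simp
  from measurable_compose[OF measurable_Pair2'[OF this] f]
  show "(\<lambda>t. f t w) \<in> restrict_space borel {0..1} \<rightarrow>\<^sub>M N" by simp
qed

lemma nn_integral_section_measurable: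
  fixes f :: "real \<Rightarrow> path \<Rightarrow> ennreal"
  assumes f: "(\<lambda>(t, w). f t w) \<in> borel_measurable (restrict_space borel {0..1} \<Otimes>\<^sub>M C)"
  shows "(\<lambda>w. \<integral>\<^sup>+ t. f t w \<partial>unit_leb) \<in> borel_measurable C"
proof -
  let ?R = "restrict_space lborel {0..1::real}"
  have "emeasure ?R (space ?R) \<noteq> \<infinity>"
    by (subst emeasure_restrict_space) (auto simp: space_restrict_space)
  then interpret R: finite_measure ?R by (rule finite_measureI)
  \<comment> \<open>Joint measurability refers to the Borel sets in the time variable, so the
    Lebesgue integral is first rewritten over the Borel restriction, to which Tonelli
    applies.\<close>
  have e: "(\<integral>\<^sup>+ t. f t w \<partial>unit_leb) = (\<integral>\<^sup>+ t. f t w \<partial>?R)" for w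
  proof -
    have "(\<integral>\<^sup>+ t. f t w \<partial>unit_leb) = (\<integral>\<^sup>+ t. f t w * indicator {0..1} t \<partial>lebesgue)"
      by (rule nn_integral_restrict_space) simp
    also have "\<dots> = (\<integral>\<^sup>+ t. f t w * indicator {0..1} t \<partial>lborel)"
      by (rule nn_integral_completion)
    also have "\<dots> = (\<integral>\<^sup>+ t. f t w \<partial>?R)"
      by (rule nn_integral_restrict_space[symmetric]) simp
    finally show ?thesis .
  qed
  have "sets (restrict_space borel {0..1} \<Otimes>\<^sub>M C) = sets (?R \<Otimes>\<^sub>M C)"
    by (intro sets_pair_measure_cong sets_restrict_space_cong) auto
  then have "(\<lambda>(t, w). f t w) \<in> borel_measurable (?R \<Otimes>\<^sub>M C)"
    using f by (simp cong: measurable_cong_sets)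
  then have "(\<lambda>(w, t). f t w) \<in> borel_measurable (C \<Otimes>\<^sub>M ?R)"
    using measurable_pair_swap_iff[of "\<lambda>(w, t). f t w" C ?R borel] by simp
  from R.borel_measurable_nn_integral[OF this] show ?thesis unfolding e .
qed

lemma step_process_joint_measurable:
  assumes "simple_integrand \<gamma> n t \<xi>"
  shows "(\<lambda>(s, w). step_process n t \<xi> s w) \<in> borel_measurable (restrict_space borel {0..1} \<Otimes>\<^sub>M C)"
proof -
  have t: "time_grid n t" and \<xi>: "\<And>i. i < n \<Longrightarrow> \<xi> i \<in> borel_measurable (F (t i))"
    using assms by (auto simp: simple_integrand_def)
  have \<xi>C: "\<xi> i \<in> borel_measurable C" if "i < n" for i
    using F_measurable_C[OF _ \<xi>[OF that]] time_grid_range[OF t, of i] that by simp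
  have "(\<lambda>z. step_process n t \<xi> (fst z) (snd z)) \<in> borel_measurable (restrict_space borel {0..1} \<Otimes>\<^sub>M C)"
    unfolding step_process_def
  proof (intro borel_measurable_sum borel_measurable_times)
    fix i assume "i \<in> {..<n}"
    then show "(\<lambda>z. \<xi> i (snd z)) \<in> borel_measurable (restrict_space borel {0..1} \<Otimes>\<^sub>M C)"
      using measurable_compose[OF measurable_snd \<xi>C[of i]] by simp
    have "indicator {t i<..t (Suc i)} \<in> borel_measurable (restrict_space borel {0..1::real})"
      by (intro measurable_restrict_space1 borel_measurable_indicator) simp
    from measurable_compose[OF measurable_fst this]
    show "(\<lambda>z. indicator {t i<..t (Suc i)} (fst z) :: real) \<in> borel_measurable (restrict_space borel {0..1} \<Otimes>\<^sub>M C)" .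
  qed
  then show ?thesis by (simp add: case_prod_beta')
qed

end

text \<open>Fixes one approximating sequence taken from the existential in
  \<open>ito_integral\<close>, to be shared by the identification of the bracket and the limit of
  the tilted laws.\<close>

locale ito_approximation = wiener_space +
  fixes X M :: "real \<Rightarrow> path \<Rightarrow> real"
    and n :: "nat \<Rightarrow> nat" and t :: "nat \<Rightarrow> nat \<Rightarrow> real" and \<xi> :: "nat \<Rightarrow> nat \<Rightarrow> path \<Rightarrow> real"
  assumes predictable: "predictable_process \<gamma> X"
    and finite_energy: "AE w in \<gamma>. (\<integral>\<^sup>+ s. ennreal ((X s w)\<^sup>2) \<partial>unit_leb) < \<infinity>"
    and M_adapted: "adapted_process \<gamma> M" and M_continuous: "continuous_process \<gamma> M"
    and simple: "\<And>k. simple_integrand \<gamma> (n k) (t k) (\<xi> k)"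
    and X_limit: "\<And>\<epsilon>. \<epsilon> > 0 \<Longrightarrow> (\<lambda>k. measure C {w \<in> space \<gamma>.
        (\<integral>\<^sup>+ s. ennreal ((step_process (n k) (t k) (\<xi> k) s w - X s w)\<^sup>2) \<partial>unit_leb) > ennreal \<epsilon>}) \<longlonglongrightarrow> 0"
    and M_limit: "\<And>\<epsilon>. \<epsilon> > 0 \<Longrightarrow> (\<lambda>k. measure C {w \<in> space \<gamma>.
        \<exists>s\<in>{0..1}. \<bar>step_integral (n k) (t k) (\<xi> k) s w - M s w\<bar> > \<epsilon>}) \<longlonglongrightarrow> 0"
begin

section \<open>Errors of the simple approximations, in probability\<close>

abbreviation "Xs k \<equiv> step_process (n k) (t k) (\<xi> k)"
abbreviation "Is k \<equiv> step_integral (n k) (t k) (\<xi> k)"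
abbreviation "err k w \<equiv> \<integral>s. (Xs k s w - X s w)\<^sup>2 \<partial>unit_leb"

lemma Xs_simple: "simple_pair (Xs k) (Is k)"
  by (rule simple_integrand_simple_pair[OF simple])

lemma X_section: "w \<in> space \<gamma> \<Longrightarrow> (\<lambda>s. X s w) \<in> borel_measurable unit_leb"
  by (rule joint_section_measurable[OF predictable_joint_measurable[OF predictable]])

lemma X_square_integrable: "AE w in C. integrable unit_leb (\<lambda>s. (X s w)\<^sup>2)"
proof -
  have "AE w in C. (\<integral>\<^sup>+ s. ennreal ((X s w)\<^sup>2) \<partial>unit_leb) < \<infinity>"
    using finite_energy by (rule AE_completion)
  moreover have "AE w in C. w \<in> space \<gamma>" using AE_space[of C] by simp
  ultimately show ?thesis
  proof eventually_elim
    case (elim w)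
    then show ?case using X_section[of w] by (simp add: integrable_iff_bounded)
  qed
qed

lemmas Xs_section = simple_pair_section[OF Xs_simple]

lemma joint_square_error:
  "(\<lambda>w. \<integral>\<^sup>+ s. ennreal ((Xs k s w - X s w)\<^sup>2) \<partial>unit_leb) \<in> borel_measurable C"
proof (rule nn_integral_section_measurable)
  have "(\<lambda>z. (case z of (s, w) \<Rightarrow> Xs k s w) - (case z of (s, w) \<Rightarrow> X s w)) \<in> borel_measurable (restrict_space borel {0..1} \<Otimes>\<^sub>M C)"
    by (intro borel_measurable_diff step_process_joint_measurable[OF simple] predictable_joint_measurable[OF predictable])
  then have "(\<lambda>z. ennreal (((case z of (s, w) \<Rightarrow> Xs k s w) - (case z of (s, w) \<Rightarrow> X s w))\<^sup>2)) \<in> borel_measurable (restrict_space borel {0..1} \<Otimes>\<^sub>M C)"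
    by measurable
  then show "(\<lambda>(s, w). ennreal ((Xs k s w - X s w)\<^sup>2)) \<in> borel_measurable (restrict_space borel {0..1} \<Otimes>\<^sub>M C)"
    by (simp add: case_prod_beta')
qed

lemma err_eq:
  assumes "w \<in> space \<gamma>"
  shows "err k w = enn2real (\<integral>\<^sup>+ s. ennreal ((Xs k s w - X s w)\<^sup>2) \<partial>unit_leb)"
  using X_section[OF assms] Xs_section(1)[of k w] by (intro integral_eq_nn_integral) auto

lemma err_measurable: "err k \<in> borel_measurable C"
proof -
  have "(\<lambda>w. enn2real (\<integral>\<^sup>+ s. ennreal ((Xs k s w - X s w)\<^sup>2) \<partial>unit_leb)) \<in> borel_measurable C"
    using joint_square_error by measurable
  then show ?thesis using err_eq by (subst measurable_cong) auto
qed

lemma err_vanishes: "vanishes_in_prob err"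
  unfolding vanishes_in_prob_def
proof (intro conjI allI impI err_measurable)
  fix e :: real assume e: "e > 0"
  let ?S = "\<lambda>k. {w \<in> space \<gamma>. (\<integral>\<^sup>+ s. ennreal ((Xs k s w - X s w)\<^sup>2) \<partial>unit_leb) > ennreal e}"
  show "(\<lambda>k. tail_prob (err k) e) \<longlonglongrightarrow> 0"
  proof (rule tendsto_zero_mono[OF X_limit[OF e]])
    show "tail_prob (err k) e \<le> prob (?S k)" for k
    proof (rule finite_measure_mono)
      have "{w \<in> space C. (\<integral>\<^sup>+ s. ennreal ((Xs k s w - X s w)\<^sup>2) \<partial>unit_leb) > ennreal e} \<in> sets C"
        using joint_square_error[of k] by measurable
      then show "?S k \<in> sets C"
        by simp
      \<comment> \<open>Where the integral is infinite the real-valued \<open>err\<close> defaults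
        to 0, so passing to \<open>err\<close> can only shrink the tail event.\<close>
      have "ennreal e < v" if "enn2real v > e" for v
        using that e by (cases v) (auto simp: ennreal_less_iff)
      then show "{w \<in> space C. \<bar>err k w\<bar> > e} \<subseteq> ?S k"
        using err_eq by auto
    qed
  qed simp
qed

lemma M_measurable: "s \<in> {0..1} \<Longrightarrow> M s \<in> borel_measurable C"
  using M_adapted F_measurable_C[of s "M s" borel] unfolding adapted_process_def by auto

lemma Is_measurable:
  assumes "s \<in> {0..1}"
  shows "Is k s \<in> borel_measurable C"
proof -
  have tg: "time_grid (n k) (t k)" and \<xi>: "\<And>i. i < n k \<Longrightarrow> \<xi> k i \<in> borel_measurable (F (t k i))"
    using simple[of k] by (auto simp: simple_integrand_def)
  have \<xi>C: "\<xi> k i \<in> borel_measurable C" if "i < n k" for i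
    using F_measurable_C[OF _ \<xi>[OF that]] time_grid_range[OF tg, of i] that by simp
  have r: "min s (t k i) \<in> {0..1}" if "i \<le> n k" for i
    using time_grid_range[OF tg that] assms by auto
  show ?thesis
    unfolding step_integral_def[abs_def]
    by (intro borel_measurable_sum borel_measurable_times borel_measurable_diff \<xi>C path_measurable r) auto
qed

lemma Is_continuous:
  assumes "w \<in> space \<gamma>"
  shows "continuous_on {0..1} (\<lambda>s. Is k s w)"
proof -
  have tg: "time_grid (n k) (t k)" using simple[of k] by (auto simp: simple_integrand_def)
  have "continuous_on {0..1} (\<lambda>s. w (min s (t k i)))" if "i \<le> n k" for i
    using time_grid_range[OF tg that]
    by (intro continuous_on_compose2[OF path_continuous[OF assms]] continuous_intros) auto
  then show ?thesis unfolding step_integral_def by (intro continuous_intros) auto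
qed

lemma M_vanishes:
  assumes s: "s \<in> {0..1}"
  shows "vanishes_in_prob (\<lambda>k w. Is k s w - M s w)"
  unfolding vanishes_in_prob_def
proof (intro conjI allI impI)
  show m: "(\<lambda>w. Is k s w - M s w) \<in> borel_measurable C" for k
    using Is_measurable[OF s] M_measurable[OF s] by simp
  fix e :: real assume e: "e > 0"
  show "(\<lambda>k. tail_prob (\<lambda>w. Is k s w - M s w) e) \<longlonglongrightarrow> 0"
  proof (rule tendsto_zero_mono[OF M_limit[OF e]])
    show "tail_prob (\<lambda>w. Is k s w - M s w) e \<le>
        prob {w \<in> space \<gamma>. \<exists>s\<in>{0..1}. \<bar>Is k s w - M s w\<bar> > e}" for k
    proof (rule finite_measure_mono)
      let ?B = "{w \<in> space \<gamma>. \<exists>s\<in>{0..1}. \<bar>Is k s w - M s w\<bar> > e}"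
      \<comment> \<open>The event \<open>?B\<close> ranges over uncountably many times. By
        continuity it agrees almost surely with the countable union \<open>?A\<close>, and
        completeness makes it measurable, which monotonicity of the measure requires.\<close>
      let ?A = "\<Union>q\<in>\<rat> \<inter> {0..1}. {w \<in> space C. \<bar>Is k q w - M q w\<bar> > e}"
      have "countable (\<rat> \<inter> {0..1::real})" using countable_rat by (rule countable_Int1)
      then have A: "?A \<in> sets C"
      proof (rule sets.countable_UN'')
        fix q :: real assume "q \<in> \<rat> \<inter> {0..1}"
        then show "{w \<in> space C. \<bar>Is k q w - M q w\<bar> > e} \<in> sets C"
          by (intro abs_gt_sets borel_measurable_diff Is_measurable M_measurable) auto
      qed
      have "AE w in C. continuous_on {0..1} (\<lambda>s. M s w)"
        using M_continuous AE_completion unfolding continuous_process_def by blast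
      then have AE: "AE w in C. w \<in> ?A \<longleftrightarrow> w \<in> ?B"
      proof (rule AE_mp, intro AE_I2 impI)
        fix w assume w: "w \<in> space C" and c: "continuous_on {0..1} (\<lambda>s. M s w)"
        have "continuous_on {0..1} (\<lambda>s. Is k s w - M s w)"
          using Is_continuous[of w k] c w by (intro continuous_on_diff) auto
        from continuous_rational_witness[OF this] w show "w \<in> ?A \<longleftrightarrow> w \<in> ?B" by auto
      qed
      show "?B \<in> sets C" by (rule completion.in_sets_AE[OF AE A]) auto
      show "{w \<in> space C. \<bar>Is k s w - M s w\<bar> > e} \<subseteq> ?B" using s by auto
    qed
  qed simp
qed

lemma M_zero: "AE w in C. M 0 w = 0"
proof -
  have "Is k 0 w = 0" for k w
  proof -
    have tg: "time_grid (n k) (t k)" using simple[of k] by (auto simp: simple_integrand_def)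
    have "min 0 (t k i) = 0" if "i \<le> n k" for i using time_grid_range[OF tg that] by simp
    then show ?thesis unfolding step_integral_def by (intro sum.neutral) auto
  qed
  then have "vanishes_in_prob (\<lambda>_ w. - M 0 w)" using M_vanishes[of 0] by simp
  from vanishes_in_prob_const[OF this] show ?thesis by simp
qed

text \<open>The partition is fixed while \<open>m\<close> grows, so only finitely many times are
  involved and convergence at each of them suffices.\<close>

lemma partition_error_vanishes:
  assumes p: "\<And>l. l \<le> N \<Longrightarrow> p l \<in> {0..1}"
  shows "vanishes_in_prob (\<lambda>m w. \<Sum>l<N. ((M (p (Suc l)) w - Is m (p (Suc l)) w) - (M (p l) w - Is m (p l) w))\<^sup>2)"
proof (rule vanishes_in_prob_sum, rule vanishes_in_prob_square)
  fix l assume l: "l \<in> {..<N}"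
  have "vanishes_in_prob (\<lambda>m w. (- 1) * (Is m (p (Suc l)) w - M (p (Suc l)) w) + (Is m (p l) w - M (p l) w))"
    using l p by (intro vanishes_in_prob_add vanishes_in_prob_cmult M_vanishes) auto
  then show "vanishes_in_prob (\<lambda>m w. (M (p (Suc l)) w - Is m (p (Suc l)) w) - (M (p l) w - Is m (p l) w))"
    by (simp add: diff_diff_eq2 add_diff_eq)
qed

end

lemma (in wiener_space) simple_pair_energy_measurable:
  assumes "simple_pair Y J"
  shows "(\<lambda>w. energy Y w) \<in> borel_measurable C"
proof -
  obtain N s where g: "grid N s" and s: "simple_on (s ` {..N}) Y J"
    using simple_pair_grid[OF assms] .
  show ?thesis
    unfolding simple_on_square_integral[OF s g order_refl]
    by (intro borel_measurable_sum borel_measurable_times borel_measurable_power simple_on_measurable_X[OF s g order_refl]) auto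
qed

context ito_approximation
begin

lemma energy_diff_le:
  assumes w: "w \<in> space \<gamma>" "integrable unit_leb (\<lambda>s. (X s w)\<^sup>2)"
  shows "(\<integral>s. (Xs m s w - Xs k s w)\<^sup>2 \<partial>unit_leb) \<le> 2 * err m w + 2 * err k w"
proof -
  note i = integrable_diff_square[OF Xs_section(1) X_section[OF w(1)] Xs_section(2) w(2)]
  have i2: "integrable unit_leb (\<lambda>s. (Xs m s w - Xs k s w)\<^sup>2)"
    by (intro integrable_diff_square Xs_section)
  have "(Xs m s w - Xs k s w)\<^sup>2 \<le> 2 * (Xs m s w - X s w)\<^sup>2 + 2 * (Xs k s w - X s w)\<^sup>2" for s
    using square_diff_le[of "Xs m s w" "Xs k s w" "X s w"] by (simp add: power2_commute)
  then have "(\<integral>s. (Xs m s w - Xs k s w)\<^sup>2 \<partial>unit_leb) \<le> (\<integral>s. 2 * (Xs m s w - X s w)\<^sup>2 + 2 * (Xs k s w - X s w)\<^sup>2 \<partial>unit_leb)"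
    using i[of m] i[of k] i2 by (intro integral_mono) auto
  also have "\<dots> = 2 * err m w + 2 * err k w" using i[of m] i[of k] by simp
  finally show ?thesis .
qed

text \<open>The partitions may vary with \<open>k\<close> in any way:
  \<open>simple_square_sum_bound\<close> estimates the sum by the energy of
  \<open>Xs (m k) - Xs k\<close>, which vanishes in probability since both processes approach
  \<open>X\<close>.\<close>

lemma simple_increments_vanish:
  assumes m: "filterlim m at_top sequentially" and g: "\<And>k. grid (N k) (p k)"
  shows "vanishes_in_prob (\<lambda>k w. \<Sum>l<N k. ((Is (m k) (p k (Suc l)) w - Is (m k) (p k l) w) - (Is k (p k (Suc l)) w - Is k (p k l) w))\<^sup>2)"
    (is "vanishes_in_prob ?T")
  unfolding vanishes_in_prob_def
proof (intro conjI allI impI)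
  have pr: "p k l \<in> {0..1}" if "l \<le> N k" for k l using grid_range[OF g that] by simp
  show Tm: "?T k \<in> borel_measurable C" for k
    by (intro borel_measurable_sum borel_measurable_power borel_measurable_diff Is_measurable pr) auto
  define Y where "Y k = (\<lambda>x w. 1 * Xs (m k) x w + (- 1) * Xs k x w)" for k
  define J where "J k = (\<lambda>x w. 1 * Is (m k) x w + (- 1) * Is k x w)" for k
  have YJ: "simple_pair (Y k) (J k)" for k
    unfolding Y_def J_def by (intro simple_pair_lincomb Xs_simple)
  define D where "D k w = energy (Y k) w" for k w
  have "vanishes_in_prob (\<lambda>k w. 2 * err (m k) w + 2 * err k w)"
    by (intro vanishes_in_prob_add vanishes_in_prob_cmult err_vanishes vanishes_in_prob_subseq[OF err_vanishes m])
  then have D: "vanishes_in_prob D"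
  proof (rule vanishes_in_prob_mono)
    show "D k \<in> borel_measurable C" for k
      unfolding D_def by (rule simple_pair_energy_measurable[OF YJ])
    show "AE w in C. \<bar>D k w\<bar> \<le> \<bar>2 * err (m k) w + 2 * err k w\<bar>" for k
      using X_square_integrable AE_space[of C]
    proof eventually_elim
      case (elim w)
      have "D k w = (\<integral>s. (Xs (m k) s w - Xs k s w)\<^sup>2 \<partial>unit_leb)" by (simp add: D_def Y_def)
      also have "\<dots> \<le> 2 * err (m k) w + 2 * err k w" using energy_diff_le[of w "m k" k] elim by simp
      finally have "D k w \<le> 2 * err (m k) w + 2 * err k w" .
      moreover have "0 \<le> D k w" unfolding D_def by simp
      ultimately show ?case by linarith
    qed
  qed
  have T: "?T k w = (\<Sum>l<N k. (J k (p k (Suc l)) w - J k (p k l) w)\<^sup>2)" for k w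
    by (intro sum.cong refl arg_cong[where f="\<lambda>x. x\<^sup>2"]) (simp add: J_def)
  fix e :: real assume e: "e > 0"
  have bound: "tail_prob (?T k) e \<le> tail_prob (D k) \<delta> + \<delta> / e" if "\<delta> > 0" for k \<delta>
  proof -
    have "\<bar>?T k w\<bar> = (\<Sum>l<N k. (J k (p k (Suc l)) w - J k (p k l) w)\<^sup>2)" for w
      unfolding T by (simp add: sum_nonneg)
    moreover have "\<bar>D k w\<bar> = energy (Y k) w" for w unfolding D_def by simp
    ultimately show ?thesis
      using simple_square_sum_bound[OF YJ g e that, of k k] by simp
  qed
  show "(\<lambda>k. tail_prob (?T k) e) \<longlonglongrightarrow> 0"
  proof (rule LIMSEQ_I)
    fix d :: real assume d: "d > 0"
    \<comment> \<open>Chosen so that the term \<open>\<delta> / e\<close> of the bound costs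
      \<open>d / 2\<close>.\<close>
    define \<delta> where "\<delta> = e * d / 2"
    have \<delta>: "\<delta> > 0" "\<delta> / e = d / 2" using e d by (simp_all add: \<delta>_def)
    have "eventually (\<lambda>k. tail_prob (D k) \<delta> < d / 2) sequentially"
      using order_tendstoD(2)[OF vanishes_in_probD(2)[OF D \<delta>(1)], of "d / 2"] d by simp
    then have "eventually (\<lambda>k. norm (tail_prob (?T k) e - 0) < d) sequentially"
    proof eventually_elim
      case (elim k)
      have "norm (tail_prob (?T k) e - 0) = tail_prob (?T k) e"
        by (simp only: real_norm_def diff_0_right abs_of_nonneg measure_nonneg)
      then show ?case using bound[OF \<delta>(1), of k] elim \<delta>(2) by linarith
    qed
    then show "\<exists>no. \<forall>k\<ge>no. norm (tail_prob (?T k) e - 0) < d"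
      unfolding eventually_sequentially .
  qed
qed

lemma energy_converges:
  assumes w: "w \<in> space \<gamma>" "integrable unit_leb (\<lambda>s. (X s w)\<^sup>2)" and r: "(\<lambda>k. err (r k) w) \<longlonglongrightarrow> 0"
  shows "(\<lambda>k. energy (Xs (r k)) w) \<longlonglongrightarrow> energy X w"
  unfolding power2_eq_square
  by (rule tendsto_integral_mult_L2[OF Xs_section X_section[OF w(1)] w(2) Xs_section X_section[OF w(1)] w(2) r r])

text \<open>On a common sequence of partitions, \<open>Q\<close> ties the squared increments of
  \<open>M\<close> to the bracket, and \<open>R\<close> ties those of the simple integral to its
  energy. The link between the two sums goes through a later simple integral: \<open>U\<close>
  compares \<open>M\<close> with it, and \<open>T\<close> compares it with the current one.\<close>

lemma bracket_eq_energy: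
  assumes qv: "quadratic_variation \<gamma> M A"
  shows "AE w in C. A 1 w = energy X w"
proof -
  let ?e = "\<lambda>k. inverse (real (Suc k))"
  define dM where "dM p l w = M (p (Suc l)) w - M (p l) w" for p and l :: nat and w
  define dI where "dI k p l w = Is k (p (Suc l)) w - Is k (p l) w" for k p and l :: nat and w
  define R where "R k N p w = (\<Sum>l<N. (dI k p l w)\<^sup>2) - energy (Xs k) w" for k N p w
  define Q where "Q N p w = (\<Sum>l<N. (dM p l w)\<^sup>2) - A 1 w" for N p w
  define U where "U m N p w = (\<Sum>l<N. (dM p l w - dI m p l w)\<^sup>2)" for m N p w
  have A1: "A 1 \<in> borel_measurable C"
    using qv F_measurable_C[of 1 "A 1" borel] by (simp add: quadratic_variation_def adapted_process_def)
  \<comment> \<open>The order of choice is: the mesh from the bracket, then the grid, then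
    \<open>m\<close>. Tying every tolerance to \<open>?e k\<close> makes the chosen quantities fall
    under \<open>vanishes_in_prob_rate\<close>, and \<open>k \<le> m\<close> forces \<open>m\<close>
    to infinity.\<close>
  define P where "P k N p m \<longleftrightarrow> grid N p \<and> R k N p \<in> borel_measurable C \<and> tail_prob (R k N p) (?e k) < ?e k \<and>
      tail_prob (Q N p) (?e k) < ?e k \<and> k \<le> m \<and> tail_prob (U m N p) (?e k) < ?e k" for k N p m
  have "\<exists>N p m. P k N p m" for k
  proof -
    have ek: "?e k > 0" by simp
    have tg: "time_grid (n k) (t k)" using simple[of k] by (auto simp: simple_integrand_def)
    have "(1::real) \<in> {0..1}" by simp
    then have "\<forall>\<epsilon>>0. \<exists>\<delta>>0. \<forall>(n::nat) s. s 0 = 0 \<and> s n = 1 \<and> (\<forall>i<n. s i \<le> s (Suc i) \<and> s (Suc i) - s i < \<delta>) \<longrightarrow>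
        measure C {w \<in> space \<gamma>. \<bar>(\<Sum>i<n. (M (s (Suc i)) w - M (s i) w)\<^sup>2) - A 1 w\<bar> > \<epsilon>} < \<epsilon>"
      using qv unfolding quadratic_variation_def by blast
    from this[THEN spec, THEN mp, OF ek]
    obtain \<delta> where \<delta>: "\<delta> > 0" and part: "\<forall>(n::nat) s. s 0 = 0 \<and> s n = 1 \<and> (\<forall>i<n. s i \<le> s (Suc i) \<and> s (Suc i) - s i < \<delta>) \<longrightarrow>
        measure C {w \<in> space \<gamma>. \<bar>(\<Sum>i<n. (M (s (Suc i)) w - M (s i) w)\<^sup>2) - A 1 w\<bar> > ?e k} < ?e k"
      by (elim exE conjE) (rule that)
    have S: "finite (t k ` {..n k})" "t k ` {..n k} \<subseteq> {0..1}" using time_grid_range[OF tg] by auto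
    obtain N p where g: "grid N p" "\<And>i. i < N \<Longrightarrow> p (Suc i) - p i < \<delta>"
      and R': "(\<lambda>w. (\<Sum>l<N. (Is k (p (Suc l)) w - Is k (p l) w)\<^sup>2) - energy (Xs k) w) \<in> borel_measurable C"
        "tail_prob (\<lambda>w. (\<Sum>l<N. (Is k (p (Suc l)) w - Is k (p l) w)\<^sup>2) - energy (Xs k) w) (?e k) < ?e k"
      by (rule simple_quadratic_variation[OF simple_integrand_simple_on[OF simple[of k]] S \<delta> ek]) (rule that, assumption+)
    have R: "R k N p \<in> borel_measurable C" "tail_prob (R k N p) (?e k) < ?e k"
      using R' unfolding R_def[abs_def] dI_def by blast+
    have "p 0 = 0 \<and> p N = 1 \<and> (\<forall>i<N. p i \<le> p (Suc i) \<and> p (Suc i) - p i < \<delta>)"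
      using g by (auto simp: grid_def intro: less_imp_le)
    from mp[OF spec[OF spec[OF part, of N], of p] this]
    have Q: "tail_prob (Q N p) (?e k) < ?e k"
      unfolding Q_def dM_def space_completion .
    have "vanishes_in_prob (\<lambda>m w. U m N p w)"
    proof -
      have "dM p l w - dI m p l w = (M (p (Suc l)) w - Is m (p (Suc l)) w) - (M (p l) w - Is m (p l) w)" for l m w
        by (simp add: dM_def dI_def)
      then show ?thesis
        using partition_error_vanishes[of N p] grid_range[OF g(1)] by (simp add: U_def)
    qed
    from order_tendstoD(2)[OF vanishes_in_probD(2)[OF this ek] ek]
    have "eventually (\<lambda>m. tail_prob (U m N p) (?e k) < ?e k \<and> k \<le> m) sequentially"
      using eventually_ge_at_top[of k] by (rule eventually_conj)
    from eventually_happens'[OF sequentially_bot this]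
    obtain m where "tail_prob (U m N p) (?e k) < ?e k" "k \<le> m"
      by (elim exE conjE) (rule that)
    then show ?thesis using g(1) R Q unfolding P_def by blast
  qed
  then obtain N p m where "\<And>k. P k (N k) (p k) (m k)" by metis
  then have g: "\<And>k. grid (N k) (p k)" 
    and R: "\<And>k. R k (N k) (p k) \<in> borel_measurable C" "\<And>k. tail_prob (R k (N k) (p k)) (?e k) < ?e k"
    and Q: "\<And>k. tail_prob (Q (N k) (p k)) (?e k) < ?e k"
    and m: "\<And>k. k \<le> m k" and U: "\<And>k. tail_prob (U (m k) (N k) (p k)) (?e k) < ?e k"
    unfolding P_def by blast+
  have pr: "p k l \<in> {0..1}" if "l \<le> N k" for k l using grid_range[OF g that] by simp
  have Mm: "(\<lambda>w. dM (p k) l w) \<in> borel_measurable C" if "l < N k" for k l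
    unfolding dM_def using that by (intro borel_measurable_diff M_measurable pr) auto
  have Im: "(\<lambda>w. dI j (p k) l w) \<in> borel_measurable C" if "l < N k" for j k l
    unfolding dI_def using that by (intro borel_measurable_diff Is_measurable pr) auto
  define R' where "R' k = R k (N k) (p k)" for k
  define Q' where "Q' k = Q (N k) (p k)" for k
  \<comment> \<open>The comparison wanted, with simple integral number \<open>k\<close> on partition
    number \<open>k\<close>. The choice of \<open>m\<close> controls only \<open>Um\<close>, and
    \<open>T\<close> bridges the gap.\<close>
  define U' where "U' k = U k (N k) (p k)" for k
  define Um where "Um k = U (m k) (N k) (p k)" for k
  define T where "T k w = (\<Sum>l<N k. (dI (m k) (p k) l w - dI k (p k) l w)\<^sup>2)" for k w
  have Rv: "vanishes_in_prob R'" unfolding R'_def by (rule vanishes_in_prob_rate[OF R])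
  have Qv: "vanishes_in_prob Q'"
    unfolding Q'_def
  proof (rule vanishes_in_prob_rate[OF _ Q])
    show "Q (N k) (p k) \<in> borel_measurable C" for k
      unfolding Q_def by (intro borel_measurable_diff borel_measurable_sum borel_measurable_power Mm A1) auto
  qed
  have U_meas: "U j (N k) (p k) \<in> borel_measurable C" for j k
    unfolding U_def by (intro borel_measurable_sum borel_measurable_power borel_measurable_diff Mm Im) auto
  have Uv: "vanishes_in_prob Um" unfolding Um_def by (rule vanishes_in_prob_rate[OF U_meas U])
  have mlim: "filterlim m at_top sequentially"
    by (rule filterlim_at_top_mono[OF filterlim_ident]) (simp add: m)
  have Tv: "vanishes_in_prob T"
    unfolding T_def[abs_def] dI_def by (rule simple_increments_vanish[OF mlim g])
  have Vv: "vanishes_in_prob U'"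
  proof (rule vanishes_in_prob_mono)
    show "vanishes_in_prob (\<lambda>k w. 2 * Um k w + 2 * T k w)"
      by (intro vanishes_in_prob_add vanishes_in_prob_cmult Uv Tv)
    have "\<bar>U' k w\<bar> \<le> \<bar>2 * Um k w + 2 * T k w\<bar>" for k w
    proof -
      have "U' k w \<le> (\<Sum>l<N k. 2 * (dM (p k) l w - dI (m k) (p k) l w)\<^sup>2 + 2 * (dI (m k) (p k) l w - dI k (p k) l w)\<^sup>2)"
        unfolding U'_def U_def by (intro sum_mono square_diff_le)
      also have "\<dots> = 2 * Um k w + 2 * T k w"
        by (simp add: Um_def T_def U_def sum.distrib sum_distrib_left)
      finally have 1: "U' k w \<le> 2 * Um k w + 2 * T k w" .
      have "0 \<le> U' k w" unfolding U'_def U_def by (simp add: sum_nonneg)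
      then show ?thesis using 1 by linarith
    qed
    then show "AE w in C. \<bar>U' k w\<bar> \<le> \<bar>2 * Um k w + 2 * T k w\<bar>" for k
      by simp
  qed (simp only: U'_def U_meas)
  obtain r :: "nat \<Rightarrow> nat" where "AE w in C. (\<lambda>k. R' (r k) w) \<longlonglongrightarrow> 0 \<and> (\<lambda>k. Q' (r k) w) \<longlonglongrightarrow> 0 \<and>
      (\<lambda>k. U' (r k) w) \<longlonglongrightarrow> 0 \<and> (\<lambda>k. err (r k) w) \<longlonglongrightarrow> 0"
    by (rule vanishes_in_prob_AE_subseq4[OF Rv Qv Vv err_vanishes])
  then show ?thesis
    using X_square_integrable AE_space[of C]
  proof eventually_elim
    case (elim w)
    then have R0: "(\<lambda>k. R' (r k) w) \<longlonglongrightarrow> 0" and Q0: "(\<lambda>k. Q' (r k) w) \<longlonglongrightarrow> 0"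
      and U0: "(\<lambda>k. U' (r k) w) \<longlonglongrightarrow> 0" and E0: "(\<lambda>k. err (r k) w) \<longlonglongrightarrow> 0"
      by simp_all
    let ?E = "energy X w"
    have "(\<lambda>k. R' (r k) w + energy (Xs (r k)) w) \<longlonglongrightarrow> 0 + ?E"
      using elim by (intro tendsto_add R0 energy_converges E0) auto
    then have "(\<lambda>k. \<Sum>l<N (r k). (dI (r k) (p (r k)) l w)\<^sup>2) \<longlonglongrightarrow> ?E" by (simp add: R'_def R_def)
    \<comment> \<open>Taking roots turns the sums into Euclidean norms, whose difference is at most
      the norm of \<open>dM - dI\<close>; squaring then returns to the sums.\<close>
    then have LI: "(\<lambda>k. L2_set (\<lambda>l. dI (r k) (p (r k)) l w) {..<N (r k)}) \<longlonglongrightarrow> sqrt ?E"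
      unfolding L2_set_def by (rule tendsto_real_sqrt)
    have "(\<lambda>k. L2_set (\<lambda>l. dM (p (r k)) l w - dI (r k) (p (r k)) l w) {..<N (r k)}) \<longlonglongrightarrow> sqrt 0"
      using U0 unfolding L2_set_def U'_def U_def by (rule tendsto_real_sqrt)
    then have D0: "(\<lambda>k. L2_set (\<lambda>l. dM (p (r k)) l w - dI (r k) (p (r k)) l w) {..<N (r k)}) \<longlonglongrightarrow> 0" by simp
    have "(\<lambda>k. L2_set (\<lambda>l. dM (p (r k)) l w) {..<N (r k)} - L2_set (\<lambda>l. dI (r k) (p (r k)) l w) {..<N (r k)}) \<longlonglongrightarrow> 0"
      by (rule Lim_null_comparison[OF _ D0]) (simp add: L2_set_diff_bound)
    from tendsto_add[OF this LI] have "(\<lambda>k. L2_set (\<lambda>l. dM (p (r k)) l w) {..<N (r k)}) \<longlonglongrightarrow> sqrt ?E" by simp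
    from tendsto_power[OF this, of 2] have 1: "(\<lambda>k. \<Sum>l<N (r k). (dM (p (r k)) l w)\<^sup>2) \<longlonglongrightarrow> ?E"
      by (simp add: L2_set_def sum_nonneg)
    have "(\<lambda>k. Q' (r k) w + A 1 w) \<longlonglongrightarrow> 0 + A 1 w" by (intro tendsto_add Q0 tendsto_const)
    then have 2: "(\<lambda>k. \<Sum>l<N (r k). (dM (p (r k)) l w)\<^sup>2) \<longlonglongrightarrow> A 1 w" by (simp add: Q'_def Q_def)
    show ?case by (rule LIMSEQ_unique[OF 2 1])
  qed
qed

end

section \<open>Characteristic functions of Wiener integrals\<close>

context wiener_space
begin

text \<open>Indexed by the integrand instead of a path, so that linear combinations avoid
  derivatives of sums of paths that are differentiable only almost everywhere. Convergence in
  probability is enough to pass to the limit in characteristic functions.\<close>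

definition wiener_int :: "(real \<Rightarrow> real) \<Rightarrow> (path \<Rightarrow> real) \<Rightarrow> bool" where
  "wiener_int g J \<longleftrightarrow> J \<in> borel_measurable C \<and> g \<in> borel_measurable unit_leb \<and>
     integrable unit_leb (\<lambda>x. (g x)\<^sup>2) \<and>
     (\<exists>c K. (\<forall>k. simple_pair (\<lambda>x _. c k x) (K k)) \<and>
        (\<lambda>k::nat. sq_dist (c k) g) \<longlonglongrightarrow> 0 \<and>
        vanishes_in_prob (\<lambda>k w. K k 1 w - J w))"

lemma simple_pair_end_measurable:
  assumes "simple_pair X I"
  shows "I 1 \<in> borel_measurable C"
proof -
  obtain N s where g: "grid N s" and s: "simple_on (s ` {..N}) X I"
    using simple_pair_grid[OF assms] .
  show ?thesis using simple_on_measurable_I[OF s g order_refl, of N] g by (simp add: grid_def)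
qed

lemma simple_pair_cross_measurable:
  assumes X: "simple_pair X I" and c: "simple_pair (\<lambda>x _. c x) K"
  shows "(\<lambda>w. \<integral>x. c x * X x w \<partial>unit_leb) \<in> borel_measurable C"
proof -
  obtain N s where g: "grid N s" and s: "simple_on (s ` {..N}) X I" "simple_on (s ` {..N}) (\<lambda>x _. c x) K"
    using simple_pair_grid2[OF X c] .
  show ?thesis
    unfolding simple_on_cross_integral[OF s g order_refl]
    by (intro borel_measurable_sum borel_measurable_times simple_on_measurable_X[OF s(1) g order_refl] borel_measurable_const) auto
qed

text \<open>Chebyshev, carried out in \<open>ennreal\<close> because the second moments are not
  assumed finite for every \<open>k\<close>.\<close>

lemma vanishes_in_prob_L2:
  assumes Y: "\<And>k. Y k \<in> borel_measurable C"
    and L2: "(\<lambda>k. \<integral>\<^sup>+ w. ennreal ((Y k w)\<^sup>2) \<partial>C) \<longlonglongrightarrow> 0"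
  shows "vanishes_in_prob Y"
  unfolding vanishes_in_prob_def
proof (intro conjI allI impI Y)
  fix e :: real assume e: "e > 0"
  have bound: "ennreal (tail_prob (Y k) e) \<le> ennreal (1 / e\<^sup>2) * (\<integral>\<^sup>+ w. ennreal ((Y k w)\<^sup>2) \<partial>C)" for k
  proof -
    let ?A = "{w \<in> space C. \<bar>Y k w\<bar> > e}"
    have A: "?A \<in> sets C" by (rule abs_gt_sets[OF Y])
    have "ennreal (prob ?A) = (\<integral>\<^sup>+ w. indicator ?A w \<partial>C)"
      unfolding nn_integral_indicator[OF A] by (rule emeasure_eq_measure[symmetric])
    also have "\<dots> \<le> (\<integral>\<^sup>+ w. ennreal (1 / e\<^sup>2) * ennreal ((Y k w)\<^sup>2) \<partial>C)"
    proof (rule nn_integral_mono)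
      fix w
      show "indicator ?A w \<le> ennreal (1 / e\<^sup>2) * ennreal ((Y k w)\<^sup>2)"
      proof (cases "w \<in> ?A")
        case True
        then have "e\<^sup>2 \<le> (Y k w)\<^sup>2" using e abs_le_square_iff[of e "Y k w"] by simp
        then have "1 \<le> (1 / e\<^sup>2) * (Y k w)\<^sup>2" using e by (simp add: field_simps)
        then have "ennreal 1 \<le> ennreal (1 / e\<^sup>2) * ennreal ((Y k w)\<^sup>2)"
          by (subst ennreal_mult[symmetric]) (simp_all only: ennreal_leI zero_le_power2 zero_le_divide_1_iff)
        then show ?thesis unfolding indicator_def using True by (simp only: ennreal_1 mem_Collect_eq simp_thms of_bool_eq)
      qed simp
    qed
    also have "\<dots> = ennreal (1 / e\<^sup>2) * (\<integral>\<^sup>+ w. ennreal ((Y k w)\<^sup>2) \<partial>C)"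
    proof (rule nn_integral_cmult)
      show "(\<lambda>w. ennreal ((Y k w)\<^sup>2)) \<in> borel_measurable C" using Y[of k] by measurable
    qed
    finally show ?thesis .
  qed
  have "(\<lambda>k. ennreal (1 / e\<^sup>2) * (\<integral>\<^sup>+ w. ennreal ((Y k w)\<^sup>2) \<partial>C)) \<longlonglongrightarrow> ennreal (1 / e\<^sup>2) * 0"
    by (intro ennreal_tendsto_cmult L2) simp
  then have lim: "(\<lambda>k. ennreal (1 / e\<^sup>2) * (\<integral>\<^sup>+ w. ennreal ((Y k w)\<^sup>2) \<partial>C)) \<longlonglongrightarrow> 0" by simp
  have "(\<lambda>k. ennreal (tail_prob (Y k) e)) \<longlonglongrightarrow> 0"
    by (rule tendsto_sandwich[OF _ _ tendsto_const lim]) (use bound in auto)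
  then show "(\<lambda>k. tail_prob (Y k) e) \<longlonglongrightarrow> 0"
    by (subst (asm) ennreal_tendsto_0_iff) (rule measure_nonneg)
qed

text \<open>Deterministic coefficients are measurable with respect to any past, so deterministic
  step functions are simple integrands.\<close>

lemma wiener_integral_wiener_int:
  assumes h: "h \<in> cameron_martin" and J: "wiener_integral \<gamma> h J"
  shows "wiener_int (deriv h) J"
proof -
  have sq: "deriv h \<in> borel_measurable unit_leb" "integrable unit_leb (\<lambda>x. (deriv h x)\<^sup>2)"
    using h by (auto simp: cameron_martin_def square_integrable_def)
  have Jm: "J \<in> borel_measurable C" using J by (simp add: wiener_integral_def)
  obtain n t c where tg: "\<And>k::nat. time_grid (n k) (t k)"
    and c: "(\<lambda>k. \<integral>\<^sup>+ s. ennreal (((\<Sum>i<n k. c k i * indicator {t k i<..t k (Suc i)} s) - deriv h s)\<^sup>2) \<partial>unit_leb) \<longlonglongrightarrow> 0"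
    and K: "(\<lambda>k. \<integral>\<^sup>+ w. ennreal (((\<Sum>i<n k. c k i * (w (t k (Suc i)) - w (t k i))) - J w)\<^sup>2) \<partial>C) \<longlonglongrightarrow> 0"
    using J unfolding wiener_integral_def by blast
  define f where "f k s = (\<Sum>i<n k. c k i * indicator {t k i<..t k (Suc i)} s)" for k and s :: real
  define I where "I k = step_integral (n k) (t k) (\<lambda>i _. c k i)" for k
  have "simple_integrand \<gamma> (n k) (t k) (\<lambda>i _. c k i)" for k
    using tg by (auto simp: simple_integrand_def)
  from simple_integrand_simple_pair[OF this]
  have sp: "simple_pair (\<lambda>x _. f k x) (I k)" for k
    unfolding f_def I_def step_process_def[abs_def] .
  have I1: "I k 1 w = (\<Sum>i<n k. c k i * (w (t k (Suc i)) - w (t k i)))" for k w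
    unfolding I_def step_integral_def
  proof (intro sum.cong refl)
    have m: "min 1 (t k i) = t k i" if "i \<le> n k" for i using time_grid_range[OF tg that] by simp
    fix i assume "i \<in> {..<n k}"
    then show "c k i * (w (min 1 (t k (Suc i))) - w (min 1 (t k i))) = c k i * (w (t k (Suc i)) - w (t k i))"
      using m[of i] m[of "Suc i"] by simp
  qed
  have "(\<lambda>k. enn2real (\<integral>\<^sup>+ s. ennreal ((f k s - deriv h s)\<^sup>2) \<partial>unit_leb)) \<longlonglongrightarrow> 0"
    using c unfolding f_def by (intro tendsto_enn2real) auto
  moreover have "sq_dist (f k) (deriv h) = enn2real (\<integral>\<^sup>+ s. ennreal ((f k s - deriv h s)\<^sup>2) \<partial>unit_leb)" for k
    using sq(1) simple_pair_section(1)[OF sp[of k]] by (intro integral_eq_nn_integral) auto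
  ultimately have L: "(\<lambda>k. sq_dist (f k) (deriv h)) \<longlonglongrightarrow> 0" by simp
  have V: "vanishes_in_prob (\<lambda>k w. I k 1 w - J w)"
  proof (rule vanishes_in_prob_L2)
    show "(\<lambda>w. I k 1 w - J w) \<in> borel_measurable C" for k
      using simple_pair_end_measurable[OF sp] Jm by (rule borel_measurable_diff)
    show "(\<lambda>k. \<integral>\<^sup>+ w. ennreal ((I k 1 w - J w)\<^sup>2) \<partial>C) \<longlonglongrightarrow> 0"
      using K unfolding I1 .
  qed
  show ?thesis
    unfolding wiener_int_def by (intro conjI Jm sq exI[of _ f] exI[of _ I] allI sp L V)
qed

lemma wiener_int_lincomb:
  assumes 1: "wiener_int g J" and 2: "wiener_int g' J'"
  shows "wiener_int (\<lambda>x. a * g x + b * g' x) (\<lambda>w. a * J w + b * J' w)"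
proof -
  obtain c K where 1: "J \<in> borel_measurable C" "g \<in> borel_measurable unit_leb" "integrable unit_leb (\<lambda>x. (g x)\<^sup>2)"
    "\<And>k. simple_pair (\<lambda>x _. c k x) (K k)" "(\<lambda>k::nat. sq_dist (c k) g) \<longlonglongrightarrow> 0"
    "vanishes_in_prob (\<lambda>k w. K k 1 w - J w)" using 1 unfolding wiener_int_def by blast
  obtain c' K' where 2: "J' \<in> borel_measurable C" "g' \<in> borel_measurable unit_leb" "integrable unit_leb (\<lambda>x. (g' x)\<^sup>2)"
    "\<And>k. simple_pair (\<lambda>x _. c' k x) (K' k)" "(\<lambda>k::nat. sq_dist (c' k) g') \<longlonglongrightarrow> 0"
    "vanishes_in_prob (\<lambda>k w. K' k 1 w - J' w)" using 2 unfolding wiener_int_def by blast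
  let ?g = "\<lambda>x. a * g x + b * g' x" and ?c = "\<lambda>k x. a * c k x + b * c' k x"
  have sp: "simple_pair (\<lambda>x _. ?c k x) (\<lambda>x w. a * K k x w + b * K' k x w)" for k
    using simple_pair_lincomb[OF 1(4) 2(4)] .
  have gm: "?g \<in> borel_measurable unit_leb" using 1(2) 2(2) by simp
  have sq: "integrable unit_leb (\<lambda>x. (?g x)\<^sup>2)"
    using integrable_diff_square[of "\<lambda>x. a * g x" unit_leb "\<lambda>x. - b * g' x"] 1(2,3) 2(2,3)
    by (simp add: power_mult_distrib)
  note s = simple_pair_section
  have d: "integrable unit_leb (\<lambda>x. (c k x - g x)\<^sup>2)" "integrable unit_leb (\<lambda>x. (c' k x - g' x)\<^sup>2)"
    "integrable unit_leb (\<lambda>x. (?c k x - ?g x)\<^sup>2)" for k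
    by (rule integrable_diff_square[OF s(1)[OF 1(4)] 1(2) s(2)[OF 1(4)] 1(3)]
        integrable_diff_square[OF s(1)[OF 2(4)] 2(2) s(2)[OF 2(4)] 2(3)]
        integrable_diff_square[OF s(1)[OF sp] gm s(2)[OF sp] sq])+
  have le: "sq_dist (?c k) ?g \<le> 2 * a\<^sup>2 * sq_dist (c k) g + 2 * b\<^sup>2 * sq_dist (c' k) g'" for k
  proof -
    have "(?c k x - ?g x)\<^sup>2 \<le> 2 * a\<^sup>2 * (c k x - g x)\<^sup>2 + 2 * b\<^sup>2 * (c' k x - g' x)\<^sup>2" for x
    proof -
      \<comment> \<open>Written as a difference so that \<open>square_diff_le\<close> with middle
        point 0 bounds the square of a sum.\<close>
      have "(?c k x - ?g x)\<^sup>2 = (a * (c k x - g x) - (- (b * (c' k x - g' x))))\<^sup>2" by (simp add: algebra_simps)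
      also have "\<dots> \<le> 2 * (a * (c k x - g x) - 0)\<^sup>2 + 2 * (0 - (- (b * (c' k x - g' x))))\<^sup>2" by (rule square_diff_le)
      finally show ?thesis by (simp add: power_mult_distrib mult.assoc)
    qed
    then have "sq_dist (?c k) ?g \<le> (\<integral>x. 2 * a\<^sup>2 * (c k x - g x)\<^sup>2 + 2 * b\<^sup>2 * (c' k x - g' x)\<^sup>2 \<partial>unit_leb)"
      using d[of k] by (intro integral_mono) auto
    then show ?thesis using d[of k] by simp
  qed
  have "(\<lambda>k. 2 * a\<^sup>2 * sq_dist (c k) g + 2 * b\<^sup>2 * sq_dist (c' k) g') \<longlonglongrightarrow> 2 * a\<^sup>2 * 0 + 2 * b\<^sup>2 * 0"
    by (intro tendsto_intros 1(5) 2(5))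
  then have lim: "(\<lambda>k. 2 * a\<^sup>2 * sq_dist (c k) g + 2 * b\<^sup>2 * sq_dist (c' k) g') \<longlonglongrightarrow> 0" by simp
  have L: "(\<lambda>k. sq_dist (?c k) ?g) \<longlonglongrightarrow> 0"
    by (rule tendsto_zero_mono[OF lim _ le]) simp
  have "vanishes_in_prob (\<lambda>k w. a * (K k 1 w - J w) + b * (K' k 1 w - J' w))"
    by (intro vanishes_in_prob_add vanishes_in_prob_cmult 1(6) 2(6))
  moreover have "(\<lambda>k w. a * (K k 1 w - J w) + b * (K' k 1 w - J' w)) = (\<lambda>k w. (a * K k 1 w + b * K' k 1 w) - (a * J w + b * J' w))"
    by (simp add: fun_eq_iff algebra_simps)
  ultimately have V: "vanishes_in_prob (\<lambda>k w. (a * K k 1 w + b * K' k 1 w) - (a * J w + b * J' w))" by (simp only:)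
  have Jm: "(\<lambda>w. a * J w + b * J' w) \<in> borel_measurable C" using 1(1) 2(1) by simp
  show ?thesis
    unfolding wiener_int_def
    by (intro conjI Jm gm sq exI[of _ ?c] exI[of _ "\<lambda>k x w. a * K k x w + b * K' k x w"] allI sp L V)
qed

lemma wiener_int_zero: "wiener_int (\<lambda>_. 0) (\<lambda>_. 0)"
  unfolding wiener_int_def
  by (intro conjI exI[of _ "\<lambda>_ _. 0"] exI[of _ "\<lambda>_ _ _. 0"] allI simple_pair_zero) (simp_all add: vanishes_in_prob_zero)

lemma wiener_int_scale:
  assumes "wiener_int g J"
  shows "wiener_int (\<lambda>x. a * g x) (\<lambda>w. a * J w)"
  using wiener_int_lincomb[OF assms wiener_int_zero, of a 0] by simp

lemma wiener_int_sum:
  assumes "\<And>i. i \<in> S \<Longrightarrow> wiener_int (g i) (J i)"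
  shows "wiener_int (\<lambda>x. \<Sum>i\<in>S. a i * g i x) (\<lambda>w. \<Sum>i\<in>S. a i * J i w)"
  using assms
proof (induction S rule: infinite_finite_induct)
  case (insert i S)
  then have "wiener_int (\<lambda>x. a i * g i x + 1 * (\<Sum>i\<in>S. a i * g i x)) (\<lambda>w. a i * J i w + 1 * (\<Sum>i\<in>S. a i * J i w))"
    by (intro wiener_int_lincomb) auto
  then show ?case using insert by simp
qed (simp_all add: wiener_int_zero)

lemma wiener_int_approx:
  assumes "wiener_int g J"
  obtains c K where "\<And>k. simple_pair (\<lambda>x _. c k x) (K k)"
    "(\<lambda>k::nat. sq_dist (c k) g) \<longlonglongrightarrow> 0" "vanishes_in_prob (\<lambda>k w. K k 1 w - J w)"
    "(\<lambda>k. complex_of_real (exp (- (sq_norm (c k) / 2)))) \<longlonglongrightarrow> of_real (exp (- (sq_norm g / 2)))"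
proof -
  obtain c K where g: "g \<in> borel_measurable unit_leb" "integrable unit_leb (\<lambda>x. (g x)\<^sup>2)"
    and c: "\<And>k. simple_pair (\<lambda>x _. c k x) (K k)" "(\<lambda>k::nat. sq_dist (c k) g) \<longlonglongrightarrow> 0"
    and V: "vanishes_in_prob (\<lambda>k w. K k 1 w - J w)" using assms unfolding wiener_int_def by blast
  note s = simple_pair_section[OF c(1)]
  have "(\<lambda>k. \<integral>x. c k x * c k x \<partial>unit_leb) \<longlonglongrightarrow> (\<integral>x. g x * g x \<partial>unit_leb)"
    by (rule tendsto_integral_mult_L2[OF s g s g c(2) c(2)])
  then have "(\<lambda>k. complex_of_real (exp (- (sq_norm (c k) / 2)))) \<longlonglongrightarrow> of_real (exp (- (sq_norm g / 2)))"
    unfolding power2_eq_square by (intro tendsto_intros) auto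
  then show thesis using that c V by blast
qed

lemma wiener_int_char:
  assumes J: "wiener_int g J"
  shows "(\<integral>w. iexp (J w) \<partial>C) = of_real (exp (- (sq_norm g / 2)))"
proof -
  have Jm: "J \<in> borel_measurable C" using J by (simp add: wiener_int_def)
  obtain c K where c: "\<And>k. simple_pair (\<lambda>x _. c k x) (K k)" "(\<lambda>k::nat. sq_dist (c k) g) \<longlonglongrightarrow> 0"
    and V: "vanishes_in_prob (\<lambda>k w. K k 1 w - J w)"
    and e: "(\<lambda>k. complex_of_real (exp (- (sq_norm (c k) / 2)))) \<longlonglongrightarrow> of_real (exp (- (sq_norm g / 2)))"
    by (rule wiener_int_approx[OF J]) (rule that, assumption+)
  obtain r where r: "strict_mono r" "AE w in C. (\<lambda>k. K (r k) 1 w - J w) \<longlonglongrightarrow> 0"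
    using vanishes_in_prob_AE_subseq[OF V] by blast
  have Km: "K k 1 \<in> borel_measurable C" for k by (rule simple_pair_end_measurable[OF c(1)])
  have 1: "(\<lambda>k. \<integral>w. iexp (K (r k) 1 w) \<partial>C) \<longlonglongrightarrow> (\<integral>w. iexp (J w) \<partial>C)"
  proof (rule integral_dominated_convergence[where w="\<lambda>_. 1"])
    show "(\<lambda>w. iexp (J w)) \<in> borel_measurable C" using Jm by measurable
    show "(\<lambda>w. iexp (K (r k) 1 w)) \<in> borel_measurable C" for k using Km[of "r k"] by measurable
    show "AE w in C. (\<lambda>k. iexp (K (r k) 1 w)) \<longlonglongrightarrow> iexp (J w)"
      using r(2)
    proof eventually_elim
      case (elim w)
      then have "(\<lambda>k. K (r k) 1 w) \<longlonglongrightarrow> J w" by (subst Lim_null)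
      then show ?case by (intro tendsto_intros)
    qed
  qed simp_all
  \<comment> \<open>The zero integrand has stochastic exponential 1, so the tilted formula becomes
    the plain characteristic function.\<close>
  have 2: "(\<integral>w. iexp (K k 1 w) \<partial>C) = of_real (exp (- (sq_norm (c k) / 2)))" for k
    using simple_pair_tilted_char(3)[OF simple_pair_zero c(1)[of k]] by simp
  have "(\<lambda>k. complex_of_real (exp (- (sq_norm (c (r k)) / 2)))) \<longlonglongrightarrow> of_real (exp (- (sq_norm g / 2)))"
    using LIMSEQ_subseq_LIMSEQ[OF e r(1)] by (simp add: comp_def)
  then show ?thesis using 1 unfolding 2 by (rule LIMSEQ_unique[rotated])
qed

end

section \<open>The law of the shifted Wiener integral under the density \<open>D\<close>\<close>

context ito_approximation
begin

lemma tilted_char_limit: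
  assumes J: "wiener_int g J" 
  defines "D \<equiv> \<lambda>w. exp (M 1 w - energy X w / 2)"
  assumes D: "integrable C D" "(\<integral>w. D w \<partial>C) = 1"
  shows "(\<lambda>w. J w - (\<integral>s. g s * X s w \<partial>unit_leb)) \<in> borel_measurable C"
    and "(\<integral>w. of_real (D w) * iexp (J w - (\<integral>s. g s * X s w \<partial>unit_leb)) \<partial>C) = of_real (exp (- (sq_norm g / 2)))"
proof -
  have Jm: "J \<in> borel_measurable C" and g: "g \<in> borel_measurable unit_leb" "integrable unit_leb (\<lambda>x. (g x)\<^sup>2)"
    using J by (simp_all add: wiener_int_def)
  obtain c K where c: "\<And>k. simple_pair (\<lambda>x _. c k x) (K k)" "(\<lambda>k::nat. sq_dist (c k) g) \<longlonglongrightarrow> 0"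
    and V: "vanishes_in_prob (\<lambda>k w. K k 1 w - J w)"
    and e: "(\<lambda>k. complex_of_real (exp (- (sq_norm (c k) / 2)))) \<longlonglongrightarrow> of_real (exp (- (sq_norm g / 2)))"
    by (rule wiener_int_approx[OF J]) (rule that, assumption+)
  have "(1::real) \<in> {0..1}" by simp
  then obtain r where r: "strict_mono r" "AE w in C. (\<lambda>k. K (r k) 1 w - J w) \<longlonglongrightarrow> 0 \<and>
      (\<lambda>k. Is (r k) 1 w - M 1 w) \<longlonglongrightarrow> 0 \<and> (\<lambda>k. err (r k) w) \<longlonglongrightarrow> 0 \<and> (\<lambda>k. err (r k) w) \<longlonglongrightarrow> 0"
    by (rule vanishes_in_prob_AE_subseq4[OF V M_vanishes err_vanishes err_vanishes])
  define Y where "Y w = J w - (\<integral>s. g s * X s w \<partial>unit_leb)" for w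
  define Yk where "Yk k w = K (r k) 1 w - (\<integral>s. c (r k) s * Xs (r k) s w \<partial>unit_leb)" for k w
  define Dk where "Dk k w = exp (Is (r k) 1 w - energy (Xs (r k)) w / 2)" for k w
  note s = simple_pair_section[OF c(1)]
  have cr: "(\<lambda>k. sq_dist (c (r k)) g) \<longlonglongrightarrow> 0"
    using LIMSEQ_subseq_LIMSEQ[OF c(2) r(1)] by (simp add: comp_def)
  have AE: "AE w in C. (\<lambda>k. Yk k w) \<longlonglongrightarrow> Y w \<and> (\<lambda>k. Dk k w) \<longlonglongrightarrow> D w"
    using r(2) X_square_integrable AE_space[of C]
  proof eventually_elim
    case (elim w)
    then have w: "w \<in> space \<gamma>" by simp
    from elim(1) have z: "(\<lambda>k. K (r k) 1 w - J w) \<longlonglongrightarrow> 0" "(\<lambda>k. Is (r k) 1 w - M 1 w) \<longlonglongrightarrow> 0"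
      and E0: "(\<lambda>k. err (r k) w) \<longlonglongrightarrow> 0"
      by blast+
    note K = z(1)[folded Lim_null] and I = z(2)[folded Lim_null]
    have "(\<lambda>k. \<integral>x. c (r k) x * Xs (r k) x w \<partial>unit_leb) \<longlonglongrightarrow> (\<integral>x. g x * X x w \<partial>unit_leb)"
      by (rule tendsto_integral_mult_L2[OF s g Xs_section X_section[OF w] elim(2) cr E0])
    then have "(\<lambda>k. Yk k w) \<longlonglongrightarrow> Y w" unfolding Yk_def Y_def by (intro tendsto_diff K)
    moreover have "(\<lambda>k. Dk k w) \<longlonglongrightarrow> D w"
      unfolding Dk_def D_def using energy_converges[OF w elim(2) E0] by (intro tendsto_intros I) auto
    ultimately show ?case ..
  qed
  have Ykm: "Yk k \<in> borel_measurable C" for k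
    unfolding Yk_def by (intro borel_measurable_diff simple_pair_end_measurable[OF c(1)] simple_pair_cross_measurable[OF Xs_simple c(1)])
  \<comment> \<open>\<open>g\<close> is only Lebesgue measurable in time, whereas joint
    measurability is available over the Borel sets. Measurability is instead inherited from the
    almost sure limit of the \<open>Yk\<close>.\<close>
  show Ym': "(\<lambda>w. J w - (\<integral>s. g s * X s w \<partial>unit_leb)) \<in> borel_measurable C"
  proof (rule borel_measurable_AE_cong)
    show "(\<lambda>w. lim (\<lambda>k. Yk k w)) \<in> borel_measurable C" by (rule borel_measurable_lim_metric[OF Ykm])
    show "AE w in C. lim (\<lambda>k. Yk k w) = J w - (\<integral>s. g s * X s w \<partial>unit_leb)"
      using AE unfolding Y_def by eventually_elim (auto intro: limI)
  qed
  then have Ym: "Y \<in> borel_measurable C" unfolding Y_def .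
  note t = simple_pair_tilted_char[OF Xs_simple c(1)]
  have Dki: "integrable C (Dk k)" "(\<integral>w. Dk k w \<partial>C) = 1" for k
    using t(1,2) unfolding Dk_def by auto
  have tk: "(\<integral>w. of_real (Dk k w) * iexp (Yk k w) \<partial>C) = of_real (exp (- (sq_norm (c (r k)) / 2)))"
     "(\<lambda>w. of_real (Dk k w) * iexp (Yk k w)) \<in> borel_measurable C" for k
    using t(3)[of "r k" "r k"] t(4)[of "r k" "r k"] unfolding Dk_def Yk_def .
  have Dm: "D \<in> borel_measurable C" and Dkm: "\<And>k. Dk k \<in> borel_measurable C"
    using D(1) Dki(1) by auto
  have D0: "D w \<ge> 0" "Dk k w \<ge> 0" for w k by (simp_all add: D_def Dk_def)
  have "(\<lambda>k. \<integral>\<^sup>+ w. norm (Dk k w - D w) \<partial>C) \<longlonglongrightarrow> 0"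
  proof (rule Scheffe_lemma2[OF Dkm D(1)])
    show "AE w in C. (\<lambda>k. Dk k w) \<longlonglongrightarrow> D w" using AE by eventually_elim simp
    have "(\<integral>\<^sup>+ w. norm (D w) \<partial>C) = 1"
      using nn_integral_eq_integral[OF D(1)] D0 D(2) by simp
    moreover have "(\<integral>\<^sup>+ w. norm (Dk k w) \<partial>C) = 1" for k
      using nn_integral_eq_integral[OF Dki(1)[of k]] D0 Dki(2)[of k] by simp
    ultimately show "(\<integral>\<^sup>+ w. norm (Dk k w) \<partial>C) \<le> (\<integral>\<^sup>+ w. norm (D w) \<partial>C)" for k by simp
  qed
  then have "(\<lambda>k. enn2real (\<integral>\<^sup>+ w. norm (Dk k w - D w) \<partial>C)) \<longlonglongrightarrow> 0"
    by (intro tendsto_enn2real) auto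
  moreover have "enn2real (\<integral>\<^sup>+ w. norm (Dk k w - D w) \<partial>C) = (\<integral>w. norm (Dk k w - D w) \<partial>C)" for k
    using D(1) Dki(1)[of k] by (intro integral_eq_nn_integral[symmetric]) auto
  ultimately have L1: "(\<lambda>k. \<integral>w. norm (Dk k w - D w) \<partial>C) \<longlonglongrightarrow> 0" by simp
  have iD: "integrable C (\<lambda>w. complex_of_real (D w) * iexp (Yk k w))" for k
    using D(1) Ykm[of k] by (intro Bochner_Integration.integrable_bound[OF D(1)]) (auto simp: norm_mult)
  have iDk: "integrable C (\<lambda>w. complex_of_real (Dk k w) * iexp (Yk k w))" for k
    using Dki(1)[of k] tk(2)[of k] by (intro Bochner_Integration.integrable_bound[OF Dki(1)[of k]]) (auto simp: norm_mult)
  \<comment> \<open>The two limits are taken one after the other. Replacing \<open>Dk\<close> by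
    \<open>D\<close> costs at most their L1 distance, since the imaginary exponential has modulus 1;
    afterwards the fixed \<open>D\<close> dominates the passage from \<open>Yk\<close> to
    \<open>Y\<close>.\<close>
  have "(\<lambda>k. (\<integral>w. of_real (Dk k w) * iexp (Yk k w) \<partial>C) - (\<integral>w. of_real (D w) * iexp (Yk k w) \<partial>C)) \<longlonglongrightarrow> 0"
  proof (rule Lim_null_comparison[OF _ L1], intro always_eventually allI)
    fix k
    have "norm ((\<integral>w. of_real (Dk k w) * iexp (Yk k w) \<partial>C) - (\<integral>w. of_real (D w) * iexp (Yk k w) \<partial>C)) =
      norm (\<integral>w. of_real (Dk k w) * iexp (Yk k w) - of_real (D w) * iexp (Yk k w) \<partial>C)"
      by (subst Bochner_Integration.integral_diff[OF iDk iD]) simp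
    also have "\<dots> \<le> (\<integral>w. norm (of_real (Dk k w) * iexp (Yk k w) - of_real (D w) * iexp (Yk k w)) \<partial>C)"
      by (rule integral_norm_bound)
    also have "\<dots> = (\<integral>w. norm (Dk k w - D w) \<partial>C)"
    proof (intro Bochner_Integration.integral_cong refl)
      fix w
      have "of_real (Dk k w) * iexp (Yk k w) - of_real (D w) * iexp (Yk k w) = of_real (Dk k w - D w) * iexp (Yk k w)"
        by (simp add: left_diff_distrib)
      then show "norm (of_real (Dk k w) * iexp (Yk k w) - of_real (D w) * iexp (Yk k w)) = norm (Dk k w - D w)"
        by (simp add: norm_mult del: of_real_diff)
    qed
    finally show "norm ((\<integral>w. of_real (Dk k w) * iexp (Yk k w) \<partial>C) - (\<integral>w. of_real (D w) * iexp (Yk k w) \<partial>C)) \<le> (\<integral>w. norm (Dk k w - D w) \<partial>C)" .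
  qed
  moreover have "(\<lambda>k. \<integral>w. of_real (D w) * iexp (Yk k w) \<partial>C) \<longlonglongrightarrow> (\<integral>w. of_real (D w) * iexp (Y w) \<partial>C)"
  proof (rule integral_dominated_convergence[where w=D])
    show "(\<lambda>w. of_real (D w) * iexp (Y w)) \<in> borel_measurable C" using Dm Ym by measurable
    show "(\<lambda>w. of_real (D w) * iexp (Yk k w)) \<in> borel_measurable C" for k using Dm Ykm[of k] by measurable
    show "AE w in C. (\<lambda>k. of_real (D w) * iexp (Yk k w)) \<longlonglongrightarrow> of_real (D w) * iexp (Y w)"
      using AE by eventually_elim (auto intro!: tendsto_intros)
    show "AE w in C. norm (complex_of_real (D w) * iexp (Yk k w)) \<le> D w" for k
      by (simp add: norm_mult D0)
  qed (rule D(1))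
  ultimately have 1: "(\<lambda>k. \<integral>w. of_real (Dk k w) * iexp (Yk k w) \<partial>C) \<longlonglongrightarrow> (\<integral>w. of_real (D w) * iexp (Y w) \<partial>C)"
    using tendsto_add by fastforce
  have "(\<lambda>k. complex_of_real (exp (- (sq_norm (c (r k)) / 2)))) \<longlonglongrightarrow> of_real (exp (- (sq_norm g / 2)))"
    using LIMSEQ_subseq_LIMSEQ[OF e r(1)] by (simp add: comp_def)
  then show "(\<integral>w. of_real (D w) * iexp (J w - (\<integral>s. g s * X s w \<partial>unit_leb)) \<partial>C) = of_real (exp (- (sq_norm g / 2)))"
    using 1 unfolding tk(1) Y_def by (rule LIMSEQ_unique[rotated])
qed

end

section \<open>From linear forms to polynomials\<close>

text \<open>Iterated forward differences, with the steps taken from the list. Each step lowers the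
  degree of a polynomial, so as many steps as the degree leave a constant.\<close>

primrec differences :: "real list \<Rightarrow> (real \<Rightarrow> real) \<Rightarrow> real \<Rightarrow> real" where
  "differences [] f y = f y"
| "differences (v # vs) f y = differences vs f (y + v) - differences vs f y"

lemma differences_shift: "differences vs f (y + x) = differences vs (\<lambda>z. f (z + x)) y"
proof (induction vs arbitrary: y)
  case (Cons v vs)
  have "y + x + v = (y + v) + x" by simp
  then show ?case using Cons[of "y + v"] Cons[of y] by (simp only: differences.simps)
qed simp

lemma differences_sum: "differences vs (\<lambda>z. \<Sum>i\<in>A. c i * f i z) y = (\<Sum>i\<in>A. c i * differences vs (f i) y)"
  by (induction vs arbitrary: y) (simp_all add: sum_subtractf[symmetric] right_diff_distrib)

lemma differences_diff: "differences vs (\<lambda>z. f z - g z) y = differences vs f y - differences vs g y"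
  by (induction vs arbitrary: y) simp_all

text \<open>Polarization: iterated differences express the product of \<open>k\<close> numbers through \<open>k\<close>-th powers of
  their partial sums.\<close>

lemma differences_power:
  "j \<le> length vs \<Longrightarrow> differences vs (\<lambda>z. z ^ j) y = (if j = length vs then fact j * prod_list vs else 0)"
proof (induction vs arbitrary: j y)
  case (Cons v vs)
  \<comment> \<open>Only powers below \<open>j\<close> survive one difference; of these, the
    induction hypothesis keeps the single power \<open>i = length vs\<close>.\<close>
  have "(z + v) ^ j - z ^ j = (\<Sum>i<j. (of_nat (j choose i) * v ^ (j - i)) * z ^ i)" for z :: real
  proof -
    have "(z + v) ^ j = (\<Sum>i\<le>j. of_nat (j choose i) * z ^ i * v ^ (j - i))" by (rule binomial_ring)
    also have "\<dots> = (\<Sum>i<j. of_nat (j choose i) * z ^ i * v ^ (j - i)) + z ^ j"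
      by (simp add: lessThan_Suc_atMost[symmetric])
    finally show ?thesis by (simp add: mult_ac)
  qed
  then have "differences (v # vs) (\<lambda>z. z ^ j) y = differences vs (\<lambda>z. \<Sum>i<j. (of_nat (j choose i) * v ^ (j - i)) * z ^ i) y"
    by (simp add: differences_shift differences_diff[symmetric])
  also have "\<dots> = (\<Sum>i<j. (of_nat (j choose i) * v ^ (j - i)) * differences vs (\<lambda>z. z ^ i) y)"
    by (rule differences_sum)
  also have "\<dots> = (\<Sum>i<j. if i = length vs then of_nat (j choose i) * v ^ (j - i) * (fact i * prod_list vs) else 0)"
    using Cons.prems by (intro sum.cong refl) (simp add: Cons.IH)
  also have "\<dots> = (if length vs < j then of_nat (j choose length vs) * v ^ (j - length vs) * (fact (length vs) * prod_list vs) else 0)"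
    by simp
  also have "\<dots> = (if j = length (v # vs) then fact j * prod_list (v # vs) else 0)"
    using Cons.prems by (auto simp: not_less)
  finally show ?case .
qed simp

text \<open>Each index is listed as often as its exponent says, which turns a monomial into the
  product that polarization produces.\<close>

lemma monomial_as_prod_list:
  assumes "finite K"
  shows "\<exists>is. set is \<subseteq> K \<and> (\<forall>x :: nat \<Rightarrow> real. (\<Prod>i\<in>K. x i ^ e i) = prod_list (map x is))"
  using assms
proof (induction K)
  case (insert i K)
  then obtain js where js: "set js \<subseteq> K" "\<And>x :: nat \<Rightarrow> real. (\<Prod>i\<in>K. x i ^ e i) = prod_list (map x js)" by blast
  have "(\<Prod>i\<in>insert i K. x i ^ e i) = prod_list (map x (replicate (e i) i @ js))" for x :: "nat \<Rightarrow> real"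
    using insert.hyps js by (simp add: map_replicate)
  then show ?case using js by (intro exI[of _ "replicate (e i) i @ js"]) auto
qed (auto intro: exI[of _ "[]"])

text \<open>Isolates the algebra from the probability: powers of one-dimensional linear forms are
  the only input, so no joint law of several Wiener integrals enters.\<close>

locale matching_linear_moments =
  fixes M :: "'a measure" and D :: "'a \<Rightarrow> real" and X Y :: "nat \<Rightarrow> 'a \<Rightarrow> real" and N :: nat
  assumes matching: "\<And>(a :: nat \<Rightarrow> real) k.
      integrable M (\<lambda>w. D w * (\<Sum>i<N. a i * X i w) ^ k) \<and>
      integrable M (\<lambda>w. (\<Sum>i<N. a i * Y i w) ^ k) \<and>
      (\<integral>w. D w * (\<Sum>i<N. a i * X i w) ^ k \<partial>M) = (\<integral>w. (\<Sum>i<N. a i * Y i w) ^ k \<partial>M)"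
begin

definition matches :: "((nat \<Rightarrow> real) \<Rightarrow> real) \<Rightarrow> bool" where
  "matches f \<longleftrightarrow> integrable M (\<lambda>w. D w * f (\<lambda>i. X i w)) \<and> integrable M (\<lambda>w. f (\<lambda>i. Y i w)) \<and>
     (\<integral>w. D w * f (\<lambda>i. X i w) \<partial>M) = (\<integral>w. f (\<lambda>i. Y i w) \<partial>M)"

lemma matches_diff: "matches f \<Longrightarrow> matches g \<Longrightarrow> matches (\<lambda>x. f x - g x)"
  unfolding matches_def by (simp add: right_diff_distrib)

lemma matches_scale:
  assumes "matches f"
  shows "matches (\<lambda>x. c * f x)"
proof -
  have e: "D w * (c * r) = c * (D w * r)" for w r by simp
  show ?thesis using assms unfolding matches_def e by simp
qed

lemma matches_sum: "(\<And>i. i \<in> A \<Longrightarrow> matches (f i)) \<Longrightarrow> matches (\<lambda>x. \<Sum>i\<in>A. f i x)"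
  unfolding matches_def by (simp add: sum_distrib_left)

text \<open>A difference with step \<open>x i\<close> raises the coefficient \<open>a i\<close> by
  1, so it leads from one linear form to another. This is why the induction is over arbitrary
  \<open>a\<close>.\<close>

lemma matches_differences:
  "set is \<subseteq> {..<N} \<Longrightarrow> matches (\<lambda>x. differences (map x is) (\<lambda>y. y ^ k) (\<Sum>i<N. a i * x i))"
proof (induction "is" arbitrary: a)
  case Nil
  then show ?case using matching[of a k] by (simp add: matches_def)
next
  case (Cons i js)
  then have i: "i < N" by simp
  have e: "(\<Sum>j<N. (a(i := a i + 1)) j * x j) = (\<Sum>j<N. a j * x j) + x i" for x :: "nat \<Rightarrow> real"
  proof -
    have "(\<Sum>j<N. (a(i := a i + 1)) j * x j) = (\<Sum>j<N. a j * x j + (if j = i then x j else 0))"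
      by (intro sum.cong refl) (simp add: algebra_simps)
    then show ?thesis using i by (simp add: sum.distrib)
  qed
  have "matches (\<lambda>x. differences (map x js) (\<lambda>y. y ^ k) (\<Sum>j<N. (a(i := a i + 1)) j * x j) -
      differences (map x js) (\<lambda>y. y ^ k) (\<Sum>j<N. a j * x j))"
    using Cons by (intro matches_diff Cons.IH) auto
  then show ?case unfolding e by simp
qed

lemma matches_monomial:
  assumes "set is \<subseteq> {..<N}"
  shows "matches (\<lambda>x. prod_list (map x is))"
proof -
  have "matches (\<lambda>x. (1 / fact (length is)) * differences (map x is) (\<lambda>y. y ^ length is) (\<Sum>i<N. 0 * x i))"
    by (intro matches_scale matches_differences assms)
  then show ?thesis by (simp add: differences_power)
qed

lemma matches_polynomial:
  assumes "polynomial_in N p"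
  shows "matches (poly_eval p)"
proof -
  have "matches (\<lambda>x. \<Sum>m\<in>Poly_Mapping.keys p. Poly_Mapping.lookup p m *
        (\<Prod>i\<in>Poly_Mapping.keys m. x i ^ Poly_Mapping.lookup m i))"
  proof (intro matches_sum matches_scale)
    fix m assume "m \<in> Poly_Mapping.keys p"
    then have m: "Poly_Mapping.keys m \<subseteq> {..<N}" using assms by (auto simp: polynomial_in_def)
    obtain js where "set js \<subseteq> Poly_Mapping.keys m"
      "\<And>x :: nat \<Rightarrow> real. (\<Prod>i\<in>Poly_Mapping.keys m. x i ^ Poly_Mapping.lookup m i) = prod_list (map x js)"
      using monomial_as_prod_list[OF finite_keys[of m], of "Poly_Mapping.lookup m"] by blast
    then show "matches (\<lambda>x. \<Prod>i\<in>Poly_Mapping.keys m. x i ^ Poly_Mapping.lookup m i)"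
      using matches_monomial[of js] m by simp
  qed
  then show ?thesis unfolding poly_eval_def[abs_def] .
qed

end

section \<open>Girsanov on polynomial functionals\<close>

context wiener_space
begin

lemma integrable_AE_cong:
  fixes f g :: "path \<Rightarrow> real"
  assumes f: "integrable C f" and eq: "AE w in C. f w = g w"
  shows "integrable C g" "(\<integral>w. g w \<partial>C) = (\<integral>w. f w \<partial>C)"
proof -
  have fm: "f \<in> borel_measurable C" using f by (rule borel_measurable_integrable)
  have gm: "g \<in> borel_measurable C" by (rule borel_measurable_AE_cong[OF fm eq])
  show "integrable C g" using integrable_cong_AE[OF fm gm eq] f by simp
  show "(\<integral>w. g w \<partial>C) = (\<integral>w. f w \<partial>C)" using integral_cong_AE[OF fm gm eq] by simp
qed

text \<open>By its characteristic function, \<open>J\<close> has the law of \<open>?s * x\<close>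
  with \<open>x\<close> standard normal. Scaling, rather than a density of variance
  \<open>sq_norm g\<close>, includes the degenerate case where that variance is 0.\<close>

lemma wiener_int_moments:
  assumes J: "wiener_int g J"
  shows "integrable C (\<lambda>w. J w ^ k)"
proof -
  let ?s = "sqrt (sq_norm g)"
  have Jm[measurable]: "J \<in> borel_measurable C" using J by (simp add: wiener_int_def)
  interpret n: real_distribution std_normal_distribution by (rule real_dist_normal_dist)
  have sm: "(\<lambda>x. ?s * x) \<in> borel_measurable std_normal_distribution" by simp
  have eq: "distr C borel J = distr std_normal_distribution borel (\<lambda>x. ?s * x)"
  proof (rule Levy_uniqueness)
    show "real_distribution (distr C borel J)" by (rule real_distribution_distr) fact
    show "real_distribution (distr std_normal_distribution borel (\<lambda>x. ?s * x))"
      by (rule n.real_distribution_distr) (rule sm)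
    show "char (distr C borel J) = char (distr std_normal_distribution borel (\<lambda>x. ?s * x))"
    proof
      fix t
      have "char (distr C borel J) t = (\<integral>w. iexp (t * J w) \<partial>C)"
        unfolding char_def by (subst integral_distr) auto
      also have "\<dots> = of_real (exp (- ((\<integral>x. (t * g x)\<^sup>2 \<partial>unit_leb) / 2)))"
        by (rule wiener_int_char[OF wiener_int_scale[OF J]])
      also have "\<dots> = of_real (exp (- ((t * ?s)\<^sup>2 / 2)))" by (simp add: power_mult_distrib)
      also have "\<dots> = char std_normal_distribution (t * ?s)" by (simp add: char_std_normal_distribution)
      also have "\<dots> = char (distr std_normal_distribution borel (\<lambda>x. ?s * x)) t"
        unfolding char_def by (subst integral_distr) (auto simp: mult.assoc)
      finally show "char (distr C borel J) t = char (distr std_normal_distribution borel (\<lambda>x. ?s * x)) t" .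
    qed
  qed
  have "integrable std_normal_distribution (\<lambda>x. ?s ^ k * x ^ k)"
    using integrable_std_normal_distribution_moment[of k] by simp
  then have "integrable (distr std_normal_distribution borel (\<lambda>x. ?s * x)) (\<lambda>x. x ^ k)"
    by (subst integrable_distr_eq) (auto simp: power_mult_distrib)
  then show ?thesis unfolding eq[symmetric] by (subst (asm) integrable_distr_eq) auto
qed

end

text \<open>The shifted integral under \<open>Q\<close> and \<open>J\<close> under \<open>C\<close>
  have the same characteristic function, hence the same law. Integrability of the power against
  \<open>D\<close> is transferred along with its value.\<close>

lemma (in ito_approximation) tilted_moments:
  assumes J: "wiener_int g J" 
  defines "D \<equiv> \<lambda>w. exp (M 1 w - energy X w / 2)"
  assumes D: "integrable C D" "(\<integral>w. D w \<partial>C) = 1"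
  shows "integrable C (\<lambda>w. D w * (J w - (\<integral>s. g s * X s w \<partial>unit_leb)) ^ k)"
    and "(\<integral>w. D w * (J w - (\<integral>s. g s * X s w \<partial>unit_leb)) ^ k \<partial>C) = (\<integral>w. J w ^ k \<partial>C)"
proof -
  define Y where "Y w = J w - (\<integral>s. g s * X s w \<partial>unit_leb)" for w
  define Q where "Q = density C (\<lambda>w. ennreal (D w))"
  note D' = D[unfolded D_def]
  have Jm[measurable]: "J \<in> borel_measurable C" using J by (simp add: wiener_int_def)
  have Ym[measurable]: "Y \<in> borel_measurable C" unfolding Y_def by (rule tilted_char_limit(1)[OF J D'])
  have Dm[measurable]: "D \<in> borel_measurable C" using D(1) by (rule borel_measurable_integrable)
  have D0: "D w \<ge> 0" for w by (simp add: D_def)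
  have "emeasure Q (space Q) = emeasure Q (space C)" by (simp add: Q_def)
  also have "\<dots> = (\<integral>\<^sup>+ w. ennreal (D w) * indicator (space C) w \<partial>C)"
    unfolding Q_def by (rule emeasure_density) (use Dm in measurable)
  also have "\<dots> = (\<integral>\<^sup>+ w. ennreal (D w) \<partial>C)" by (intro nn_integral_cong) simp
  also have "\<dots> = 1" using nn_integral_eq_integral[OF D(1)] D0 D(2) by simp
  finally interpret Q: prob_space Q by (rule prob_spaceI)
  have YQ: "Y \<in> borel_measurable Q" unfolding Q_def using Ym by simp
  have eq: "distr Q borel Y = distr C borel J"
  proof (rule Levy_uniqueness)
    show "real_distribution (distr Q borel Y)" by (rule Q.real_distribution_distr) (rule YQ)
    show "real_distribution (distr C borel J)" by (rule real_distribution_distr) (rule Jm)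
    show "char (distr Q borel Y) = char (distr C borel J)"
    proof
      fix t
      have "char (distr Q borel Y) t = (\<integral>w. iexp (t * Y w) \<partial>Q)"
        unfolding char_def using YQ by (subst integral_distr) auto
      also have "\<dots> = (\<integral>w. D w *\<^sub>R iexp (t * Y w) \<partial>C)"
        unfolding Q_def using Dm Ym D0 by (intro integral_density) auto
      \<comment> \<open>The Fourier variable \<open>t\<close> is absorbed into the integrand, so the
        limit lemma applied to \<open>t * g\<close> gives the characteristic function at every
        \<open>t\<close>.\<close>
      also have "\<dots> = (\<integral>w. of_real (D w) * iexp ((t * J w) - (\<integral>s. (t * g s) * X s w \<partial>unit_leb)) \<partial>C)"
        by (simp add: Y_def scaleR_conv_of_real right_diff_distrib mult.assoc)
      also have "\<dots> = of_real (exp (- ((\<integral>x. (t * g x)\<^sup>2 \<partial>unit_leb) / 2)))"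
        unfolding D_def by (rule tilted_char_limit(2)[OF wiener_int_scale[OF J] D'])
      also have "\<dots> = (\<integral>w. iexp (t * J w) \<partial>C)"
        by (rule wiener_int_char[OF wiener_int_scale[OF J], symmetric])
      also have "\<dots> = char (distr C borel J) t"
        unfolding char_def by (subst integral_distr) auto
      finally show "char (distr Q borel Y) t = char (distr C borel J) t" .
    qed
  qed
  have "integrable (distr C borel J) (\<lambda>x. x ^ k)"
    using wiener_int_moments[OF J, of k] by (subst integrable_distr_eq) auto
  then have "integrable Q (\<lambda>w. Y w ^ k)"
    unfolding eq[symmetric] using YQ by (subst (asm) integrable_distr_eq) auto
  then have i: "integrable C (\<lambda>w. D w * Y w ^ k)"
    unfolding Q_def using D0 by (subst (asm) integrable_density) auto
  then show "integrable C (\<lambda>w. D w * (J w - (\<integral>s. g s * X s w \<partial>unit_leb)) ^ k)" unfolding Y_def .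
  have "(\<integral>w. D w * Y w ^ k \<partial>C) = (\<integral>w. Y w ^ k \<partial>Q)"
    unfolding Q_def using D0 by (subst integral_density) auto
  also have "\<dots> = (\<integral>x. x ^ k \<partial>distr Q borel Y)" using YQ by (subst integral_distr) auto
  also have "\<dots> = (\<integral>w. J w ^ k \<partial>C)" unfolding eq by (subst integral_distr) auto
  finally show "(\<integral>w. D w * (J w - (\<integral>s. g s * X s w \<partial>unit_leb)) ^ k \<partial>C) = (\<integral>w. J w ^ k \<partial>C)" unfolding Y_def .
qed

text \<open>At time 0 the partition without cells is admissible and its sum is empty, so
  \<open>A 0\<close> itself has arbitrarily small tails. The value is used to start the stochastic
  exponential at 1.\<close>

lemma (in wiener_space) quadratic_variation_zero:
  assumes "quadratic_variation \<gamma> M A"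
  shows "AE w in C. A 0 w = 0"
proof -
  have "(0::real) \<in> {0..1}" by simp
  then have q: "\<forall>\<epsilon>>0. \<exists>\<delta>>0. \<forall>(n::nat) s. s 0 = 0 \<and> s n = 0 \<and> (\<forall>i<n. s i \<le> s (Suc i) \<and> s (Suc i) - s i < \<delta>) \<longrightarrow>
      measure C {w \<in> space \<gamma>. \<bar>(\<Sum>i<n. (M (s (Suc i)) w - M (s i) w)\<^sup>2) - A 0 w\<bar> > \<epsilon>} < \<epsilon>"
    using assms unfolding quadratic_variation_def by blast
  have p: "tail_prob (A 0) \<epsilon> < \<epsilon>" if \<epsilon>: "\<epsilon> > 0" for \<epsilon>
  proof -
    from q[THEN spec, THEN mp, OF \<epsilon>] obtain \<delta> where 
      d: "\<forall>(n::nat) s. s 0 = 0 \<and> s n = 0 \<and> (\<forall>i<n. s i \<le> s (Suc i) \<and> s (Suc i) - s i < \<delta>) \<longrightarrow>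
      measure C {w \<in> space \<gamma>. \<bar>(\<Sum>i<n. (M (s (Suc i)) w - M (s i) w)\<^sup>2) - A 0 w\<bar> > \<epsilon>} < \<epsilon>"
      by (elim exE conjE) (rule that)
    show ?thesis using spec[OF spec[OF d, of 0], of "\<lambda>_. 0"] by simp
  qed
  have m: "A 0 \<in> borel_measurable C"
    using assms F_measurable_C[of 0 "A 0" borel] by (simp add: quadratic_variation_def adapted_process_def)
  have "vanishes_in_prob (\<lambda>_. A 0)"
    by (rule vanishes_in_prob_rate) (rule m, rule p, simp)
  then show ?thesis by (rule vanishes_in_prob_const)
qed

theorem corollary3p5:
  fixes \<gamma> :: "path measure"
    and bracket :: "path \<Rightarrow> path \<Rightarrow> real"
    and Z :: "path \<Rightarrow> path"
    and Zdot M A :: "real \<Rightarrow> path \<Rightarrow> real"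
  assumes "wiener_measure \<gamma>"
    and "\<forall>h\<in>cameron_martin. wiener_integral \<gamma> h (bracket h)"
    and "predictable_map \<gamma> Z Zdot"
    and "ito_integral \<gamma> Zdot M"
    and "quadratic_variation \<gamma> M A"
    and "martingale \<gamma> (stochastic_exponential M A)"
  shows "\<forall>f\<in>polynomial_functionals.
      integrable (completion \<gamma>)
        (\<lambda>w. stochastic_exponential M A 1 w * f (\<lambda>h. bracket h w - cm_inner h (Z w))) \<and>
      integrable (completion \<gamma>) (\<lambda>w. f (\<lambda>h. bracket h w)) \<and>
      (\<integral>w. stochastic_exponential M A 1 w * f (\<lambda>h. bracket h w - cm_inner h (Z w))
          \<partial>completion \<gamma>)
        = (\<integral>w. f (\<lambda>h. bracket h w) \<partial>completion \<gamma>)"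
proof
  fix f assume "f \<in> polynomial_functionals"
  then obtain N p h where p: "polynomial_in N p" and h: "\<And>i. i < N \<Longrightarrow> h i \<in> cameron_martin"
    and f: "f = (\<lambda>\<omega>. poly_eval p (\<lambda>i. \<omega> (h i)))"
    unfolding polynomial_functionals_def by blast
  interpret wiener_space \<gamma> by standard fact
  obtain n t \<xi> where simple: "\<And>k::nat. simple_integrand \<gamma> (n k) (t k) (\<xi> k)"
    and lim: "\<And>\<epsilon>. \<epsilon> > 0 \<Longrightarrow>
          (\<lambda>k. measure C {w \<in> space \<gamma>. (\<integral>\<^sup>+ s. ennreal ((step_process (n k) (t k) (\<xi> k) s w - Zdot s w)\<^sup>2)
                                 \<partial>unit_leb) > ennreal \<epsilon>}) \<longlonglongrightarrow> 0 \<and>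
          (\<lambda>k. measure C {w \<in> space \<gamma>. \<exists>s\<in>{0..1}. \<bar>step_integral (n k) (t k) (\<xi> k) s w - M s w\<bar> > \<epsilon>}) \<longlonglongrightarrow> 0"
    using assms(4) unfolding ito_integral_def by blast
  interpret ito_approximation \<gamma> Zdot M n t \<xi>
  proof
    show "predictable_process \<gamma> Zdot" "AE w in \<gamma>. (\<integral>\<^sup>+ s. ennreal ((Zdot s w)\<^sup>2) \<partial>unit_leb) < \<infinity>"
      "adapted_process \<gamma> M" "continuous_process \<gamma> M"
      using assms(4) unfolding ito_integral_def by blast+
  qed (use simple lim in blast)+
  define S where "S = stochastic_exponential M A"
  define D where "D w = exp (M 1 w - energy Zdot w / 2)" for w
  have SD: "AE w in C. S 1 w = D w"
    using bracket_eq_energy[OF assms(5)] by eventually_elim (simp add: S_def D_def stochastic_exponential_def)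
  have S0: "AE w in C. S 0 w = 1"
    using quadratic_variation_zero[OF assms(5)] M_zero by eventually_elim (simp add: S_def stochastic_exponential_def)
  have Si: "integrable C (S 1)" and S0m: "S 0 \<in> borel_measurable (F 0)"
    and Sc: "AE w in C. real_cond_exp C (F 0) (S 1) w = S 0 w"
    using assms(6) unfolding martingale_def adapted_process_def S_def by auto
  \<comment> \<open>The expectation is passed back to time 0 by the conditional expectation, and
    there the exponential is almost surely 1.\<close>
  have S1: "(\<integral>w. S 1 w \<partial>C) = 1"
  proof -
    interpret sub: finite_measure_subalgebra C "F 0"
      by standard (rule subalgebra_F, simp)
    have "AE w in C. real_cond_exp C (F 0) (S 1) w = 1" using Sc S0 by eventually_elim simp
    from integrable_AE_cong(2)[OF sub.real_cond_exp_int(1)[OF Si] this]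
    show ?thesis using sub.real_cond_exp_int(2)[OF Si] by (simp add: base.prob_space)
  qed
  have D: "integrable C D" "(\<integral>w. D w \<partial>C) = 1"
    using integrable_AE_cong[OF Si SD] S1 by simp_all
  note D' = D[unfolded D_def]
  have J: "wiener_int (deriv (h i)) (bracket (h i))" if "i < N" for i
    using wiener_integral_wiener_int[OF h[OF that]] assms(2) h[OF that] by blast
  define Xi where "Xi i w = bracket (h i) w - (\<integral>s. deriv (h i) s * Zdot s w \<partial>unit_leb)" for i w
  interpret matching_linear_moments C D Xi "\<lambda>i. bracket (h i)" N
  proof
    fix a :: "nat \<Rightarrow> real" and k
    let ?g = "\<lambda>x. \<Sum>i<N. a i * deriv (h i) x" and ?J = "\<lambda>w. \<Sum>i<N. a i * bracket (h i) w"
    have W: "wiener_int ?g ?J" by (rule wiener_int_sum) (use J in auto)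
    \<comment> \<open>Linearity of the time integral uses the square integrability of the section of
      \<open>Zdot\<close>, which holds only almost surely.\<close>
    have "AE w in C. D w * (?J w - (\<integral>s. ?g s * Zdot s w \<partial>unit_leb)) ^ k = D w * (\<Sum>i<N. a i * Xi i w) ^ k"
      using X_square_integrable AE_space[of C]
    proof eventually_elim
      case (elim w)
      have i: "integrable unit_leb (\<lambda>s. deriv (h i) s * Zdot s w)" if "i < N" for i
        using J[OF that] elim X_section[of w] by (intro integrable_mult_of_squares) (auto simp: wiener_int_def)
      have "(\<integral>s. ?g s * Zdot s w \<partial>unit_leb) = (\<integral>s. (\<Sum>i<N. a i * (deriv (h i) s * Zdot s w)) \<partial>unit_leb)"
        by (simp add: sum_distrib_right mult.assoc)
      also have "\<dots> = (\<Sum>i<N. a i * (\<integral>s. deriv (h i) s * Zdot s w \<partial>unit_leb))"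
        using i by (subst Bochner_Integration.integral_sum) auto
      finally show ?case by (simp add: Xi_def right_diff_distrib sum_subtractf)
    qed
    note c = integrable_AE_cong[OF tilted_moments(1)[OF W D', of k, folded D_def] this]
    show "integrable C (\<lambda>w. D w * (\<Sum>i<N. a i * Xi i w) ^ k) \<and>
      integrable C (\<lambda>w. (\<Sum>i<N. a i * bracket (h i) w) ^ k) \<and>
      (\<integral>w. D w * (\<Sum>i<N. a i * Xi i w) ^ k \<partial>C) = (\<integral>w. (\<Sum>i<N. a i * bracket (h i) w) ^ k \<partial>C)"
      using c tilted_moments(2)[OF W D', of k, folded D_def] wiener_int_moments[OF W, of k] by simp
  qed
  have P: "integrable C (\<lambda>w. D w * poly_eval p (\<lambda>i. Xi i w))" "integrable C (\<lambda>w. poly_eval p (\<lambda>i. bracket (h i) w))"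
    "(\<integral>w. D w * poly_eval p (\<lambda>i. Xi i w) \<partial>C) = (\<integral>w. poly_eval p (\<lambda>i. bracket (h i) w) \<partial>C)"
    using matches_polynomial[OF p] unfolding matches_def by auto
  have ZAE: "AE w in C. Z w \<in> cameron_martin \<and> (AE t in unit_leb. (Z w has_real_derivative Zdot t w) (at t))"
    using assms(3) AE_completion unfolding predictable_map_def by blast
  have "AE w in C. D w * poly_eval p (\<lambda>i. Xi i w) = S 1 w * f (\<lambda>h. bracket h w - cm_inner h (Z w))"
    using SD ZAE AE_space[of C]
  proof eventually_elim
    case (elim w)
    have X: "Xi i w = bracket (h i) w - cm_inner (h i) (Z w)" if i: "i < N" for i
    proof -
      have m: "deriv (h i) \<in> borel_measurable unit_leb" "deriv (Z w) \<in> borel_measurable unit_leb" "(\<lambda>s. Zdot s w) \<in> borel_measurable unit_leb"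
        using h[OF i] elim X_section[of w] by (auto simp: cameron_martin_def square_integrable_def)
      have "AE t in unit_leb. (Z w has_real_derivative Zdot t w) (at t)" using elim by simp
      \<comment> \<open>For almost every time the predictable version equals the derivative of
        \<open>Z w\<close>, so the shift in the Wiener integral is the Cameron-Martin inner
        product.\<close>
      then have "AE t in unit_leb. deriv (h i) t * deriv (Z w) t = deriv (h i) t * Zdot t w"
        by eventually_elim (simp add: DERIV_imp_deriv)
      then have "cm_inner (h i) (Z w) = (\<integral>s. deriv (h i) s * Zdot s w \<partial>unit_leb)"
        unfolding cm_inner_def using m by (intro integral_cong_AE) auto
      then show ?thesis by (simp add: Xi_def)
    qed
    \<comment> \<open>The identity \<open>X\<close> covers the indices below \<open>N\<close>, for
      which \<open>h i\<close> is a Cameron-Martin path. The rewriting therefore goes inside the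
      monomials, whose variables are below \<open>N\<close>.\<close>
    have "poly_eval p (\<lambda>i. Xi i w) = poly_eval p (\<lambda>i. bracket (h i) w - cm_inner (h i) (Z w))"
      unfolding poly_eval_def
    proof (intro sum.cong prod.cong refl arg_cong2[where f="(*)"])
      fix m i assume "m \<in> Poly_Mapping.keys p" "i \<in> Poly_Mapping.keys m"
      then have "i < N" using p by (auto simp: polynomial_in_def)
      then show "Xi i w ^ Poly_Mapping.lookup m i = (bracket (h i) w - cm_inner (h i) (Z w)) ^ Poly_Mapping.lookup m i"
        using X[of i] by simp
    qed
    then show ?case using elim by (simp add: f)
  qed
  note c = integrable_AE_cong[OF P(1) this]
  show "integrable C (\<lambda>w. stochastic_exponential M A 1 w * f (\<lambda>h. bracket h w - cm_inner h (Z w))) \<and>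
      integrable C (\<lambda>w. f (\<lambda>h. bracket h w)) \<and>
      (\<integral>w. stochastic_exponential M A 1 w * f (\<lambda>h. bracket h w - cm_inner h (Z w)) \<partial>C)
        = (\<integral>w. f (\<lambda>h. bracket h w) \<partial>C)"
    using c P(2,3) unfolding S_def f by simp
qed

end
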